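(* Let $1\le m_1<m_2<\dots<m_t$ be integers and $r_1,\dots,r_t\ge 1$ integers with $r_1+\dots+r_t\ge 2$. Let $G$ be the group scheme over $\mathbb{Z}$ of $\mathbb{G}_m$-equivariant automorphisms of $\mathbb{A}^{r_1+\dots+r_t}-\{0\}$, for the weighted action in which the weight $m_i$ occurs $r_i$ times. Then there is a natural decomposition of $G$ as a semi-direct product $$G\cong U_t\rtimes\cdots\rtimes U_2\rtimes U_1\rtimes\big(\operatorname{GL}(r_1)\times\cdots\times\operatorname{GL}(r_t)\big),$$ where $U_a\cong\mathbb{A}^{r_ak_a}$ (note that $U_1$ is trivial). Furthermore, for every $1\le a\le t$, the (conjugation) action of $\operatorname{GL}(r_a)$ leaves each $U_b$ invariant, and: (i) When $a>b$, the induced action of $\operatorname{GL}(r_a)$ on $U_b$ is trivial. (ii) When $a=b$, the induced action of $\operatorname{GL}(r_a)$ on $U_a\cong\mathbb{A}^{r_a}\otimes\mathbb{A}^{K_a}$ is naturally isomorphic to the representation $\rho\otimes\mathbb{A}^{K_a}$, where $\rho$ is the standard representation of $\operatorname{GL}(r_a)$ and $\mathbb{A}^{K_a}$ carries the trivial action. (iii) When $a<b$, the action of $\operatorname{GL}(r_a)$ on $U_b$ is naturally isomorphic to the representation $$\bigoplus_{0\le l\le\lfloor m_b/m_a\rfloor}\mathbb{A}^{r_bd_l}\otimes\hat\rho^{\otimes l},$$ where $\hat\rho$ is the inverse transpose of the standard representation $\rho$ of $\operatorname{GL}(r_a)$, $\mathbb{A}^{r_bd_l}$ carries the trivial action, and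 $d_l$ (which also depends on $a$ and $b$) is the number of monomials of degree $m_b-lm_a$ in the variables $x^i_j$ with $i<b$, $i\ne a$; in other words, $d_l$ is the number of solutions of $$\sum_{\substack{i=1\\ i\ne a}}^{b-1}m_i\sum_{j=1}^{r_i}z_{i,j}=m_b-lm_a$$ in non-negative integers $z_{i,j}$.
   Context: Use coordinates $x^i_j$ ($1\le i\le t$, $1\le j\le r_i$) on $\mathbb{A}^{r_1+\dots+r_t}$, with $x^i_j$ of degree (weight) $m_i$; $\mathbb{G}_m$ acts by $\lambda\cdot x^i_j=\lambda^{m_i}x^i_j$. For a scheme $T$, $G(T)$ is the group of $\mathbb{G}_m$-equivariant automorphisms over $T$ of $\mathbb{A}_T^{r_1+\dots+r_t}-\{0\}$; such automorphisms are given by polynomials. "Homogeneous" means weighted homogeneous. The subgroup $\operatorname{GL}(r_1)\times\cdots\times\operatorname{GL}(r_t)\subset G$ consists of the automorphisms where the $i$-th factor acts linearly on the column vector $(x^i_1,\dots,x^i_{r_i})$ and fixes the other coordinates. The subgroup $U\subset G$ consists of the automorphisms $x^i_j\mapsto x^i_j+P^i_j$ with $P^i_j$ homogeneous of degree $m_i$ in the variables $x^c_e$ with $c<i$. For $1\le a\le t$, $U_a\subset U$ consists of those with $P^i_j=0$ whenever $i\ne a$. $K_a$ is the set of monomials of degree $m_a$ in the variables $x^i_j$ with $i<a$, and $k_a=|K_a|$. $\mathbb{A}^{K_a}$ is the vector group scheme with basis $K_a$, and $U_a$ is canonically identified with $\bigoplus_{j=1}^{r_a}\mathbb{A}^{K_a}\cong\mathbb{A}^{r_a}\otimes\mathbb{A}^{K_a}$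 by the coefficients of $P^a_1,\dots,P^a_{r_a}$. Vector group schemes are written $\mathbb{A}^m$; when a group acts, $\mathbb{A}^m$ also denotes the trivial representation of rank $m$. Actions are left actions; the conjugate of $f$ by $g$ is $g\circ f\circ g^{-1}$. Notation: for a family of subgroups $V_1,\dots,V_s$ of a group $V$, one writes $V\cong V_s\rtimes\cdots\rtimes V_2\rtimes V_1$ (successive semi-direct product) if each $V_a$ normalizes every $V_b$ with $a<b$, distinct $V_a$'s intersect trivially, and the $V_a$ generate $V$. In the theorem, $\operatorname{GL}(r_1)\times\cdots\times\operatorname{GL}(r_t)$ is the last (rightmost) factor, and $G$ is the semi-direct product of $U=U_t\rtimes\cdots\rtimes U_1$ by it.
   Formalization: In (iii) the tensor power of the inverse transpose is replaced by the l-th symmetric power, since the printed formula fails (m=(1,2), r=(2,1): rank 3 versus 4); the printed formula is also proved whenever r_a=1 or d_l=0 for all l≥2, exactly when it holds. *)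

theory Defs
  imports
    "HOL-Library.Poly_Mapping"
    "HOL-Library.Multiset"
    "HOL-Library.FuncSet"
    "HOL-Algebra.Product_Groups"
    "HOL-Algebra.Generated_Groups"
    "Jordan_Normal_Form.Matrix"
begin

text \<open>
  Group schemes over the integers are treated through their functors of points on commutative
  rings: the group of points over a ring is a HOL-Algebra group depending polymorphically on the
  type \<open>'a::comm_ring_1\<close>, and a morphism of group schemes is a polymorphic family of
  group homomorphisms that commutes with base change along ring homomorphisms.
\<close>

section \<open>Polynomials in the coordinates\<close>

text \<open>
  The pair \<open>(i, j)\<close> stands for the coordinate of block \<open>i\<close>, \<open>1 \<le> i \<le> t\<close>, and weight \<open>m i\<close>.
  The blocks are numbered from 1, but the position \<open>j < r i\<close> inside a block is numbered
  from 0, in agreement with the row and column indices of the type \<^typ>\<open>'a mat\<close>.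
\<close>

type_synonym coord = "nat \<times> nat"
type_synonym 'v monomial = "'v \<Rightarrow>\<^sub>0 nat"
type_synonym ('v, 'a) mpoly = "'v monomial \<Rightarrow>\<^sub>0 'a"
type_synonym 'a polymap = "coord \<Rightarrow> (coord, 'a) mpoly"

definition coords :: "(nat \<Rightarrow> nat) \<Rightarrow> nat \<Rightarrow> coord set" where
  "coords r t = (SIGMA i:{1..t}. {..<r i})"

definition coords_below :: "(nat \<Rightarrow> nat) \<Rightarrow> nat \<Rightarrow> nat \<Rightarrow> coord set" where
  "coords_below r t a = {v \<in> coords r t. fst v < a}"

definition const_poly :: "'a \<Rightarrow> ('v, 'a::comm_ring_1) mpoly" where
  "const_poly c = Poly_Mapping.single 0 c"

definition var_poly :: "'v \<Rightarrow> ('v, 'a::comm_ring_1) mpoly" where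
  "var_poly v = Poly_Mapping.single (Poly_Mapping.single v 1) 1"

definition polys_in :: "'v set \<Rightarrow> ('v, 'a::comm_ring_1) mpoly set" where
  "polys_in V = {p. \<forall>\<mu>\<in>Poly_Mapping.keys p. Poly_Mapping.keys \<mu> \<subseteq> V}"

definition subst_poly ::
  "('v \<Rightarrow> ('w, 'a) mpoly) \<Rightarrow> ('v, 'a::comm_ring_1) mpoly \<Rightarrow> ('w, 'a) mpoly" where
  "subst_poly F p = (\<Sum>\<mu>\<in>Poly_Mapping.keys p. const_poly (Poly_Mapping.lookup p \<mu>) *
     (\<Prod>v\<in>Poly_Mapping.keys \<mu>. F v ^ Poly_Mapping.lookup \<mu> v))"

definition wdegree :: "(nat \<Rightarrow> nat) \<Rightarrow> coord monomial \<Rightarrow> nat" where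
  "wdegree m \<mu> = (\<Sum>v\<in>Poly_Mapping.keys \<mu>. m (fst v) * Poly_Mapping.lookup \<mu> v)"

definition monomials_of :: "(nat \<Rightarrow> nat) \<Rightarrow> nat \<Rightarrow> coord set \<Rightarrow> coord monomial set" where
  "monomials_of m d W = {\<mu>. Poly_Mapping.keys \<mu> \<subseteq> W \<and> wdegree m \<mu> = d}"

definition homog_polys :: "(nat \<Rightarrow> nat) \<Rightarrow> nat \<Rightarrow> coord set \<Rightarrow> (coord, 'a::comm_ring_1) mpoly set" where
  "homog_polys m d W = {p. Poly_Mapping.keys p \<subseteq> monomials_of m d W}"

section \<open>Equivariant automorphisms of the punctured affine space\<close>

text \<open>
  A polynomial map is normalized to be \<^const>\<open>undefined\<close> outside the coordinates.  When there are
  at least two coordinates, morphisms from the punctured affine space over a ring to the affine space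
  are the same as polynomial maps.  Such a map sends the punctured space into itself iff the
  pulled back coordinates have no common zero outside the zero section, i.e. iff every
  coordinate lies in the radical of the ideal which they generate.
\<close>

definition punctured :: "coord set \<Rightarrow> 'a::comm_ring_1 polymap \<Rightarrow> bool" where
  "punctured V F \<longleftrightarrow> (\<forall>v\<in>V. \<exists>n A. (\<forall>w\<in>V. A w \<in> polys_in V) \<and>
     var_poly v ^ n = (\<Sum>w\<in>V. A w * F w))"

text \<open>
  Equivariance is the identity \<open>F (\<lambda> \<cdot> x) = \<lambda> \<cdot> F x\<close> for the universal point \<open>x\<close> and the universal
  scalar \<open>\<lambda>\<close>, the latter being the additional variable \<^const>\<open>None\<close>.  (Polynomials in \<open>\<lambda>\<close> embed into
  Laurent polynomials in \<open>\<lambda>\<close>.)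
\<close>

definition equivariant :: "(nat \<Rightarrow> nat) \<Rightarrow> coord set \<Rightarrow> 'a::comm_ring_1 polymap \<Rightarrow> bool" where
  "equivariant m V F \<longleftrightarrow> (\<forall>v\<in>V.
     subst_poly (\<lambda>w. var_poly None ^ m (fst w) * var_poly (Some w)) (F v) =
     var_poly None ^ m (fst v) * subst_poly (\<lambda>w. var_poly (Some w)) (F v))"

definition equiv_end ::
  "'a::comm_ring_1 itself \<Rightarrow> (nat \<Rightarrow> nat) \<Rightarrow> (nat \<Rightarrow> nat) \<Rightarrow> nat \<Rightarrow> 'a polymap monoid" where
  "equiv_end ty m r t = \<lparr>
     carrier = {F \<in> coords r t \<rightarrow>\<^sub>E polys_in (coords r t).
                  punctured (coords r t) F \<and> equivariant m (coords r t) F},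
     monoid.mult = (\<lambda>F H. \<lambda>v\<in>coords r t. subst_poly H (F v)),
     one = (\<lambda>v\<in>coords r t. var_poly v)\<rparr>"

definition equiv_aut ::
  "'a::comm_ring_1 itself \<Rightarrow> (nat \<Rightarrow> nat) \<Rightarrow> (nat \<Rightarrow> nat) \<Rightarrow> nat \<Rightarrow> 'a polymap monoid" where
  "equiv_aut ty m r t = units_of (equiv_end ty m r t)"

definition base_change ::
  "(nat \<Rightarrow> nat) \<Rightarrow> nat \<Rightarrow> ('a \<Rightarrow> 'b) \<Rightarrow> 'a::comm_ring_1 polymap \<Rightarrow> 'b::comm_ring_1 polymap" where
  "base_change r t h F = (\<lambda>v\<in>coords r t. Poly_Mapping.map h (F v))"

definition conj_by :: "('g, 'x) monoid_scheme \<Rightarrow> 'g \<Rightarrow> 'g \<Rightarrow> 'g" where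
  "conj_by G g f = g \<otimes>\<^bsub>G\<^esub> f \<otimes>\<^bsub>G\<^esub> inv\<^bsub>G\<^esub> g"

section \<open>The subgroups\<close>

definition GL :: "'a::comm_ring_1 itself \<Rightarrow> nat \<Rightarrow> 'a mat monoid" where
  "GL ty n = units_of (ring_mat ty n ())"

definition GL_prod :: "'a::comm_ring_1 itself \<Rightarrow> (nat \<Rightarrow> nat) \<Rightarrow> nat \<Rightarrow> (nat \<Rightarrow> 'a mat) monoid" where
  "GL_prod ty r t = product_group {1..t} (\<lambda>i. GL ty (r i))"

definition lin_aut :: "(nat \<Rightarrow> nat) \<Rightarrow> nat \<Rightarrow> (nat \<Rightarrow> 'a mat) \<Rightarrow> 'a::comm_ring_1 polymap" where
  "lin_aut r t A = (\<lambda>v\<in>coords r t.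
     \<Sum>k<r (fst v). const_poly (A (fst v) $$ (snd v, k)) * var_poly (fst v, k))"

definition lin_subgroup :: "'a::comm_ring_1 itself \<Rightarrow> (nat \<Rightarrow> nat) \<Rightarrow> nat \<Rightarrow> 'a polymap set" where
  "lin_subgroup ty r t = lin_aut r t ` carrier (GL_prod ty r t)"

definition GL_factor :: "(nat \<Rightarrow> nat) \<Rightarrow> nat \<Rightarrow> nat \<Rightarrow> 'a mat \<Rightarrow> 'a::comm_ring_1 polymap" where
  "GL_factor r t a g = lin_aut r t (\<lambda>i\<in>{1..t}. if i = a then g else 1\<^sub>m (r i))"

definition unip ::
  "'a::comm_ring_1 itself \<Rightarrow> (nat \<Rightarrow> nat) \<Rightarrow> (nat \<Rightarrow> nat) \<Rightarrow> nat \<Rightarrow> 'a polymap set" where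
  "unip ty m r t = {F \<in> carrier (equiv_aut ty m r t). \<forall>v\<in>coords r t.
     \<exists>P\<in>homog_polys m (m (fst v)) (coords_below r t (fst v)). F v = var_poly v + P}"

definition unip_factor ::
  "'a::comm_ring_1 itself \<Rightarrow> (nat \<Rightarrow> nat) \<Rightarrow> (nat \<Rightarrow> nat) \<Rightarrow> nat \<Rightarrow> nat \<Rightarrow> 'a polymap set" where
  "unip_factor ty m r t a =
     {F \<in> unip ty m r t. \<forall>v\<in>coords r t. fst v \<noteq> a \<longrightarrow> F v = var_poly v}"

text \<open>
  The successive semi-direct product of a family indexed by a set \<open>I\<close> of naturals; the factor with
  the smallest index is the rightmost one.
\<close>

definition succ_semidirect :: "('g, 'x) monoid_scheme \<Rightarrow> nat set \<Rightarrow> (nat \<Rightarrow> 'g set) \<Rightarrow> bool" where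
  "succ_semidirect G I W \<longleftrightarrow>
     (\<forall>a\<in>I. subgroup (W a) G) \<and>
     (\<forall>a\<in>I. \<forall>b\<in>I. a < b \<longrightarrow> (\<forall>g\<in>W a. conj_by G g ` W b = W b)) \<and>
     (\<forall>a\<in>I. \<forall>b\<in>I. a \<noteq> b \<longrightarrow> W a \<inter> W b = {\<one>\<^bsub>G\<^esub>}) \<and>
     generate G (\<Union>a\<in>I. W a) = carrier G"

section \<open>Vector groups and representations\<close>

text \<open>
  The points of the vector group scheme with basis \<open>I\<close>; for finite \<open>I\<close> it has rank \<open>card I\<close>.
\<close>

definition vector_group :: "'i set \<Rightarrow> ('i \<Rightarrow> 'a::comm_ring_1) monoid" where
  "vector_group I = \<lparr>
     carrier = I \<rightarrow>\<^sub>E UNIV,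
     monoid.mult = (\<lambda>x y. \<lambda>i\<in>I. x i + y i),
     one = (\<lambda>i\<in>I. 0)\<rparr>"

record ('g, 'i, 'a) mrep =
  rbasis :: "'i set"
  rentry :: "'g \<Rightarrow> 'i \<Rightarrow> 'i \<Rightarrow> 'a"

definition rep_act :: "('g, 'i, 'a::comm_ring_1) mrep \<Rightarrow> 'g \<Rightarrow> ('i \<Rightarrow> 'a) \<Rightarrow> ('i \<Rightarrow> 'a)" where
  "rep_act \<rho> g x = (\<lambda>i\<in>rbasis \<rho>. \<Sum>j\<in>rbasis \<rho>. rentry \<rho> g i j * x j)"

definition std_rep :: "nat \<Rightarrow> ('a::comm_ring_1 mat, nat, 'a) mrep" where
  "std_rep n = \<lparr>rbasis = {..<n}, rentry = (\<lambda>g i j. g $$ (i, j))\<rparr>"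

definition inv_transpose_rep :: "nat \<Rightarrow> ('a::comm_ring_1 mat, nat, 'a) mrep" where
  "inv_transpose_rep n = \<lparr>rbasis = {..<n},
     rentry = (\<lambda>g i j. transpose_mat (inv\<^bsub>GL TYPE('a) n\<^esub> g) $$ (i, j))\<rparr>"

definition triv_rep :: "'i set \<Rightarrow> ('g, 'i, 'a::comm_ring_1) mrep" where
  "triv_rep I = \<lparr>rbasis = I, rentry = (\<lambda>g i j. if i = j then 1 else 0)\<rparr>"

definition tensor_rep ::
  "('g, 'i, 'a::comm_ring_1) mrep \<Rightarrow> ('g, 'k, 'a) mrep \<Rightarrow> ('g, 'i \<times> 'k, 'a) mrep" where
  "tensor_rep \<rho> \<sigma> = \<lparr>rbasis = rbasis \<rho> \<times> rbasis \<sigma>,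
     rentry = (\<lambda>g p q. rentry \<rho> g (fst p) (fst q) * rentry \<sigma> g (snd p) (snd q))\<rparr>"

definition dsum_rep ::
  "'l set \<Rightarrow> ('l \<Rightarrow> ('g, 'i, 'a::comm_ring_1) mrep) \<Rightarrow> ('g, 'l \<times> 'i, 'a) mrep" where
  "dsum_rep L \<rho> = \<lparr>rbasis = (SIGMA l:L. rbasis (\<rho> l)),
     rentry = (\<lambda>g p q. if fst p = fst q then rentry (\<rho> (fst p)) g (snd p) (snd q) else 0)\<rparr>"

definition tensor_power_rep :: "nat \<Rightarrow> ('g, 'i, 'a::comm_ring_1) mrep \<Rightarrow> ('g, 'i list, 'a) mrep" where
  "tensor_power_rep l \<rho> = \<lparr>rbasis = {xs. set xs \<subseteq> rbasis \<rho> \<and> length xs = l},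
     rentry = (\<lambda>g xs ys. \<Prod>k<l. rentry \<rho> g (xs ! k) (ys ! k))\<rparr>"

text \<open>
  The symmetric power is the quotient of the tensor power which identifies the basis vectors
  \<open>xs\<close> and \<open>ys\<close> when \<open>mset xs = mset ys\<close>.  Its basis consists of multisets, and the column of its
  matrix at \<open>N\<close> is the image of the column of the tensor power at any list representing \<open>N\<close>; the
  choice of the list does not matter, because the entries of the tensor power do not change
  when both lists are permuted in the same way.
\<close>

definition sym_power_rep ::
  "nat \<Rightarrow> ('g, 'i, 'a::comm_ring_1) mrep \<Rightarrow> ('g, 'i multiset, 'a) mrep" where
  "sym_power_rep l \<rho> = \<lparr>rbasis = {M. set_mset M \<subseteq> rbasis \<rho> \<and> size M = l},
     rentry = (\<lambda>g M N. \<Sum>xs\<in>{xs. mset xs = M}.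
       rentry (tensor_power_rep l \<rho>) g xs (SOME ys. mset ys = N))\<rparr>"

text \<open>
  \<open>\<phi>\<close> identifies the conjugation action of the group \<open>\<Gamma>\<close>, mapped to \<open>G\<close> by \<open>\<iota>\<close>, on the
  subgroup \<open>N\<close> of \<open>G\<close> with the representation \<open>\<rho>\<close>.
\<close>

definition conj_rep_iso ::
  "('x, 'y) monoid_scheme \<Rightarrow> 'x set \<Rightarrow> ('g, 'z) monoid_scheme \<Rightarrow> ('g \<Rightarrow> 'x) \<Rightarrow>
   ('g, 'i, 'a::comm_ring_1) mrep \<Rightarrow> ('x \<Rightarrow> 'i \<Rightarrow> 'a) \<Rightarrow> bool" where
  "conj_rep_iso G N \<Gamma> \<iota> \<rho> \<phi> \<longleftrightarrow>
     \<phi> \<in> iso (G\<lparr>carrier := N\<rparr>) (vector_group (rbasis \<rho>)) \<and>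
     (\<forall>g\<in>carrier \<Gamma>. \<forall>u\<in>N. \<phi> (conj_by G (\<iota> g) u) = rep_act \<rho> g (\<phi> u))"

section \<open>Coordinates on the unipotent factors\<close>

definition K_monomials :: "(nat \<Rightarrow> nat) \<Rightarrow> (nat \<Rightarrow> nat) \<Rightarrow> nat \<Rightarrow> nat \<Rightarrow> coord monomial set" where
  "K_monomials m r t a = monomials_of m (m a) (coords_below r t a)"

definition unip_coords ::
  "(nat \<Rightarrow> nat) \<Rightarrow> (nat \<Rightarrow> nat) \<Rightarrow> nat \<Rightarrow> nat \<Rightarrow> 'a::comm_ring_1 polymap \<Rightarrow> nat \<times> coord monomial \<Rightarrow> 'a"
  where
  "unip_coords m r t a F = (\<lambda>(j, \<kappa>)\<in>{..<r a} \<times> K_monomials m r t a.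
     Poly_Mapping.lookup (F (a, j) - var_poly (a, j)) \<kappa>)"

text \<open>
  The monomials counted by the number \<open>d\<close> of the theorem; only \<open>l \<le> m b div m a\<close> is used, so
  that the subtraction is not truncated.
\<close>

definition D_monomials ::
  "(nat \<Rightarrow> nat) \<Rightarrow> (nat \<Rightarrow> nat) \<Rightarrow> nat \<Rightarrow> nat \<Rightarrow> nat \<Rightarrow> nat \<Rightarrow> coord monomial set" where
  "D_monomials m r t a b l = monomials_of m (m b - l * m a) {v \<in> coords_below r t b. fst v \<noteq> a}"

definition block_monomial :: "nat \<Rightarrow> nat multiset \<Rightarrow> coord monomial" where
  "block_monomial a M = (\<Sum>k\<in>#M. Poly_Mapping.single (a, k) 1)"

text \<open>
  The representations in the case \<open>a < b\<close>.  The trivial representation of rank \<open>r b * d\<close> has the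
  basis \<open>{..<r b} \<times> D_monomials m r t a b l\<close>.  The maps below are relabellings of the coordinates
  \<^const>\<open>unip_coords\<close>: a monomial in the variables below \<open>b\<close> is split into its
  part outside block \<open>a\<close> and its part in block \<open>a\<close>.

  The \<open>l\<close>-th power of the dual of the standard representation is the symmetric one: its
  basis vectors are the monomials of degree \<open>l\<close> in the variables of block \<open>a\<close>, which commute.  It
  agrees with the full tensor power if \<open>l \<le> 1\<close> or \<open>r a = 1\<close>; otherwise its rank is smaller.
\<close>

definition sym_sum_rep ::
  "(nat \<Rightarrow> nat) \<Rightarrow> (nat \<Rightarrow> nat) \<Rightarrow> nat \<Rightarrow> nat \<Rightarrow> nat \<Rightarrow>
   ('a::comm_ring_1 mat, nat \<times> ((nat \<times> coord monomial) \<times> nat multiset), 'a) mrep" where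
  "sym_sum_rep m r t a b = dsum_rep {0..m b div m a} (\<lambda>l. tensor_rep
     (triv_rep ({..<r b} \<times> D_monomials m r t a b l))
     (sym_power_rep l (inv_transpose_rep (r a))))"

definition sym_sum_coords ::
  "(nat \<Rightarrow> nat) \<Rightarrow> (nat \<Rightarrow> nat) \<Rightarrow> nat \<Rightarrow> nat \<Rightarrow> nat \<Rightarrow> 'a::comm_ring_1 polymap \<Rightarrow>
   nat \<times> ((nat \<times> coord monomial) \<times> nat multiset) \<Rightarrow> 'a" where
  "sym_sum_coords m r t a b F =
     (\<lambda>(l, ((j, \<delta>), M))\<in>rbasis (sym_sum_rep m r t a b :: ('a mat, _, 'a) mrep).
        unip_coords m r t b F (j, \<delta> + block_monomial a M))"

definition tensor_sum_rep ::
  "(nat \<Rightarrow> nat) \<Rightarrow> (nat \<Rightarrow> nat) \<Rightarrow> nat \<Rightarrow> nat \<Rightarrow> nat \<Rightarrow>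
   ('a::comm_ring_1 mat, nat \<times> ((nat \<times> coord monomial) \<times> nat list), 'a) mrep" where
  "tensor_sum_rep m r t a b = dsum_rep {0..m b div m a} (\<lambda>l. tensor_rep
     (triv_rep ({..<r b} \<times> D_monomials m r t a b l))
     (tensor_power_rep l (inv_transpose_rep (r a))))"

definition tensor_sum_coords ::
  "(nat \<Rightarrow> nat) \<Rightarrow> (nat \<Rightarrow> nat) \<Rightarrow> nat \<Rightarrow> nat \<Rightarrow> nat \<Rightarrow> 'a::comm_ring_1 polymap \<Rightarrow>
   nat \<times> ((nat \<times> coord monomial) \<times> nat list) \<Rightarrow> 'a" where
  "tensor_sum_coords m r t a b F =
     (\<lambda>(l, ((j, \<delta>), ks))\<in>rbasis (tensor_sum_rep m r t a b :: ('a mat, _, 'a) mrep).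
        unip_coords m r t b F (j, \<delta> + block_monomial a (mset ks)))"

text \<open>Compatibility of coordinates over two rings with base change along \<open>h\<close>.\<close>

definition natural_along ::
  "(nat \<Rightarrow> nat) \<Rightarrow> nat \<Rightarrow> ('a \<Rightarrow> 'b) \<Rightarrow> 'a::comm_ring_1 polymap set \<Rightarrow> 'i set \<Rightarrow>
   ('a polymap \<Rightarrow> 'i \<Rightarrow> 'a) \<Rightarrow> ('b::comm_ring_1 polymap \<Rightarrow> 'i \<Rightarrow> 'b) \<Rightarrow> bool" where
  "natural_along r t h N I \<phi> \<psi> \<longleftrightarrow>
     (\<forall>F\<in>N. \<forall>i\<in>I. \<psi> (base_change r t h F) i = h (\<phi> F i))"

end

theory Submission
  imports Defs
begin

text \<open>
  Equivariance makes every coordinate of block \<open>i\<close> a weighted homogeneous polynomial of degree \<open>m i\<close>.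
  Since the weights increase strictly, such a polynomial is a linear form in block \<open>i\<close> plus a polynomial
  in the lower blocks.  Hence the linear part is a group homomorphism to the product of the general
  linear groups; block-diagonal linear maps split it and \<open>U\<close> is its kernel, which gives the outer
  semi-direct product.  An element of \<open>U\<close> is the product of its truncations to single blocks.  All
  conjugation actions come from one formula: conjugating \<open>x \<mapsto> x + P\<close> in block \<open>b\<close> by \<open>g\<close> replaces \<open>P\<close> by
  \<open>A (P \<circ> g\<^sup>-\<^sup>1)\<close>, where \<open>A\<close> is the matrix of \<open>g\<close> on block \<open>b\<close>.  For \<open>a < b\<close> one expands the monomials
  after substituting \<open>g\<^sup>-\<^sup>1\<close> into their block \<open>a\<close> part; the coefficients are the entries of the
  symmetric powers of the inverse transpose.
\<close>

section \<open>Substitution into polynomials\<close>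

definition monom_eval :: "('v \<Rightarrow> 'c::comm_monoid_mult) \<Rightarrow> 'v monomial \<Rightarrow> 'c" where
  "monom_eval F \<mu> = (\<Prod>v\<in>Poly_Mapping.keys \<mu>. F v ^ Poly_Mapping.lookup \<mu> v)"

lemma monom_eval_superset:
  assumes "finite S" "Poly_Mapping.keys \<mu> \<subseteq> S"
  shows "monom_eval F \<mu> = (\<Prod>v\<in>S. F v ^ Poly_Mapping.lookup \<mu> v)"
  unfolding monom_eval_def
  by (rule prod.mono_neutral_left) (use assms in \<open>auto simp: in_keys_iff\<close>)

lemma monom_eval_zero [simp]: "monom_eval F 0 = 1"
  by (simp add: monom_eval_def)

lemma monom_eval_single [simp]: "monom_eval F (Poly_Mapping.single v k) = F v ^ k"
  by (simp add: monom_eval_def)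

lemma keys_add_nat: "Poly_Mapping.keys (\<mu> + \<nu>) = Poly_Mapping.keys \<mu> \<union> Poly_Mapping.keys (\<nu> :: 'v monomial)"
  by (auto simp: in_keys_iff lookup_add)

lemma monom_eval_add: "monom_eval F (\<mu> + \<nu>) = monom_eval F \<mu> * monom_eval F \<nu>"
proof -
  let ?S = "Poly_Mapping.keys \<mu> \<union> Poly_Mapping.keys \<nu>"
  have "monom_eval F (\<mu> + \<nu>) = (\<Prod>v\<in>?S. F v ^ Poly_Mapping.lookup (\<mu> + \<nu>) v)"
    by (rule monom_eval_superset) (auto simp: keys_add_nat)
  also have "\<dots> = (\<Prod>v\<in>?S. F v ^ Poly_Mapping.lookup \<mu> v) * (\<Prod>v\<in>?S. F v ^ Poly_Mapping.lookup \<nu> v)"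
    by (simp add: lookup_add power_add prod.distrib)
  also have "\<dots> = monom_eval F \<mu> * monom_eval F \<nu>"
    by (simp add: monom_eval_superset[of ?S])
  finally show ?thesis .
qed

lemma monom_eval_cong:
  "(\<And>v. v \<in> Poly_Mapping.keys \<mu> \<Longrightarrow> F v = H v) \<Longrightarrow> monom_eval F \<mu> = monom_eval H \<mu>"
  by (auto simp: monom_eval_def intro: prod.cong)

lemma const_poly_zero [simp]: "const_poly 0 = 0"
  by (simp add: const_poly_def)

lemma const_poly_one [simp]: "const_poly 1 = 1"
  by (simp add: const_poly_def)

lemma const_poly_add: "const_poly (a + b) = const_poly a + const_poly b"
  by (simp add: const_poly_def single_add)

lemma const_poly_mult: "const_poly (a * b) = const_poly a * const_poly b"
  by (simp add: const_poly_def mult_single)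

lemma const_poly_sum: "const_poly (sum f A) = (\<Sum>x\<in>A. const_poly (f x))"
  by (induction A rule: infinite_finite_induct) (auto simp: const_poly_add)

lemma lookup_const_mult [simp]:
  "Poly_Mapping.lookup (const_poly c * p) \<mu> = c * Poly_Mapping.lookup p \<mu>"
proof -
  have "const_poly c * p = Poly_Mapping.map ((*) c) p"
    by (simp add: const_poly_def mult_map_scale_conv_mult)
  then show ?thesis
    by (simp add: Poly_Mapping.map.rep_eq when_def)
qed

lemma const_mult_single:
  "const_poly c * Poly_Mapping.single \<mu> d = Poly_Mapping.single \<mu> (c * d)"
  by (simp add: const_poly_def mult_single)

lemma var_poly_power:
  "(var_poly v :: ('v, 'a::comm_ring_1) mpoly) ^ k = Poly_Mapping.single (Poly_Mapping.single v k) 1"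
proof (induction k)
  case (Suc k)
  have "Poly_Mapping.single v (Suc k) = Poly_Mapping.single v 1 + Poly_Mapping.single v k"
    by (simp flip: single_add)
  with Suc show ?case
    by (simp add: var_poly_def mult_single)
qed simp

lemma sum_single_lookup: "(\<Sum>v\<in>Poly_Mapping.keys \<mu>. Poly_Mapping.single v (Poly_Mapping.lookup \<mu> v)) = \<mu>"
proof (rule poly_mapping_eqI)
  fix k
  have "(\<Sum>v\<in>Poly_Mapping.keys \<mu>. Poly_Mapping.lookup (Poly_Mapping.single v (Poly_Mapping.lookup \<mu> v)) k)
      = (\<Sum>v\<in>Poly_Mapping.keys \<mu>. if v = k then Poly_Mapping.lookup \<mu> k else 0)"
    by (intro sum.cong) (auto simp: lookup_single when_def)
  then show "Poly_Mapping.lookup (\<Sum>v\<in>Poly_Mapping.keys \<mu>. Poly_Mapping.single v (Poly_Mapping.lookup \<mu> v)) k =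
      Poly_Mapping.lookup \<mu> k"
    by (simp add: lookup_sum in_keys_iff)
qed

lemma prod_single_one:
  "(\<Prod>v\<in>S. Poly_Mapping.single (f v) (1::'a::comm_ring_1)) =
     Poly_Mapping.single (\<Sum>v\<in>S. (f v :: 'v monomial)) 1"
  by (induction S rule: infinite_finite_induct) (auto simp: mult_single)

lemma monom_eval_var [simp]:
  "monom_eval var_poly \<mu> = (Poly_Mapping.single \<mu> 1 :: ('v, 'a::comm_ring_1) mpoly)"
  by (simp add: monom_eval_def var_poly_power prod_single_one sum_single_lookup)

lemma mpoly_induct [case_names const var add mult]:
  fixes p :: "('v, 'a::comm_ring_1) mpoly"
  assumes vars: "\<And>\<mu>. \<mu> \<in> Poly_Mapping.keys p \<Longrightarrow> Poly_Mapping.keys \<mu> \<subseteq> V"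
  assumes const: "\<And>c. P (const_poly c)" and var: "\<And>v. v \<in> V \<Longrightarrow> P (var_poly v)"
    and add: "\<And>p q. P p \<Longrightarrow> P q \<Longrightarrow> P (p + q)" and mult: "\<And>p q. P p \<Longrightarrow> P q \<Longrightarrow> P (p * q)"
  shows "P p"
proof -
  have one: "P 1" and zero: "P 0"
    using const[of 1] const[of 0] by simp_all
  have pow: "P (q ^ n)" if "P q" for q n
    using that by (induction n) (auto intro: one mult)
  have prod: "P (prod f S)" if "\<And>v. v \<in> S \<Longrightarrow> P (f v)" for f and S :: "'v set"
    using that by (induction S rule: infinite_finite_induct) (auto intro: one mult)
  have sum: "P (sum f S)" if "\<And>v. v \<in> S \<Longrightarrow> P (f v)" for f and S :: "'v monomial set"
    using that by (induction S rule: infinite_finite_induct) (auto intro: zero add)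
  have "P (const_poly c * monom_eval var_poly \<mu>)" if "Poly_Mapping.keys \<mu> \<subseteq> V" for c \<mu>
    unfolding monom_eval_def using that by (intro mult const prod pow var) auto
  then have "P (\<Sum>\<mu>\<in>Poly_Mapping.keys p. Poly_Mapping.single \<mu> (Poly_Mapping.lookup p \<mu>))"
    by (intro sum) (auto simp: const_mult_single dest: vars)
  then show ?thesis
    by (simp add: sum_single_lookup)
qed

lemma subst_poly_altdef:
  "subst_poly F p = (\<Sum>\<mu>\<in>Poly_Mapping.keys p. const_poly (Poly_Mapping.lookup p \<mu>) * monom_eval F \<mu>)"
  by (simp add: subst_poly_def monom_eval_def)

lemma subst_poly_superset:
  assumes "finite S" "Poly_Mapping.keys p \<subseteq> S"
  shows "subst_poly F p = (\<Sum>\<mu>\<in>S. const_poly (Poly_Mapping.lookup p \<mu>) * monom_eval F \<mu>)"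
  unfolding subst_poly_altdef
  by (rule sum.mono_neutral_left) (use assms in \<open>auto simp: in_keys_iff\<close>)

lemma subst_single: "subst_poly F (Poly_Mapping.single \<mu> c) = const_poly c * monom_eval F \<mu>"
  by (subst subst_poly_superset[of "{\<mu>}"]) auto

lemma subst_zero [simp]: "subst_poly F 0 = 0"
  by (simp add: subst_poly_altdef)

lemma subst_const [simp]: "subst_poly F (const_poly c) = const_poly c"
  using subst_single[of F 0 c] by (simp add: const_poly_def)

lemma subst_one [simp]: "subst_poly F 1 = 1"
  using subst_const[of F 1] by simp

lemma subst_var [simp]: "subst_poly F (var_poly v) = F v"
  by (simp add: var_poly_def subst_single)

lemma subst_add [simp]: "subst_poly F (p + q) = subst_poly F p + subst_poly F q"
proof -
  let ?S = "Poly_Mapping.keys p \<union> Poly_Mapping.keys q"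
  have "subst_poly F (p + q) = (\<Sum>\<mu>\<in>?S. const_poly (Poly_Mapping.lookup (p + q) \<mu>) * monom_eval F \<mu>)"
    by (rule subst_poly_superset) (use Poly_Mapping.keys_add[of p q] in auto)
  then show ?thesis
    by (simp add: lookup_add const_poly_add distrib_right sum.distrib subst_poly_superset[of ?S])
qed

lemma subst_sum [simp]: "subst_poly F (sum f A) = (\<Sum>x\<in>A. subst_poly F (f x))"
  by (induction A rule: infinite_finite_induct) auto

lemma subst_mult [simp]: "subst_poly F (p * q) = subst_poly F p * subst_poly F q"
proof -
  let ?s = "\<lambda>p \<mu>. Poly_Mapping.single \<mu> (Poly_Mapping.lookup p \<mu>)"
  have "p * q = (\<Sum>\<mu>\<in>Poly_Mapping.keys p. ?s p \<mu>) * (\<Sum>\<nu>\<in>Poly_Mapping.keys q. ?s q \<nu>)"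
    by (simp only: sum_single_lookup)
  then have "subst_poly F (p * q) =
      (\<Sum>\<mu>\<in>Poly_Mapping.keys p. \<Sum>\<nu>\<in>Poly_Mapping.keys q. subst_poly F (?s p \<mu> * ?s q \<nu>))"
    by (simp add: sum_product)
  also have "\<dots> = subst_poly F p * subst_poly F q"
    by (simp add: mult_single subst_single monom_eval_add const_poly_mult mult_ac
        subst_poly_altdef[of F p] subst_poly_altdef[of F q] sum_product)
  finally show ?thesis .
qed

lemma subst_subst:
  "subst_poly F (subst_poly H p) = subst_poly (\<lambda>v. subst_poly F (H v)) p"
  by (induction p rule: mpoly_induct[where V = UNIV]) auto

lemma subst_var_poly [simp]: "subst_poly var_poly p = p"
  by (induction p rule: mpoly_induct[where V = UNIV]) auto

lemma subst_cong:
  assumes "p \<in> polys_in V" "\<And>v. v \<in> V \<Longrightarrow> F v = H v"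
  shows "subst_poly F p = subst_poly H p"
  unfolding subst_poly_altdef
  by (intro sum.cong refl arg_cong2[where f = "(*)"] monom_eval_cong)
    (use assms in \<open>auto simp: polys_in_def\<close>)

section \<open>Weighted homogeneous polynomials\<close>

lemma wdegree_superset:
  assumes "finite S" "Poly_Mapping.keys \<mu> \<subseteq> S"
  shows "wdegree m \<mu> = (\<Sum>v\<in>S. m (fst v) * Poly_Mapping.lookup \<mu> v)"
  unfolding wdegree_def
  by (rule sum.mono_neutral_left) (use assms in \<open>auto simp: in_keys_iff\<close>)

lemma wdegree_zero [simp]: "wdegree m 0 = 0"
  by (simp add: wdegree_def)

lemma wdegree_single [simp]: "wdegree m (Poly_Mapping.single v k) = m (fst v) * k"
  by (simp add: wdegree_def)

lemma wdegree_add [simp]: "wdegree m (\<mu> + \<nu>) = wdegree m \<mu> + wdegree m \<nu>"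
proof -
  let ?S = "Poly_Mapping.keys \<mu> \<union> Poly_Mapping.keys \<nu>"
  have "wdegree m (\<mu> + \<nu>) = (\<Sum>v\<in>?S. m (fst v) * Poly_Mapping.lookup (\<mu> + \<nu>) v)"
    by (rule wdegree_superset) (auto simp: keys_add_nat)
  then show ?thesis
    by (simp add: lookup_add distrib_left sum.distrib wdegree_superset[of ?S])
qed

lemma monomials_of_mono: "V \<subseteq> W \<Longrightarrow> monomials_of m d V \<subseteq> monomials_of m d W"
  by (auto simp: monomials_of_def)

lemma homog_polys_mono: "V \<subseteq> W \<Longrightarrow> homog_polys m d V \<subseteq> homog_polys m d W"
  using monomials_of_mono[of V W m d] by (auto simp: homog_polys_def)

lemma homog_polys_monoD: "p \<in> homog_polys m d V \<Longrightarrow> V \<subseteq> W \<Longrightarrow> p \<in> homog_polys m d W"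
  using homog_polys_mono by blast

lemma polys_in_altdef: "polys_in V = homog_polys (\<lambda>_. 0) 0 V"
  by (auto simp: polys_in_def homog_polys_def monomials_of_def wdegree_def)

lemma homog_imp_polys_in: "p \<in> homog_polys m d V \<Longrightarrow> p \<in> polys_in V"
  by (auto simp: polys_in_def homog_polys_def monomials_of_def)

lemma homog_zero [simp]: "0 \<in> homog_polys m d V"
  by (simp add: homog_polys_def)

lemma homog_add: "p \<in> homog_polys m d V \<Longrightarrow> q \<in> homog_polys m d V \<Longrightarrow> p + q \<in> homog_polys m d V"
  using Poly_Mapping.keys_add[of p q] unfolding homog_polys_def by blast

lemma homog_uminus: "p \<in> homog_polys m d V \<Longrightarrow> - p \<in> homog_polys m d V"
  by (auto simp: homog_polys_def in_keys_iff subset_iff)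

lemma homog_diff: "p \<in> homog_polys m d V \<Longrightarrow> q \<in> homog_polys m d V \<Longrightarrow> p - q \<in> homog_polys m d V"
  using homog_add[of p m d V "- q"] homog_uminus by auto

lemma homog_sum: "(\<And>x. x \<in> A \<Longrightarrow> f x \<in> homog_polys m d V) \<Longrightarrow> sum f A \<in> homog_polys m d V"
  by (induction A rule: infinite_finite_induct) (auto intro: homog_add)

lemma homog_mult:
  assumes "p \<in> homog_polys m d V" "q \<in> homog_polys m e V"
  shows "p * q \<in> homog_polys m (d + e) V"
proof -
  have "\<mu> + \<nu> \<in> monomials_of m (d + e) V"
    if "\<mu> \<in> Poly_Mapping.keys p" "\<nu> \<in> Poly_Mapping.keys q" for \<mu> \<nu>
    using that assms by (auto simp: homog_polys_def monomials_of_def keys_add_nat subset_iff)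
  then show ?thesis
    using Poly_Mapping.keys_mult[of p q] by (auto simp: homog_polys_def)
qed

lemma homog_const [simp]: "const_poly c \<in> homog_polys m 0 V"
  by (auto simp: const_poly_def homog_polys_def monomials_of_def)

lemma homog_one [simp]: "1 \<in> homog_polys m 0 V"
  using homog_const[of 1] by simp

lemma homog_const_mult: "p \<in> homog_polys m d V \<Longrightarrow> const_poly c * p \<in> homog_polys m d V"
  using homog_mult[of "const_poly c" m 0 V p d] by simp

lemma homog_var: "v \<in> V \<Longrightarrow> m (fst v) = d \<Longrightarrow> var_poly v \<in> homog_polys m d V"
  by (auto simp: var_poly_def homog_polys_def monomials_of_def)

lemma homog_power: "p \<in> homog_polys m d V \<Longrightarrow> p ^ n \<in> homog_polys m (d * n) V"
  by (induction n) (auto dest: homog_mult)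

lemma homog_prod:
  "(\<And>x. x \<in> A \<Longrightarrow> f x \<in> homog_polys m (d x) V) \<Longrightarrow> prod f A \<in> homog_polys m (sum d A) V"
  by (induction A rule: infinite_finite_induct) (auto intro: homog_mult)

lemma homog_subst:
  assumes "p \<in> homog_polys m d V" "\<And>v. v \<in> V \<Longrightarrow> F v \<in> homog_polys m (m (fst v)) W"
  shows "subst_poly F p \<in> homog_polys m d W"
  unfolding subst_poly_altdef
proof (intro homog_sum homog_const_mult)
  fix \<mu> assume "\<mu> \<in> Poly_Mapping.keys p"
  then have \<mu>: "Poly_Mapping.keys \<mu> \<subseteq> V" "wdegree m \<mu> = d"
    using assms(1) by (auto simp: homog_polys_def monomials_of_def)
  have "monom_eval F \<mu> \<in> homog_polys m (\<Sum>v\<in>Poly_Mapping.keys \<mu>. m (fst v) * Poly_Mapping.lookup \<mu> v) W"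
    unfolding monom_eval_def using \<mu>(1) by (intro homog_prod homog_power assms(2)) auto
  then show "monom_eval F \<mu> \<in> homog_polys m d W"
    using \<mu>(2) by (simp add: wdegree_def)
qed

lemma polys_in_subst:
  assumes "p \<in> polys_in (V :: coord set)" "\<And>v. v \<in> V \<Longrightarrow> F v \<in> polys_in (W :: coord set)"
  shows "subst_poly F p \<in> polys_in W"
  using assms unfolding polys_in_altdef by (rule homog_subst)

section \<open>Equivariance as weighted homogeneity\<close>

text \<open>
  When the variable of weight \<open>d\<close> is multiplied by the \<open>d\<close>-th power of \<open>\<lambda>\<close>, distinct monomials keep
  distinct \<open>x\<close>-parts, so that the two sides of the equivariance identity can be compared monomial by
  monomial.
\<close>

definition some_monom :: "'v monomial \<Rightarrow> 'v option monomial" where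
  "some_monom \<mu> = (\<Sum>w\<in>Poly_Mapping.keys \<mu>. Poly_Mapping.single (Some w) (Poly_Mapping.lookup \<mu> w))"

lemma lookup_some_monom [simp]:
  "Poly_Mapping.lookup (some_monom \<mu>) None = 0"
  "Poly_Mapping.lookup (some_monom \<mu>) (Some w) = Poly_Mapping.lookup \<mu> w"
proof -
  have "Poly_Mapping.lookup (some_monom \<mu>) (Some w) =
      (\<Sum>v\<in>Poly_Mapping.keys \<mu>. if v = w then Poly_Mapping.lookup \<mu> w else 0)"
    unfolding some_monom_def lookup_sum by (intro sum.cong) (auto simp: lookup_single when_def)
  then show "Poly_Mapping.lookup (some_monom \<mu>) (Some w) = Poly_Mapping.lookup \<mu> w"
    by (simp add: in_keys_iff)
qed (simp add: some_monom_def lookup_sum lookup_single)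

lemma monom_eval_some:
  "monom_eval (\<lambda>w. var_poly (Some w)) \<mu> = (Poly_Mapping.single (some_monom \<mu>) 1 :: (_, 'a::comm_ring_1) mpoly)"
  by (simp add: monom_eval_def var_poly_power prod_single_one some_monom_def)

lemma monom_eval_weighted:
  "monom_eval (\<lambda>w. var_poly None ^ m (fst w) * var_poly (Some w)) \<mu> =
    (Poly_Mapping.single (Poly_Mapping.single None (wdegree m \<mu>) + some_monom \<mu>) 1 ::
      (coord option, 'a::comm_ring_1) mpoly)"
proof -
  have "monom_eval (\<lambda>w. var_poly None ^ m (fst w) * var_poly (Some w)) \<mu> =
     (var_poly None ^ wdegree m \<mu> :: (coord option, 'a) mpoly) * monom_eval (\<lambda>w. var_poly (Some w)) \<mu>"
    by (simp add: monom_eval_def wdegree_def power_mult_distrib prod.distrib power_sum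
        flip: power_mult)
  then show ?thesis
    by (simp add: monom_eval_some var_poly_power mult_single)
qed

lemma weighted_monom_inject:
  "Poly_Mapping.single None d + some_monom \<mu> = Poly_Mapping.single None e + some_monom \<nu> \<longleftrightarrow> d = e \<and> \<mu> = \<nu>"
  (is "?l = ?r \<longleftrightarrow> _")
proof
  assume *: "?l = ?r"
  have "d = e"
    using arg_cong[OF *, of "\<lambda>p. Poly_Mapping.lookup p None"] by (simp add: lookup_add)
  moreover have "\<mu> = \<nu>"
    using arg_cong[OF *, of "\<lambda>p. Poly_Mapping.lookup p (Some _)"]
    by (intro poly_mapping_eqI) (simp add: lookup_add lookup_single)
  ultimately show "d = e \<and> \<mu> = \<nu>" ..
qed simp

lemma some_monom_inject: "some_monom \<mu> = some_monom \<nu> \<longleftrightarrow> \<mu> = \<nu>"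
  using weighted_monom_inject[of 0 \<mu> 0 \<nu>] by simp

lemma equivariance_iff_wdegree:
  fixes p :: "(coord, 'a::comm_ring_1) mpoly"
  shows "subst_poly (\<lambda>w. var_poly None ^ m (fst w) * var_poly (Some w)) p =
     var_poly None ^ d * subst_poly (\<lambda>w. var_poly (Some w)) p \<longleftrightarrow>
     (\<forall>\<mu>\<in>Poly_Mapping.keys p. wdegree m \<mu> = d)" (is "?l = ?r \<longleftrightarrow> _")
proof -
  let ?M = "\<lambda>e \<mu>. Poly_Mapping.single None e + some_monom \<mu>"
  have l: "?l = (\<Sum>\<mu>\<in>Poly_Mapping.keys p.
      Poly_Mapping.single (?M (wdegree m \<mu>) \<mu>) (Poly_Mapping.lookup p \<mu>))"
    by (simp add: subst_poly_altdef monom_eval_weighted const_mult_single)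
  have r: "?r = (\<Sum>\<mu>\<in>Poly_Mapping.keys p. Poly_Mapping.single (?M d \<mu>) (Poly_Mapping.lookup p \<mu>))"
    by (simp add: subst_poly_altdef monom_eval_some const_mult_single var_poly_power mult_single
        sum_distrib_left)
  show ?thesis
  proof
    assume eq: "?l = ?r"
    show "\<forall>\<mu>\<in>Poly_Mapping.keys p. wdegree m \<mu> = d"
    proof (rule ccontr)
      assume "\<not> ?thesis"
      then obtain \<mu> where \<mu>: "\<mu> \<in> Poly_Mapping.keys p" "wdegree m \<mu> \<noteq> d"
        by auto
      have "Poly_Mapping.lookup ?l (?M d \<mu>) = (\<Sum>\<nu>\<in>Poly_Mapping.keys p. 0)"
        unfolding l lookup_sum using \<mu>(2)
        by (intro sum.cong) (auto simp: lookup_single when_def some_monom_inject weighted_monom_inject)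
      moreover have "Poly_Mapping.lookup ?r (?M d \<mu>) =
          (\<Sum>\<nu>\<in>Poly_Mapping.keys p. if \<nu> = \<mu> then Poly_Mapping.lookup p \<mu> else 0)"
        unfolding r lookup_sum
        by (intro sum.cong) (auto simp: lookup_single when_def some_monom_inject weighted_monom_inject)
      ultimately show False
        using \<mu>(1) eq by (simp add: in_keys_iff)
    qed
  next
    assume "\<forall>\<mu>\<in>Poly_Mapping.keys p. wdegree m \<mu> = d"
    then show "?l = ?r"
      unfolding l r by (intro sum.cong) auto
  qed
qed

lemma homog_polys_iff: "p \<in> homog_polys m d V \<longleftrightarrow> p \<in> polys_in V \<and> (\<forall>\<mu>\<in>Poly_Mapping.keys p. wdegree m \<mu> = d)"
  by (auto simp: homog_polys_def polys_in_def monomials_of_def)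

lemma equivariant_iff:
  assumes "\<And>v. v \<in> V \<Longrightarrow> F v \<in> polys_in V"
  shows "equivariant m V F \<longleftrightarrow> (\<forall>v\<in>V. F v \<in> homog_polys m (m (fst v)) V)"
  using assms by (auto simp: equivariant_def equivariance_iff_wdegree homog_polys_iff)

section \<open>Split epimorphisms of groups\<close>

lemma hom_section_mon:
  assumes "s \<in> hom Q G" "\<And>x. x \<in> carrier Q \<Longrightarrow> p (s x) = x"
  shows "s \<in> mon Q G"
  using assms by (auto simp: mon_def intro: inj_on_inverseI)

lemma split_epi_semidirect:
  assumes "group G" "group Q" "p \<in> hom G Q" "s \<in> hom Q G" "\<And>x. x \<in> carrier Q \<Longrightarrow> p (s x) = x"
  shows "kernel G Q p \<inter> s ` carrier Q = {\<one>\<^bsub>G\<^esub>}"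
    and "kernel G Q p <#>\<^bsub>G\<^esub> s ` carrier Q = carrier G"
proof -
  interpret G: group G by fact
  interpret Q: group Q by fact
  interpret p: group_hom G Q p by unfold_locales fact
  interpret s: group_hom Q G s by unfold_locales fact
  show "kernel G Q p \<inter> s ` carrier Q = {\<one>\<^bsub>G\<^esub>}"
  proof (intro equalityI subsetI)
    fix x assume "x \<in> kernel G Q p \<inter> s ` carrier Q"
    then show "x \<in> {\<one>\<^bsub>G\<^esub>}"
      using assms(5) by (auto simp: kernel_def)
  next
    fix x assume "x \<in> {\<one>\<^bsub>G\<^esub>}"
    moreover have "s \<one>\<^bsub>Q\<^esub> = \<one>\<^bsub>G\<^esub>" by simp
    ultimately show "x \<in> kernel G Q p \<inter> s ` carrier Q"
      by (force simp: kernel_def)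
  qed
  show "kernel G Q p <#>\<^bsub>G\<^esub> s ` carrier Q = carrier G"
  proof (intro equalityI subsetI)
    fix x assume x: "x \<in> carrier G"
    let ?l = "s (p x)"
    have l: "?l \<in> carrier G" "p ?l = p x"
      using x assms(5) by auto
    have "x \<otimes>\<^bsub>G\<^esub> inv\<^bsub>G\<^esub> ?l \<in> kernel G Q p"
      using x l by (simp add: kernel_def del: s.hom_inv)
    moreover have "x = x \<otimes>\<^bsub>G\<^esub> inv\<^bsub>G\<^esub> ?l \<otimes>\<^bsub>G\<^esub> ?l"
      using x l by (simp add: G.m_assoc del: s.hom_inv)
    ultimately show "x \<in> kernel G Q p <#>\<^bsub>G\<^esub> s ` carrier Q"
      using x unfolding set_mult_def by (auto intro!: bexI[of _ "p x"])
  qed (auto simp: set_mult_def kernel_def)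
qed

lemma (in group) conj_by_eqI:
  assumes "g \<in> carrier G" "u \<in> carrier G" "w \<in> carrier G" "g \<otimes> u = w \<otimes> g"
  shows "conj_by G g u = w"
  using assms by (simp add: conj_by_def m_assoc)

lemma (in group) conj_by_image_eqI:
  assumes "subgroup H G" "N \<subseteq> carrier G" "\<And>g u. g \<in> H \<Longrightarrow> u \<in> N \<Longrightarrow> conj_by G g u \<in> N" "g \<in> H"
  shows "conj_by G g ` N = N"
proof (intro equalityI subsetI)
  fix u assume u: "u \<in> N"
  have g: "g \<in> carrier G" "inv g \<in> H"
    using assms(1,4) by (auto simp: subgroup.mem_carrier subgroup.m_inv_closed)
  have "conj_by G g (conj_by G (inv g) u) = u"
    using g u assms(2) by (simp add: conj_by_def subset_iff m_assoc) (simp add: subset_iff flip: m_assoc)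
  moreover have "conj_by G (inv g) u \<in> N"
    using assms(3) g u by blast
  ultimately show "u \<in> conj_by G g ` N"
    by (metis imageI)
qed (use assms in auto)

section \<open>The group of equivariant automorphisms\<close>

lemma finite_coords: "finite (coords r t)"
  by (simp add: coords_def)

lemma coords_iff: "(i, j) \<in> coords r t \<longleftrightarrow> 1 \<le> i \<and> i \<le> t \<and> j < r i"
  by (auto simp: coords_def)

lemma coords_below_subset: "coords_below r t a \<subseteq> coords r t"
  by (auto simp: coords_below_def)

lemma no_const_term_in_var_ideal:
  fixes p :: "(coord, 'a::comm_ring_1) mpoly"
  assumes "finite V" "p \<in> polys_in V" "0 \<notin> Poly_Mapping.keys p"
  shows "\<exists>A. (\<forall>w\<in>V. A w \<in> polys_in V) \<and> p = (\<Sum>w\<in>V. A w * var_poly w)"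
proof -
  define J where "J = {q :: (coord, 'a) mpoly. \<exists>A. (\<forall>w\<in>V. A w \<in> polys_in V) \<and> q = (\<Sum>w\<in>V. A w * var_poly w)}"
  have "0 \<in> J"
    unfolding J_def by (auto simp: polys_in_altdef intro!: exI[of _ "\<lambda>_. 0"])
  moreover have "q1 + q2 \<in> J" if q1: "q1 \<in> J" and q2: "q2 \<in> J" for q1 q2
  proof -
    from q1 q2 obtain A1 A2 where
      "\<forall>w\<in>V. A1 w \<in> polys_in V" "q1 = (\<Sum>w\<in>V. A1 w * var_poly w)"
      "\<forall>w\<in>V. A2 w \<in> polys_in V" "q2 = (\<Sum>w\<in>V. A2 w * var_poly w)"
      unfolding J_def by auto
    then show ?thesis
      unfolding J_def
      by (auto intro!: exI[of _ "\<lambda>w. A1 w + A2 w"] simp: polys_in_altdef homog_add distrib_right sum.distrib)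
  qed
  ultimately have sum: "sum f S \<in> J" if "\<And>x. x \<in> S \<Longrightarrow> f x \<in> J" for f and S :: "coord monomial set"
    using that by (induction S rule: infinite_finite_induct) auto
  have "Poly_Mapping.single \<mu> c \<in> J" if "\<mu> \<noteq> 0" "Poly_Mapping.keys \<mu> \<subseteq> V" for \<mu> c
  proof -
    obtain w where w: "w \<in> Poly_Mapping.keys \<mu>"
      using \<open>\<mu> \<noteq> 0\<close> by (metis all_not_in_conv keys_eq_empty)
    define \<nu> where "\<nu> = \<mu> - Poly_Mapping.single w 1"
    have \<mu>: "\<mu> = \<nu> + Poly_Mapping.single w 1"
      using w by (intro poly_mapping_eqI)
        (auto simp: \<nu>_def lookup_add lookup_minus lookup_single when_def in_keys_iff)
    define A where "A = (\<lambda>v. if v = w then Poly_Mapping.single \<nu> c else 0)"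
    have "(\<Sum>v\<in>V. A v * var_poly v) = (\<Sum>v\<in>V. if v = w then Poly_Mapping.single \<nu> c * var_poly w else 0)"
      by (intro sum.cong) (auto simp: A_def)
    also have "\<dots> = Poly_Mapping.single \<mu> c"
      using w that assms(1) by (auto simp: var_poly_def mult_single \<mu>)
    finally have "Poly_Mapping.single \<mu> c = (\<Sum>v\<in>V. A v * var_poly v)" ..
    moreover have "A v \<in> polys_in V" for v
      using that(2) by (auto simp: A_def polys_in_def \<mu> keys_add_nat split: if_splits)
    ultimately show ?thesis
      unfolding J_def by blast
  qed
  then have "Poly_Mapping.single \<mu> (Poly_Mapping.lookup p \<mu>) \<in> J" if "\<mu> \<in> Poly_Mapping.keys p" for \<mu>
    using assms(2,3) that by (cases "\<mu> = 0") (auto simp: polys_in_def)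
  then have "(\<Sum>\<mu>\<in>Poly_Mapping.keys p. Poly_Mapping.single \<mu> (Poly_Mapping.lookup p \<mu>)) \<in> J"
    by (rule sum)
  then show ?thesis
    unfolding sum_single_lookup J_def by simp
qed

locale weighted_blocks =
  fixes m r :: "nat \<Rightarrow> nat" and t :: nat
  assumes m_pos: "i \<in> {1..t} \<Longrightarrow> 1 \<le> m i"
    and m_mono: "strict_mono_on {1..t} m"
begin

abbreviation "V \<equiv> coords r t"
abbreviation "B \<equiv> coords_below r t"

lemma m_pos_coords: "v \<in> V \<Longrightarrow> 0 < m (fst v)"
  using m_pos[of "fst v"] by (auto simp: coords_def)

lemma wdegree_pos:
  assumes "Poly_Mapping.keys \<mu> \<subseteq> V" "\<mu> \<noteq> 0"
  shows "0 < wdegree m \<mu>"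
proof -
  obtain v where v: "v \<in> Poly_Mapping.keys \<mu>"
    using assms(2) by (metis all_not_in_conv keys_eq_empty)
  then have "0 < m (fst v)"
    using m_pos_coords assms(1) by blast
  then have "0 < m (fst v) * Poly_Mapping.lookup \<mu> v"
    using v by (auto simp: in_keys_iff)
  also have "\<dots> \<le> wdegree m \<mu>"
    unfolding wdegree_def using v by (intro member_le_sum) auto
  finally show ?thesis .
qed

lemma homog_keys_cases:
  assumes "p \<in> homog_polys m (m i) V" "\<mu> \<in> Poly_Mapping.keys p" "i \<in> {1..t}"
  obtains k where "k < r i" "\<mu> = Poly_Mapping.single (i, k) 1" | "Poly_Mapping.keys \<mu> \<subseteq> B i"
proof (cases "Poly_Mapping.keys \<mu> \<subseteq> B i")
  case False
  have \<mu>: "Poly_Mapping.keys \<mu> \<subseteq> V" "wdegree m \<mu> = m i"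
    using assms by (auto simp: homog_polys_def monomials_of_def)
  with False obtain v where v: "v \<in> Poly_Mapping.keys \<mu>" "i \<le> fst v" "v \<in> V"
    by (force simp: coords_below_def)
  define \<nu> where "\<nu> = \<mu> - Poly_Mapping.single v 1"
  have \<mu>_eq: "\<mu> = \<nu> + Poly_Mapping.single v 1"
    using v by (intro poly_mapping_eqI)
      (auto simp: \<nu>_def lookup_add lookup_minus lookup_single when_def in_keys_iff)
  have fst_v: "fst v \<in> {1..t}"
    using v by (auto simp: coords_def)
  have "m i \<le> m (fst v)"
    using v fst_v assms(3) m_mono by (metis le_neq_implies_less order.order_iff_strict strict_mono_onD)
  with \<mu>(2) have *: "wdegree m \<nu> = 0" "m (fst v) = m i"
    unfolding \<mu>_eq by simp_all
  have "\<nu> = 0"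
    using * wdegree_pos[of \<nu>] \<mu>(1) unfolding \<mu>_eq keys_add_nat by auto
  moreover have "fst v = i"
    using * fst_v assms(3) v(2) m_mono by (metis le_neq_implies_less less_irrefl strict_mono_onD)
  ultimately show ?thesis
    using \<mu>_eq v(3) that(1)[of "snd v"] by (auto simp: coords_def)
qed (use that in auto)

lemma homog_le:
  assumes "p \<in> homog_polys m (m i) V" "i \<in> {1..t}"
  shows "p \<in> homog_polys m (m i) (B (Suc i))"
proof -
  have "Poly_Mapping.keys \<mu> \<subseteq> B (Suc i)" if "\<mu> \<in> Poly_Mapping.keys p" for \<mu>
    using assms(1) that assms(2)
  proof (cases rule: homog_keys_cases)
    case 1
    then show ?thesis using assms(2) by (auto simp: coords_below_def coords_def)
  qed (auto simp: coords_below_def)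
  then show ?thesis
    using assms(1) by (auto simp: homog_polys_def monomials_of_def)
qed

lemma lookup_below_eq_0:
  "p \<in> polys_in (B i) \<Longrightarrow> Poly_Mapping.lookup p (Poly_Mapping.single (i, k) 1) = 0"
  by (rule ccontr) (auto simp: polys_in_def coords_below_def simp flip: in_keys_iff)

end

lemma lookup_var_poly: "Poly_Mapping.lookup (var_poly v) \<mu> = (if \<mu> = Poly_Mapping.single v 1 then 1 else 0)"
  by (auto simp: var_poly_def lookup_single when_def)

lemma single_eq_single_iff: "k \<noteq> 0 \<Longrightarrow> Poly_Mapping.single v k = Poly_Mapping.single w k \<longleftrightarrow> v = w"
  by (metis keys_single singleton_inject)

lemma lookup_linear_form:
  assumes "finite K" "k \<in> K"
  shows "Poly_Mapping.lookup (\<Sum>l\<in>K. const_poly (c l) * var_poly (i, l)) (Poly_Mapping.single (i, k) 1) = c k"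
proof -
  have "Poly_Mapping.lookup (\<Sum>l\<in>K. const_poly (c l) * var_poly (i, l)) (Poly_Mapping.single (i, k) 1) =
      (\<Sum>l\<in>K. if l = k then c k else 0)"
    unfolding lookup_sum by (intro sum.cong) (auto simp: lookup_var_poly single_eq_single_iff)
  then show ?thesis using assms by simp
qed

context weighted_blocks
begin

lemma homog_decomp:
  fixes p :: "(coord, 'a::comm_ring_1) mpoly"
  assumes "p \<in> homog_polys m (m i) V" "i \<in> {1..t}"
  obtains q where "q \<in> homog_polys m (m i) (B i)"
    "p = (\<Sum>k<r i. const_poly (Poly_Mapping.lookup p (Poly_Mapping.single (i, k) 1)) * var_poly (i, k)) + q"
proof -
  let ?l = "\<Sum>k<r i. const_poly (Poly_Mapping.lookup p (Poly_Mapping.single (i, k) 1)) * var_poly (i, k)"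
  have "?l \<in> homog_polys m (m i) V"
    using assms(2) by (intro homog_sum homog_const_mult homog_var) (auto simp: coords_def)
  with assms(1) have h: "p - ?l \<in> homog_polys m (m i) V"
    by (rule homog_diff)
  have "Poly_Mapping.keys \<mu> \<subseteq> B i" if "\<mu> \<in> Poly_Mapping.keys (p - ?l)" for \<mu>
    using h that assms(2)
  proof (cases rule: homog_keys_cases)
    case (1 k)
    have "Poly_Mapping.lookup ?l \<mu> = Poly_Mapping.lookup p \<mu>"
      unfolding 1(2) by (rule lookup_linear_form) (use 1 in auto)
    with that show ?thesis
      by (simp add: in_keys_iff lookup_minus)
  qed
  then have "p - ?l \<in> homog_polys m (m i) (B i)"
    using h by (auto simp: homog_polys_def monomials_of_def)
  then show ?thesis
    by (intro that[of "p - ?l"]) auto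
qed

definition hmaps :: "'a::comm_ring_1 polymap set" where
  "hmaps = (\<Pi>\<^sub>E v\<in>V. homog_polys m (m (fst v)) V)"

definition pcomp :: "'a::comm_ring_1 polymap \<Rightarrow> 'a polymap \<Rightarrow> 'a polymap" where
  "pcomp F H = (\<lambda>v\<in>V. subst_poly H (F v))"

definition pid :: "'a::comm_ring_1 polymap" where
  "pid = (\<lambda>v\<in>V. var_poly v)"

lemma hmaps_homog: "F \<in> hmaps \<Longrightarrow> v \<in> V \<Longrightarrow> F v \<in> homog_polys m (m (fst v)) V"
  by (auto simp: hmaps_def)

lemma hmaps_polys_in: "F \<in> hmaps \<Longrightarrow> v \<in> V \<Longrightarrow> F v \<in> polys_in V"
  using hmaps_homog homog_imp_polys_in by blast

lemma hmaps_ext: "F \<in> hmaps \<Longrightarrow> F \<in> extensional V"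
  by (auto simp: hmaps_def PiE_def)

lemma pcomp_apply: "v \<in> V \<Longrightarrow> pcomp F H v = subst_poly H (F v)"
  by (simp add: pcomp_def)

lemma pcomp_closed: "F \<in> hmaps \<Longrightarrow> H \<in> hmaps \<Longrightarrow> pcomp F H \<in> hmaps"
  unfolding hmaps_def[where 'a='a] pcomp_def
  by (intro restrict_PiE_iff[THEN iffD2] ballI homog_subst[where V = V]) auto

lemma pid_closed: "pid \<in> hmaps"
  by (auto simp: hmaps_def pid_def intro: homog_var)

lemma pcomp_assoc:
  assumes "F \<in> hmaps"
  shows "pcomp (pcomp F H) K = pcomp F (pcomp H K)"
  unfolding pcomp_def
  by (intro restrict_ext) (auto simp: subst_subst intro!: subst_cong[OF hmaps_polys_in[OF assms]])

lemma pcomp_pid_left: "H \<in> hmaps \<Longrightarrow> pcomp pid H = H"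
  using hmaps_ext[of H] by (auto simp: pcomp_def pid_def fun_eq_iff extensional_def)

lemma carrier_equiv_end:
  "carrier (equiv_end ty m r t) = {F \<in> hmaps. punctured V F}"
proof -
  have "F \<in> V \<rightarrow>\<^sub>E polys_in V \<and> equivariant m V F \<longleftrightarrow> F \<in> hmaps" for F :: "'a polymap"
  proof -
    have "F \<in> hmaps \<longleftrightarrow> F \<in> V \<rightarrow>\<^sub>E polys_in V \<and> (\<forall>v\<in>V. F v \<in> homog_polys m (m (fst v)) V)"
      unfolding hmaps_def PiE_iff using homog_imp_polys_in by blast
    then show ?thesis
      using equivariant_iff[of V F m] by (metis PiE_mem)
  qed
  then show ?thesis
    unfolding equiv_end_def by auto
qed

lemma invertible_imp_punctured:
  assumes "F \<in> hmaps" "H \<in> hmaps" "pcomp H F = pid"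
  shows "punctured V F"
  unfolding punctured_def
proof
  fix v assume v: "v \<in> V"
  have "0 \<notin> Poly_Mapping.keys (H v)"
    using hmaps_homog[OF assms(2) v] m_pos_coords[OF v] by (auto simp: homog_polys_def monomials_of_def)
  then obtain A where A: "\<forall>w\<in>V. A w \<in> polys_in V" "H v = (\<Sum>w\<in>V. A w * var_poly w)"
    using no_const_term_in_var_ideal[OF finite_coords hmaps_polys_in[OF assms(2) v]] by auto
  have "var_poly v = subst_poly F (H v)"
    using v assms(3) pcomp_apply[OF v, of H F] by (simp add: pid_def)
  also have "\<dots> = (\<Sum>w\<in>V. subst_poly F (A w) * F w)"
    by (simp add: A)
  finally have "var_poly v ^ 1 = (\<Sum>w\<in>V. subst_poly F (A w) * F w)"
    by simp
  moreover have "\<forall>w\<in>V. subst_poly F (A w) \<in> polys_in V"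
    using A(1) hmaps_polys_in[OF assms(1)] by (auto intro: polys_in_subst)
  ultimately show "\<exists>n A. (\<forall>w\<in>V. A w \<in> polys_in V) \<and> var_poly v ^ n = (\<Sum>w\<in>V. A w * F w)"
    by (intro exI[of _ 1] exI[of _ "\<lambda>w. subst_poly F (A w)"] conjI)
qed

lemma carrier_equiv_aut:
  "carrier (equiv_aut ty m r t) = {F \<in> hmaps. \<exists>H\<in>hmaps. pcomp F H = pid \<and> pcomp H F = pid}"
  unfolding equiv_aut_def units_of_carrier Units_def carrier_equiv_end
  by (auto simp: equiv_end_def simp flip: pcomp_def pid_def intro: invertible_imp_punctured)

lemma mult_equiv_aut [simp]: "F \<otimes>\<^bsub>equiv_aut ty m r t\<^esub> H = pcomp F H"
  by (simp add: equiv_aut_def units_of_def equiv_end_def pcomp_def)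

lemma one_equiv_aut [simp]: "\<one>\<^bsub>equiv_aut ty m r t\<^esub> = pid"
  by (simp add: equiv_aut_def units_of_def equiv_end_def pid_def)

lemma equiv_aut_hmaps: "F \<in> carrier (equiv_aut ty m r t) \<Longrightarrow> F \<in> hmaps"
  by (simp add: carrier_equiv_aut)

lemma group_equiv_aut: "group (equiv_aut ty m r t)"
proof (rule groupI)
  let ?G = "equiv_aut ty m r t"
  show "F \<otimes>\<^bsub>?G\<^esub> H \<in> carrier ?G" if FH: "F \<in> carrier ?G" "H \<in> carrier ?G" for F H
  proof -
    obtain F' H' where *: "F' \<in> hmaps" "H' \<in> hmaps" "pcomp F F' = pid" "pcomp F' F = pid"
      "pcomp H H' = pid" "pcomp H' H = pid" "F \<in> hmaps" "H \<in> hmaps"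
      using FH unfolding carrier_equiv_aut by auto
    have "pcomp (pcomp F H) (pcomp H' F') = pcomp F (pcomp (pcomp H H') F')"
      using *(1,2,7,8) by (simp add: pcomp_assoc pcomp_closed)
    moreover have "pcomp (pcomp H' F') (pcomp F H) = pcomp H' (pcomp (pcomp F' F) H)"
      using *(1,2,7,8) by (simp add: pcomp_assoc pcomp_closed)
    ultimately have "pcomp (pcomp F H) (pcomp H' F') = pid" "pcomp (pcomp H' F') (pcomp F H) = pid"
      using * by (simp_all add: pcomp_pid_left)
    then show ?thesis
      using * by (auto simp: carrier_equiv_aut pcomp_closed)
  qed
  show "\<exists>H\<in>carrier ?G. H \<otimes>\<^bsub>?G\<^esub> F = \<one>\<^bsub>?G\<^esub>" if "F \<in> carrier ?G" for F
    using that by (auto simp: carrier_equiv_aut)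
qed (auto simp: carrier_equiv_aut pcomp_assoc pid_closed pcomp_pid_left)

section \<open>The linear part of an automorphism\<close>

lemma sum_scalar_prod_mat:
  "A \<in> carrier_mat n n \<Longrightarrow> C \<in> carrier_mat n n \<Longrightarrow> j < n \<Longrightarrow> l < n \<Longrightarrow>
    (A * C) $$ (j, l) = (\<Sum>k<n. A $$ (j, k) * C $$ (k, l))"
  by (simp add: scalar_prod_def atLeast0LessThan)

lemma carrier_GL: "carrier (GL ty n) = {A \<in> carrier_mat n n. \<exists>C\<in>carrier_mat n n. C * A = 1\<^sub>m n \<and> A * C = 1\<^sub>m n}"
  by (auto simp: GL_def units_of_carrier Units_def ring_mat_simps)

lemma mult_GL [simp]: "A \<otimes>\<^bsub>GL ty n\<^esub> C = A * C"
  by (simp add: GL_def units_of_def ring_mat_simps)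

lemma one_GL [simp]: "\<one>\<^bsub>GL ty n\<^esub> = 1\<^sub>m n"
  by (simp add: GL_def units_of_def ring_mat_simps)

lemma group_GL: "group (GL TYPE('a::comm_ring_1) n)"
  unfolding GL_def using ring.is_monoid[OF ring_mat] by (rule monoid.units_group)

lemma group_GL_prod: "group (GL_prod TYPE('a::comm_ring_1) r t)"
  by (simp add: GL_prod_def group_GL)

definition lin_part :: "'a::comm_ring_1 polymap \<Rightarrow> nat \<Rightarrow> 'a mat" where
  "lin_part F = (\<lambda>i\<in>{1..t}. mat (r i) (r i)
     (\<lambda>(j, k). Poly_Mapping.lookup (F (i, j)) (Poly_Mapping.single (i, k) 1)))"

lemma lin_part_carrier [simp]: "i \<in> {1..t} \<Longrightarrow> lin_part F i \<in> carrier_mat (r i) (r i)"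
  by (simp add: lin_part_def)

lemma lin_part_index: "(i, j) \<in> V \<Longrightarrow> k < r i \<Longrightarrow>
  lin_part F i $$ (j, k) = Poly_Mapping.lookup (F (i, j)) (Poly_Mapping.single (i, k) 1)"
  by (simp add: lin_part_def coords_iff)

lemma hmaps_decomp:
  assumes "F \<in> hmaps" "(i, j) \<in> V"
  obtains q where "q \<in> homog_polys m (m i) (B i)"
    "F (i, j) = (\<Sum>k<r i. const_poly (lin_part F i $$ (j, k)) * var_poly (i, k)) + q"
proof -
  have "i \<in> {1..t}" "F (i, j) \<in> homog_polys m (m i) V"
    using assms hmaps_homog[OF assms] by (auto simp: coords_iff)
  from homog_decomp[OF this(2,1)] show ?thesis
    using that assms(2) by (auto simp: lin_part_index)
qed

lemma hmaps_subst_below: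
  assumes "H \<in> hmaps" "q \<in> homog_polys m d (B i)"
  shows "subst_poly H q \<in> homog_polys m d (B i)"
proof (rule homog_subst[OF assms(2)])
  fix v assume v: "v \<in> B i"
  then have "H v \<in> homog_polys m (m (fst v)) (B (Suc (fst v)))"
    using assms(1) by (intro homog_le hmaps_homog) (auto simp: coords_below_def coords_def)
  moreover have "B (Suc (fst v)) \<subseteq> B i"
    using v by (auto simp: coords_below_def)
  ultimately show "H v \<in> homog_polys m (m (fst v)) (B i)"
    by (rule homog_polys_monoD)
qed

lemma lin_part_pcomp:
  assumes "F \<in> hmaps" "H \<in> hmaps" "i \<in> {1..t}"
  shows "lin_part (pcomp F H) i = lin_part F i * lin_part H i"
proof (rule eq_matI)
  fix j l assume "j < dim_row (lin_part F i * lin_part H i)" "l < dim_col (lin_part F i * lin_part H i)"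
  then have jl: "j < r i" "l < r i"
    using assms(3) by (simp_all add: lin_part_def)
  then have ij: "(i, j) \<in> V"
    using assms(3) by (simp add: coords_iff)
  let ?x = "Poly_Mapping.single (i, l) 1"
  obtain q where q: "q \<in> homog_polys m (m i) (B i)"
    "F (i, j) = (\<Sum>k<r i. const_poly (lin_part F i $$ (j, k)) * var_poly (i, k)) + q"
    using hmaps_decomp[OF assms(1) ij] .
  have "lin_part (pcomp F H) i $$ (j, l) = Poly_Mapping.lookup (subst_poly H (F (i, j))) ?x"
    using ij jl by (simp add: lin_part_index pcomp_apply)
  also have "\<dots> = (\<Sum>k<r i. lin_part F i $$ (j, k) * Poly_Mapping.lookup (H (i, k)) ?x) +
      Poly_Mapping.lookup (subst_poly H q) ?x"
    unfolding q(2) by (simp add: lookup_add lookup_sum)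
  also have "Poly_Mapping.lookup (subst_poly H q) ?x = 0"
    using hmaps_subst_below[OF assms(2) q(1)] by (intro lookup_below_eq_0 homog_imp_polys_in)
  also have "(\<Sum>k<r i. lin_part F i $$ (j, k) * Poly_Mapping.lookup (H (i, k)) ?x) =
      (\<Sum>k<r i. lin_part F i $$ (j, k) * lin_part H i $$ (k, l))"
    using assms(3) jl by (intro sum.cong) (auto simp: lin_part_index coords_iff)
  finally show "lin_part (pcomp F H) i $$ (j, l) = (lin_part F i * lin_part H i) $$ (j, l)"
    using assms(3) jl by (simp add: sum_scalar_prod_mat[where n = "r i"])
qed (use assms(3) in \<open>auto simp: lin_part_def\<close>)

lemma lin_part_pid: "lin_part pid = (\<lambda>i\<in>{1..t}. 1\<^sub>m (r i))"
  unfolding lin_part_def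
  by (intro restrict_ext eq_matI)
    (auto simp: pid_def coords_iff lookup_var_poly single_eq_single_iff)

lemma lin_part_hom: "lin_part \<in> hom (equiv_aut TYPE('a::comm_ring_1) m r t) (GL_prod TYPE('a) r t)"
proof (rule homI)
  fix F :: "'a polymap" assume "F \<in> carrier (equiv_aut TYPE('a) m r t)"
  then obtain H where H: "F \<in> hmaps" "H \<in> hmaps" "pcomp F H = pid" "pcomp H F = pid"
    by (auto simp: carrier_equiv_aut)
  have "lin_part F i \<in> carrier (GL TYPE('a) (r i))" if "i \<in> {1..t}" for i
    using that H lin_part_pcomp[of F H i] lin_part_pcomp[of H F i]
    by (auto simp: carrier_GL lin_part_pid intro!: bexI[of _ "lin_part H i"])
  then show "lin_part F \<in> carrier (GL_prod TYPE('a) r t)"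
    by (auto simp: GL_prod_def lin_part_def)
next
  fix F H :: "'a polymap" assume FH: "F \<in> carrier (equiv_aut TYPE('a) m r t)" "H \<in> carrier (equiv_aut TYPE('a) m r t)"
  show "lin_part (F \<otimes>\<^bsub>equiv_aut TYPE('a) m r t\<^esub> H) = lin_part F \<otimes>\<^bsub>GL_prod TYPE('a) r t\<^esub> lin_part H"
    using FH by (auto simp: GL_prod_def fun_eq_iff lin_part_pcomp equiv_aut_hmaps)
      (auto simp: lin_part_def)
qed

lemma lin_aut_closed: "lin_aut r t A \<in> hmaps"
  by (auto simp: hmaps_def lin_aut_def coords_def intro!: homog_sum homog_const_mult homog_var)

lemma lin_aut_apply: "(i, j) \<in> V \<Longrightarrow> lin_aut r t A (i, j) = (\<Sum>k<r i. const_poly (A i $$ (j, k)) * var_poly (i, k))"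
  by (simp add: lin_aut_def)

lemma lin_aut_cong:
  "(\<And>i j k. i \<in> {1..t} \<Longrightarrow> j < r i \<Longrightarrow> k < r i \<Longrightarrow> A i $$ (j, k) = C i $$ (j, k)) \<Longrightarrow>
    lin_aut r t A = lin_aut r t C"
  unfolding lin_aut_def by (intro restrict_ext sum.cong) (auto simp: coords_def)

lemma lin_aut_one: "lin_aut r t (\<lambda>i\<in>{1..t}. 1\<^sub>m (r i)) = pid"
  unfolding lin_aut_def pid_def
proof (intro restrict_ext)
  fix v assume v: "v \<in> V"
  have "(\<Sum>k<r (fst v). const_poly ((\<lambda>i\<in>{1..t}. 1\<^sub>m (r i)) (fst v) $$ (snd v, k)) * var_poly (fst v, k)) =
     (\<Sum>k<r (fst v). if k = snd v then var_poly v else (0 :: (coord, 'a) mpoly))"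
    using v by (intro sum.cong) (auto simp: coords_def)
  then show "(\<Sum>k<r (fst v). const_poly ((\<lambda>i\<in>{1..t}. 1\<^sub>m (r i)) (fst v) $$ (snd v, k)) * var_poly (fst v, k)) =
     (var_poly v :: (coord, 'a) mpoly)"
    using v by (auto simp: coords_def)
qed

lemma lin_aut_eq_pid: "(\<And>i. i \<in> {1..t} \<Longrightarrow> A i = 1\<^sub>m (r i)) \<Longrightarrow> lin_aut r t A = pid"
  unfolding lin_aut_one[symmetric] by (rule lin_aut_cong) simp

lemma pcomp_lin_aut:
  assumes "\<And>i. i \<in> {1..t} \<Longrightarrow> A i \<in> carrier_mat (r i) (r i)" "\<And>i. i \<in> {1..t} \<Longrightarrow> C i \<in> carrier_mat (r i) (r i)"
  shows "pcomp (lin_aut r t A) (lin_aut r t C) = lin_aut r t (\<lambda>i\<in>{1..t}. A i * C i)"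
  unfolding pcomp_def lin_aut_def[of r t "\<lambda>i\<in>{1..t}. A i * C i"]
proof (rule restrict_ext)
  fix v assume v: "v \<in> V"
  define i j where "i = fst v" "j = snd v"
  have ij: "v = (i, j)" "i \<in> {1..t}" "j < r i"
    using v by (auto simp: i_j_def coords_def)
  have "subst_poly (lin_aut r t C) (lin_aut r t A v) =
      (\<Sum>k<r i. \<Sum>l<r i. const_poly (A i $$ (j, k)) * (const_poly (C i $$ (k, l)) * var_poly (i, l)))"
    using ij v by (simp add: lin_aut_apply coords_iff sum_distrib_left)
  also have "\<dots> = (\<Sum>l<r i. \<Sum>k<r i. const_poly (A i $$ (j, k)) * (const_poly (C i $$ (k, l)) * var_poly (i, l)))"
    by (rule sum.swap)
  also have "\<dots> = (\<Sum>l<r i. const_poly ((A i * C i) $$ (j, l)) * var_poly (i, l))"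
    using ij assms[of i]
    by (intro sum.cong) (auto simp: sum_scalar_prod_mat[where n = "r i"] const_poly_sum const_poly_mult
        sum_distrib_right mult.assoc simp del: index_mult_mat)
  finally show "subst_poly (lin_aut r t C) (lin_aut r t A v) =
    (\<Sum>k<r (fst v). const_poly ((\<lambda>i\<in>{1..t}. A i * C i) (fst v) $$ (snd v, k)) * var_poly (fst v, k))"
    using ij by simp
qed

lemma lin_aut_hom: "lin_aut r t \<in> hom (GL_prod TYPE('a::comm_ring_1) r t) (equiv_aut TYPE('a) m r t)"
proof (rule homI)
  fix A assume "A \<in> carrier (GL_prod TYPE('a) r t)"
  then have A: "A i \<in> carrier (GL TYPE('a) (r i))" if "i \<in> {1..t}" for i
    using that by (auto simp: GL_prod_def)
  then have "\<forall>i\<in>{1..t}. \<exists>C\<in>carrier_mat (r i) (r i). C * A i = 1\<^sub>m (r i) \<and> A i * C = 1\<^sub>m (r i)"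
    by (auto simp: carrier_GL)
  then obtain C where C: "\<And>i. i \<in> {1..t} \<Longrightarrow> C i \<in> carrier_mat (r i) (r i)"
    "\<And>i. i \<in> {1..t} \<Longrightarrow> C i * A i = 1\<^sub>m (r i) \<and> A i * C i = 1\<^sub>m (r i)"
    by metis
  have A': "A i \<in> carrier_mat (r i) (r i)" if "i \<in> {1..t}" for i
    using A[OF that] by (simp add: carrier_GL)
  have "pcomp (lin_aut r t A) (lin_aut r t C) = pid"
    using A' C by (subst pcomp_lin_aut) (auto intro: lin_aut_eq_pid)
  moreover have "pcomp (lin_aut r t C) (lin_aut r t A) = pid"
    using A' C by (subst pcomp_lin_aut) (auto intro: lin_aut_eq_pid)
  ultimately
  show "lin_aut r t A \<in> carrier (equiv_aut TYPE('a) m r t)"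
    unfolding carrier_equiv_aut using lin_aut_closed by blast
next
  fix A C assume "A \<in> carrier (GL_prod TYPE('a) r t)" "C \<in> carrier (GL_prod TYPE('a) r t)"
  then show "lin_aut r t (A \<otimes>\<^bsub>GL_prod TYPE('a) r t\<^esub> C) =
     lin_aut r t A \<otimes>\<^bsub>equiv_aut TYPE('a) m r t\<^esub> lin_aut r t C"
    by (subst mult_equiv_aut, subst pcomp_lin_aut) (auto simp: GL_prod_def carrier_GL PiE_iff)
qed

lemma lin_part_lin_aut:
  assumes "A \<in> carrier (GL_prod TYPE('a::comm_ring_1) r t)"
  shows "lin_part (lin_aut r t A) = A"
proof
  fix i
  show "lin_part (lin_aut r t A) i = A i"
  proof (cases "i \<in> {1..t}")
    case True
    then have "A i \<in> carrier_mat (r i) (r i)"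
      using assms by (auto simp: GL_prod_def carrier_GL PiE_iff)
    then show ?thesis
      using True by (intro eq_matI)
        (auto simp: lin_part_def lin_aut_apply coords_iff lookup_linear_form[unfolded One_nat_def])
  next
    case False
    then show ?thesis
      using assms by (auto simp: lin_part_def GL_prod_def PiE_iff extensional_def)
  qed
qed

lemma unip_eq_kernel:
  "unip TYPE('a::comm_ring_1) m r t = kernel (equiv_aut TYPE('a) m r t) (GL_prod TYPE('a) r t) lin_part"
  (is "_ = kernel ?G ?Q _")
proof (intro equalityI subsetI)
  fix F assume F: "F \<in> unip TYPE('a) m r t"
  have "lin_part F i = lin_part pid i" for i
  proof (cases "i \<in> {1..t}")
    case i: True
    show ?thesis
    proof (rule eq_matI)
      fix j k assume jk: "j < dim_row (lin_part pid i)" "k < dim_col (lin_part pid i)"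
      then have jk: "j < r i" "k < r i"
        using i by (auto simp: lin_part_def)
      then have v: "(i, j) \<in> V"
        using i by (simp add: coords_iff)
      then obtain P where "P \<in> homog_polys m (m i) (B i)" "F (i, j) = var_poly (i, j) + P"
        using F by (force simp: unip_def)
      with v jk show "lin_part F i $$ (j, k) = lin_part pid i $$ (j, k)"
        using lookup_below_eq_0[OF homog_imp_polys_in]
        by (simp add: lin_part_index pid_def lookup_add)
    qed (use i in \<open>auto simp: lin_part_def\<close>)
  qed (auto simp: lin_part_def)
  then have "lin_part F = lin_part pid" ..
  then show "F \<in> kernel ?G ?Q lin_part"
    using F by (auto simp: kernel_def unip_def lin_part_pid GL_prod_def)
next
  fix F assume F: "F \<in> kernel ?G ?Q lin_part"
  then have FG: "F \<in> carrier ?G" and lp: "lin_part F = (\<lambda>i\<in>{1..t}. 1\<^sub>m (r i))"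
    by (auto simp: kernel_def GL_prod_def)
  have "\<exists>P\<in>homog_polys m (m (fst v)) (B (fst v)). F v = var_poly v + P" if v: "v \<in> V" for v
  proof -
    obtain i j where ij: "v = (i, j)" by (cases v)
    obtain q where q: "q \<in> homog_polys m (m i) (B i)"
      "F (i, j) = (\<Sum>k<r i. const_poly (lin_part F i $$ (j, k)) * var_poly (i, k)) + q"
      using hmaps_decomp[OF equiv_aut_hmaps[OF FG]] v ij by blast
    have "(\<Sum>k<r i. const_poly (lin_part F i $$ (j, k)) * var_poly (i, k)) = (var_poly (i, j) :: (coord, 'a) mpoly)"
      unfolding lp lin_aut_apply[OF v[unfolded ij], symmetric] lin_aut_one
      using v ij by (simp add: pid_def)
    with q ij show ?thesis by auto
  qed
  with FG show "F \<in> unip TYPE('a) m r t"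
    by (auto simp: unip_def)
qed

end

section \<open>The unipotent factors\<close>

context weighted_blocks
begin

definition shear_polys :: "nat \<Rightarrow> (nat \<Rightarrow> (coord, 'a::comm_ring_1) mpoly) set" where
  "shear_polys b = {P. \<forall>j<r b. P j \<in> homog_polys m (m b) (B b)}"

definition shear :: "nat \<Rightarrow> (nat \<Rightarrow> (coord, 'a::comm_ring_1) mpoly) \<Rightarrow> 'a polymap" where
  "shear b P = (\<lambda>v\<in>V. if fst v = b then var_poly v + P (snd v) else var_poly v)"

lemma shear_polysD: "P \<in> shear_polys b \<Longrightarrow> j < r b \<Longrightarrow> P j \<in> homog_polys m (m b) (B b)"
  by (simp add: shear_polys_def)

lemma shear_polys_in_below: "P \<in> shear_polys b \<Longrightarrow> j < r b \<Longrightarrow> P j \<in> polys_in (B b)"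
  using shear_polysD homog_imp_polys_in by blast

lemma shear_polys_homog: "P \<in> shear_polys b \<Longrightarrow> j < r b \<Longrightarrow> P j \<in> homog_polys m (m b) V"
  using homog_polys_monoD[OF shear_polysD coords_below_subset] .

lemma shear_apply: "(b, j) \<in> V \<Longrightarrow> shear b P (b, j) = var_poly (b, j) + P j"
  by (simp add: shear_def)

lemma shear_apply_other: "v \<in> V \<Longrightarrow> fst v \<noteq> b \<Longrightarrow> shear b P v = var_poly v"
  by (simp add: shear_def)

lemma shear_ext: "shear b P \<in> extensional V"
  by (simp add: shear_def)

lemma shear_cong: "(\<And>j. j < r b \<Longrightarrow> P j = Q j) \<Longrightarrow> shear b P = shear b Q"
  unfolding shear_def by (intro restrict_ext) (auto simp: coords_def)

lemma shear_hmaps: "P \<in> shear_polys b \<Longrightarrow> shear b P \<in> hmaps"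
  unfolding hmaps_def shear_def
proof (intro restrict_PiE_iff[THEN iffD2] ballI)
  fix v assume "P \<in> shear_polys b" "v \<in> V"
  then show "(if fst v = b then var_poly v + P (snd v) else var_poly v) \<in> homog_polys m (m (fst v)) V"
    using shear_polys_homog[of P b "snd v"] by (auto simp: coords_def intro!: homog_add homog_var)
qed

lemma subst_shear_other:
  "q \<in> polys_in {v \<in> V. fst v \<noteq> b} \<Longrightarrow> subst_poly (shear b P) q = q"
  using subst_cong[of q "{v \<in> V. fst v \<noteq> b}" "shear b P" var_poly] by (simp add: shear_apply_other)

lemma coords_below_avoids: "i \<le> b \<Longrightarrow> B i \<subseteq> {v \<in> V. fst v \<noteq> b}"
  by (auto simp: coords_below_def)

lemma subst_shear_below: "q \<in> homog_polys m d (B b) \<Longrightarrow> subst_poly (shear b P) q = q"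
  by (intro subst_shear_other homog_imp_polys_in homog_polys_monoD[OF _ coords_below_avoids]) auto

lemma pcomp_shear:
  assumes "P \<in> shear_polys b"
  shows "pcomp (shear b P) (shear b Q) = shear b (\<lambda>j. P j + Q j)"
  unfolding pcomp_def shear_def[of b "\<lambda>j. P j + Q j"]
proof (rule restrict_ext)
  fix v assume v: "v \<in> V"
  show "subst_poly (shear b Q) (shear b P v) = (if fst v = b then var_poly v + (P (snd v) + Q (snd v)) else var_poly v)"
  proof (cases "fst v = b")
    case True
    then have "P (snd v) \<in> homog_polys m (m b) (B b)"
      using v assms by (auto simp: shear_polys_def coords_def)
    then show ?thesis
      using True v by (simp add: shear_def[of b P] subst_shear_below) (simp add: shear_def)
  qed (use v in \<open>simp add: shear_apply_other\<close>)
qed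

lemma shear_zero: "shear b (\<lambda>_. 0) = pid"
  unfolding shear_def pid_def by (intro restrict_ext) simp

lemma shear_polys_zero: "(\<lambda>_. 0) \<in> shear_polys b"
  by (simp add: shear_polys_def)

lemma shear_polys_add: "P \<in> shear_polys b \<Longrightarrow> Q \<in> shear_polys b \<Longrightarrow> (\<lambda>j. P j + Q j) \<in> shear_polys b"
  by (simp add: shear_polys_def homog_add)

lemma shear_polys_uminus: "P \<in> shear_polys b \<Longrightarrow> (\<lambda>j. - P j) \<in> shear_polys b"
  by (simp add: shear_polys_def homog_uminus)

lemma pcomp_shear_uminus:
  "P \<in> shear_polys b \<Longrightarrow> pcomp (shear b P) (shear b (\<lambda>j. - P j)) = pid"
  "P \<in> shear_polys b \<Longrightarrow> pcomp (shear b (\<lambda>j. - P j)) (shear b P) = pid"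
  by (simp_all add: pcomp_shear shear_polys_uminus shear_zero)

lemma shear_closed: "P \<in> shear_polys b \<Longrightarrow> shear b P \<in> carrier (equiv_aut ty m r t)"
  unfolding carrier_equiv_aut
  using shear_hmaps[of P b] shear_hmaps[OF shear_polys_uminus, of P b] pcomp_shear_uminus[of P b] by auto

lemma unip_factor_eq:
  fixes ty :: "'a::comm_ring_1 itself"
  shows "unip_factor ty m r t b = shear b ` shear_polys b"
proof (intro equalityI subsetI)
  fix F assume F: "F \<in> unip_factor ty m r t b"
  define P where "P = (\<lambda>j. F (b, j) - var_poly (b, j))"
  have "P \<in> shear_polys b" if "b \<in> {1..t}"
    unfolding shear_polys_def
  proof (intro CollectI allI impI)
    fix j assume "j < r b"
    then have "(b, j) \<in> V"
      using that by (simp add: coords_iff)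
    then show "P j \<in> homog_polys m (m b) (B b)"
      using F by (fastforce simp: P_def unip_factor_def unip_def)
  qed
  moreover have "F = shear b P"
  proof
    fix v
    show "F v = shear b P v"
    proof (cases "v \<in> V")
      case True
      then show ?thesis using F by (cases v) (auto simp: shear_def P_def unip_factor_def)
    next
      case False
      then show ?thesis
        using F hmaps_ext[OF equiv_aut_hmaps, of F ty] shear_ext[of b P]
        by (simp add: unip_factor_def unip_def extensional_arb[of _ V])
    qed
  qed
  moreover have "shear b P = shear b (\<lambda>_. 0)" if "b \<notin> {1..t}"
    using that unfolding shear_def by (intro restrict_ext) (auto simp: coords_def)
  ultimately show "F \<in> shear b ` shear_polys b"
    using shear_polys_zero by blast
next
  fix F :: "'a polymap" assume "F \<in> shear b ` shear_polys b"
  then obtain P where P: "P \<in> shear_polys b" "F = shear b P" by auto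
  have "\<exists>Q\<in>homog_polys m (m (fst v)) (B (fst v)). F v = var_poly v + Q" if v: "v \<in> V" for v
  proof (cases "fst v = b")
    case True
    with v P show ?thesis
      by (intro bexI[of _ "P (snd v)"]) (auto simp: shear_def shear_polys_def coords_def)
  next
    case False
    with v P show ?thesis
      by (intro bexI[of _ 0]) (auto simp: shear_apply_other)
  qed
  then show "F \<in> unip_factor ty m r t b"
    using P shear_closed by (auto simp: unip_factor_def unip_def shear_apply_other)
qed

lemma unip_factor_subset: "unip_factor ty m r t b \<subseteq> carrier (equiv_aut ty m r t)"
  by (auto simp: unip_factor_def unip_def)

lemma subgroup_unip_factor: "subgroup (unip_factor ty m r t b) (equiv_aut ty m r t)"
proof -
  interpret G: group "equiv_aut ty m r t" by (rule group_equiv_aut)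
  show ?thesis
  proof (rule G.subgroupI[OF unip_factor_subset])
    fix F assume "F \<in> unip_factor ty m r t b"
    then obtain P where P: "P \<in> shear_polys b" "F = shear b P" by (auto simp: unip_factor_eq)
    have "inv\<^bsub>equiv_aut ty m r t\<^esub> F = shear b (\<lambda>j. - P j)"
      using P by (intro G.inv_equality) (simp_all add: pcomp_shear_uminus shear_closed shear_polys_uminus)
    then show "inv\<^bsub>equiv_aut ty m r t\<^esub> F \<in> unip_factor ty m r t b"
      using P shear_polys_uminus by (auto simp: unip_factor_eq)
  next
    fix F H assume "F \<in> unip_factor ty m r t b" "H \<in> unip_factor ty m r t b"
    then show "F \<otimes>\<^bsub>equiv_aut ty m r t\<^esub> H \<in> unip_factor ty m r t b"
      by (auto simp: unip_factor_eq pcomp_shear shear_polys_add)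
  qed (use shear_polys_zero in \<open>auto simp: unip_factor_eq\<close>)
qed

lemma pcomp_inv_subst:
  assumes "g \<in> carrier (equiv_aut ty m r t)" "p \<in> polys_in V"
  shows "subst_poly g (subst_poly (inv\<^bsub>equiv_aut ty m r t\<^esub> g) p) = p"
proof -
  interpret G: group "equiv_aut ty m r t" by (rule group_equiv_aut)
  have inv: "pcomp (inv\<^bsub>equiv_aut ty m r t\<^esub> g) g = pid"
    using G.l_inv[OF assms(1)] by simp
  have "subst_poly g (subst_poly (inv\<^bsub>equiv_aut ty m r t\<^esub> g) p) = subst_poly var_poly p"
    unfolding subst_subst
  proof (rule subst_cong[OF assms(2)])
    fix v assume v: "v \<in> V"
    then show "subst_poly g ((inv\<^bsub>equiv_aut ty m r t\<^esub> g) v) = var_poly v"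
      using fun_cong[OF inv, of v] by (simp add: pcomp_apply pid_def)
  qed
  then show ?thesis by simp
qed

text \<open>
  If \<open>g\<close> acts on block \<open>b\<close> by a matrix \<open>A\<close> and does not mix that block into the others, then
  conjugation by \<open>g\<close> carries the polynomials \<open>P\<close> to \<open>A (P \<circ> g\<^sup>-\<^sup>1)\<close>.
\<close>

lemma conj_shear:
  assumes g: "g \<in> carrier (equiv_aut ty m r t)" and P: "P \<in> shear_polys b"
    and gb: "\<And>j. (b, j) \<in> V \<Longrightarrow> g (b, j) = (\<Sum>k<r b. const_poly (A j k) * var_poly (b, k))"
    and gc: "\<And>v. v \<in> V \<Longrightarrow> fst v \<noteq> b \<Longrightarrow> g v \<in> polys_in {v \<in> V. fst v \<noteq> b}"
  defines "Q \<equiv> \<lambda>j. \<Sum>k<r b. const_poly (A j k) * subst_poly (inv\<^bsub>equiv_aut ty m r t\<^esub> g) (P k)"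
  shows "conj_by (equiv_aut ty m r t) g (shear b P) = shear b Q" and "Q \<in> shear_polys b"
proof -
  interpret G: group "equiv_aut ty m r t" by (rule group_equiv_aut)
  have inv: "inv\<^bsub>equiv_aut ty m r t\<^esub> g \<in> hmaps"
    using g by (intro equiv_aut_hmaps[of _ ty]) simp
  show Q: "Q \<in> shear_polys b"
    unfolding Q_def using P inv
    by (auto simp: shear_polys_def intro!: homog_sum homog_const_mult hmaps_subst_below)
  have "pcomp g (shear b P) = pcomp (shear b Q) g"
    unfolding pcomp_def
  proof (rule restrict_ext)
    fix v assume v: "v \<in> V"
    show "subst_poly (shear b P) (g v) = subst_poly g (shear b Q v)"
    proof (cases "fst v = b")
      case True
      then obtain j where vj: "v = (b, j)" "j < r b"
        using v by (cases v) (auto simp: coords_iff)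
      have bk: "(b, k) \<in> V" if "k < r b" for k
        using that v vj by (auto simp: coords_iff)
      have P_in: "P k \<in> polys_in V" if "k < r b" for k
        using that P shear_polys_homog homog_imp_polys_in by blast
      have "subst_poly (shear b P) (g v) = (\<Sum>k<r b. const_poly (A j k) * (var_poly (b, k) + P k))"
        using vj v gb[of j] bk by (simp add: shear_apply)
      also have "\<dots> = g v + (\<Sum>k<r b. const_poly (A j k) * P k)"
        using vj v gb[of j] by (simp add: distrib_left sum.distrib)
      also have "\<dots> = subst_poly g (shear b Q v)"
        using vj v g P_in by (simp add: shear_apply Q_def pcomp_inv_subst)
      finally show ?thesis .
    next
      case False
      then show ?thesis
        using v gc[OF v] by (simp add: shear_apply_other subst_shear_other)
    qed
  qed
  then show "conj_by (equiv_aut ty m r t) g (shear b P) = shear b Q"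
    using g P Q by (intro G.conj_by_eqI) (auto simp: shear_closed)
qed

lemma sum_delta_var:
  fixes j n :: nat
  shows "j < n \<Longrightarrow> (\<Sum>k<n. const_poly (if k = j then 1 else 0) * f k) = (f j :: (coord, 'a::comm_ring_1) mpoly)"
proof -
  assume "j < n"
  have "(\<Sum>k<n. const_poly (if k = j then 1 else 0) * f k) = (\<Sum>k<n. if k = j then f k else 0)"
    by (intro sum.cong) auto
  also have "\<dots> = f j"
    using \<open>j < n\<close> by (subst sum.delta) auto
  finally show ?thesis .
qed

lemma conj_unip_factor:
  assumes "a < b" "g \<in> unip_factor ty m r t a" "u \<in> unip_factor ty m r t b"
  shows "conj_by (equiv_aut ty m r t) g u \<in> unip_factor ty m r t b"
proof -
  obtain R P where g: "g = shear a R" "R \<in> shear_polys a" and u: "u = shear b P" "P \<in> shear_polys b"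
    using assms(2,3) by (auto simp: unip_factor_eq)
  have "g (b, j) = (\<Sum>k<r b. const_poly (if k = j then 1 else 0) * var_poly (b, k))" if "(b, j) \<in> V" for j
    using that assms(1) g by (subst sum_delta_var) (auto simp: shear_apply_other coords_iff)
  moreover have "g v \<in> polys_in {v \<in> V. fst v \<noteq> b}" if v: "v \<in> V" "fst v \<noteq> b" for v
  proof (cases "fst v = a")
    case True
    then have "R (snd v) \<in> polys_in (B a)"
      using g v by (auto simp: coords_def intro: shear_polys_in_below)
    moreover have "B a \<subseteq> {v \<in> V. fst v \<noteq> b}"
      using assms(1) by (intro coords_below_avoids) simp
    ultimately have "R (snd v) \<in> polys_in {v \<in> V. fst v \<noteq> b}"
      unfolding polys_in_altdef using homog_polys_monoD by blast
    moreover have "var_poly v \<in> polys_in {v \<in> V. fst v \<noteq> b}"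
      unfolding polys_in_altdef using v by (intro homog_var) auto
    ultimately show ?thesis
      using True v unfolding g polys_in_altdef by (auto simp: shear_def intro!: homog_add)
  next
    case False
    with v show ?thesis
      unfolding g polys_in_altdef by (auto simp: shear_apply_other intro!: homog_var)
  qed
  ultimately show ?thesis
    unfolding u(1) unip_factor_eq
    using conj_shear[OF shear_closed[OF g(2), of ty, folded g(1)] u(2), of "\<lambda>j k. if k = j then 1 else 0"]
    by auto
qed

lemma inv_lin_aut:
  assumes "A \<in> carrier (GL_prod TYPE('a::comm_ring_1) r t)"
  shows "inv\<^bsub>equiv_aut TYPE('a) m r t\<^esub> (lin_aut r t A) =
     lin_aut r t (\<lambda>i\<in>{1..t}. inv\<^bsub>GL TYPE('a) (r i)\<^esub> (A i))"
proof -
  interpret h: group_hom "GL_prod TYPE('a) r t" "equiv_aut TYPE('a) m r t" "lin_aut r t"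
    using group_GL_prod group_equiv_aut lin_aut_hom by (intro group_hom.intro group_hom_axioms.intro)
  show ?thesis
    using assms h.hom_inv[OF assms] by (simp add: GL_prod_def group_GL)
qed

lemma lin_aut_polys_in:
  "v \<in> V \<Longrightarrow> lin_aut r t A v \<in> polys_in {w \<in> V. fst w = fst v}"
  unfolding polys_in_altdef lin_aut_def
  by (auto simp: coords_def intro!: homog_sum homog_const_mult homog_var)

lemma conj_lin_aut_shear:
  assumes "A \<in> carrier (GL_prod TYPE('a::comm_ring_1) r t)" and P: "P \<in> shear_polys b"
  defines "Q \<equiv> \<lambda>j. \<Sum>k<r b. const_poly (A b $$ (j, k)) *
    subst_poly (lin_aut r t (\<lambda>i\<in>{1..t}. inv\<^bsub>GL TYPE('a) (r i)\<^esub> (A i))) (P k)"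
  shows "conj_by (equiv_aut TYPE('a) m r t) (lin_aut r t A) (shear b P) = shear b Q" and "Q \<in> shear_polys b"
proof -
  have g: "lin_aut r t A \<in> carrier (equiv_aut TYPE('a) m r t)"
    using lin_aut_hom assms(1) by (auto simp: hom_def)
  have gb: "lin_aut r t A (b, j) = (\<Sum>k<r b. const_poly (A b $$ (j, k)) * var_poly (b, k))" if "(b, j) \<in> V" for j
    using that by (rule lin_aut_apply)
  have gc: "lin_aut r t A v \<in> polys_in {v \<in> V. fst v \<noteq> b}" if "v \<in> V" "fst v \<noteq> b" for v
    using lin_aut_polys_in[OF that(1), of A] that(2)
    by (auto simp: polys_in_altdef elim: homog_polys_monoD)
  show "conj_by (equiv_aut TYPE('a) m r t) (lin_aut r t A) (shear b P) = shear b Q" and "Q \<in> shear_polys b"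
    using conj_shear[OF g P gb gc] by (simp_all add: Q_def inv_lin_aut assms(1))
qed

section \<open>Coordinates on the unipotent factors\<close>

lemma finite_monomials_of:
  assumes "W \<subseteq> V"
  shows "finite (monomials_of m d W)"
proof (rule finite_imageD)
  have W: "finite W"
    using assms finite_coords by (rule finite_subset)
  have le: "Poly_Mapping.lookup \<mu> v \<le> d" if "\<mu> \<in> monomials_of m d W" "v \<in> W" for \<mu> v
  proof -
    have "Poly_Mapping.lookup \<mu> v \<le> m (fst v) * Poly_Mapping.lookup \<mu> v"
      using m_pos_coords[of v] that assms by auto
    also have "\<dots> \<le> (\<Sum>v\<in>W. m (fst v) * Poly_Mapping.lookup \<mu> v)"
      using that W by (intro member_le_sum) auto
    also have "\<dots> = d"
      using that W wdegree_superset[of W \<mu> m] by (auto simp: monomials_of_def)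
    finally show ?thesis .
  qed
  then show "finite ((\<lambda>\<mu>. \<lambda>v\<in>W. Poly_Mapping.lookup \<mu> v) ` monomials_of m d W)"
    by (intro finite_subset[OF _ finite_PiE[OF W, of "\<lambda>_. {..d}"]]) auto
  show "inj_on (\<lambda>\<mu>. \<lambda>v\<in>W. Poly_Mapping.lookup \<mu> v) (monomials_of m d W)"
  proof (rule inj_onI, rule poly_mapping_eqI)
    fix \<mu> \<nu> v
    assume *: "\<mu> \<in> monomials_of m d W" "\<nu> \<in> monomials_of m d W"
      "(\<lambda>v\<in>W. Poly_Mapping.lookup \<mu> v) = (\<lambda>v\<in>W. Poly_Mapping.lookup \<nu> v)"
    show "Poly_Mapping.lookup \<mu> v = Poly_Mapping.lookup \<nu> v"
    proof (cases "v \<in> W")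
      case True
      then show ?thesis using fun_cong[OF *(3), of v] by simp
    next
      case False
      then have "v \<notin> Poly_Mapping.keys \<mu>" "v \<notin> Poly_Mapping.keys \<nu>"
        using *(1,2) by (auto simp: monomials_of_def)
      then show ?thesis by (simp add: in_keys_iff)
    qed
  qed
qed

lemma finite_K_monomials: "finite (K_monomials m r t a)"
  unfolding K_monomials_def by (intro finite_monomials_of coords_below_subset)

lemma unip_coords_shear:
  assumes "b \<in> {1..t}"
  shows "unip_coords m r t b (shear b P) =
     (\<lambda>(j, \<kappa>)\<in>{..<r b} \<times> K_monomials m r t b. Poly_Mapping.lookup (P j) \<kappa>)"
  unfolding unip_coords_def using assms
  by (intro restrict_ext) (auto simp: shear_apply coords_iff)

lemma unip_coords_iso:
  assumes "b \<in> {1..t}"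
  shows "unip_coords m r t b \<in> iso (equiv_aut ty m r t\<lparr>carrier := unip_factor ty m r t b\<rparr>)
     (vector_group ({..<r b} \<times> K_monomials m r t b))"
proof (rule isoI)
  let ?K = "K_monomials m r t b" and ?U = "unip_factor ty m r t b"
  show "unip_coords m r t b \<in> hom (equiv_aut ty m r t\<lparr>carrier := ?U\<rparr>) (vector_group ({..<r b} \<times> ?K))"
  proof (rule homI)
    fix u assume "u \<in> carrier (equiv_aut ty m r t\<lparr>carrier := ?U\<rparr>)"
    show "unip_coords m r t b u \<in> carrier (vector_group ({..<r b} \<times> ?K))"
      by (simp add: vector_group_def unip_coords_def)
  next
    fix u w assume "u \<in> carrier (equiv_aut ty m r t\<lparr>carrier := ?U\<rparr>)" "w \<in> carrier (equiv_aut ty m r t\<lparr>carrier := ?U\<rparr>)"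
    then obtain P Q where "P \<in> shear_polys b" "u = shear b P" "Q \<in> shear_polys b" "w = shear b Q"
      by (auto simp: unip_factor_eq)
    then show "unip_coords m r t b (u \<otimes>\<^bsub>equiv_aut ty m r t\<lparr>carrier := ?U\<rparr>\<^esub> w) =
        unip_coords m r t b u \<otimes>\<^bsub>vector_group ({..<r b} \<times> ?K)\<^esub> unip_coords m r t b w"
      using assms
      by (simp add: pcomp_shear unip_coords_shear vector_group_def lookup_add)
        (intro restrict_ext, auto)
  qed
  show "bij_betw (unip_coords m r t b) (carrier (equiv_aut ty m r t\<lparr>carrier := ?U\<rparr>))
      (carrier (vector_group ({..<r b} \<times> ?K)))"
    unfolding bij_betw_def
  proof
    show "inj_on (unip_coords m r t b) (carrier (equiv_aut ty m r t\<lparr>carrier := ?U\<rparr>))"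
    proof (rule inj_onI)
      fix u w assume uw: "u \<in> carrier (equiv_aut ty m r t\<lparr>carrier := ?U\<rparr>)"
        "w \<in> carrier (equiv_aut ty m r t\<lparr>carrier := ?U\<rparr>)" "unip_coords m r t b u = unip_coords m r t b w"
      then obtain P Q where PQ: "P \<in> shear_polys b" "u = shear b P" "Q \<in> shear_polys b" "w = shear b Q"
        by (auto simp: unip_factor_eq)
      have "P j = Q j" if j: "j < r b" for j
      proof (rule poly_mapping_eqI)
        fix \<kappa>
        show "Poly_Mapping.lookup (P j) \<kappa> = Poly_Mapping.lookup (Q j) \<kappa>"
        proof (cases "\<kappa> \<in> ?K")
          case True
          then show ?thesis
            using fun_cong[OF uw(3), of "(j, \<kappa>)"] j PQ assms by (simp add: unip_coords_shear)
        next
          case False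
          then have "\<kappa> \<notin> Poly_Mapping.keys (P j)" "\<kappa> \<notin> Poly_Mapping.keys (Q j)"
            using shear_polysD[OF PQ(1) j] shear_polysD[OF PQ(3) j] by (auto simp: homog_polys_def K_monomials_def)
          then show ?thesis by (simp add: in_keys_iff)
        qed
      qed
      then show "u = w"
        unfolding PQ by (rule shear_cong)
    qed
    have "x \<in> unip_coords m r t b ` ?U" if x: "x \<in> {..<r b} \<times> ?K \<rightarrow>\<^sub>E UNIV" for x
    proof -
      define P where "P = (\<lambda>j. \<Sum>\<kappa>\<in>?K. Poly_Mapping.single \<kappa> (x (j, \<kappa>)))"
      have P: "P \<in> shear_polys b"
        unfolding shear_polys_def P_def
      proof (intro CollectI allI impI homog_sum)
        fix j \<kappa> assume "\<kappa> \<in> ?K"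
        then show "Poly_Mapping.single \<kappa> (x (j, \<kappa>)) \<in> homog_polys m (m b) (B b)"
          by (auto simp: homog_polys_def K_monomials_def)
      qed
      have lookup: "Poly_Mapping.lookup (P j) \<kappa> = x (j, \<kappa>)" if "\<kappa> \<in> ?K" for j \<kappa>
      proof -
        have "Poly_Mapping.lookup (P j) \<kappa> = (\<Sum>\<nu>\<in>?K. if \<nu> = \<kappa> then x (j, \<kappa>) else 0)"
          unfolding P_def lookup_sum by (intro sum.cong) (auto simp: lookup_single when_def)
        then show ?thesis using that by (simp add: finite_K_monomials)
      qed
      have "unip_coords m r t b (shear b P) = x"
        using x assms by (auto simp: unip_coords_shear lookup fun_eq_iff PiE_iff extensional_def)
      with P show ?thesis
        unfolding unip_factor_eq by blast
    qed
    moreover have "unip_coords m r t b u \<in> {..<r b} \<times> ?K \<rightarrow>\<^sub>E UNIV" for u :: "'a polymap"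
      by (simp add: unip_coords_def)
    ultimately show "unip_coords m r t b ` carrier (equiv_aut ty m r t\<lparr>carrier := ?U\<rparr>) = carrier (vector_group ({..<r b} \<times> ?K))"
      by (auto simp: vector_group_def)
  qed
qed

section \<open>The semi-direct decomposition\<close>

lemma unip_factor_first: "unip_factor ty m r t 1 = {pid}"
proof -
  have "shear 1 P = pid" if "P \<in> shear_polys 1" for P :: "nat \<Rightarrow> (coord, 'a) mpoly"
  proof -
    have "P (snd v) = 0" if v: "v \<in> V" "fst v = 1" for v
    proof -
      have "B 1 = {}"
        by (auto simp: coords_below_def coords_def)
      then have "Poly_Mapping.keys (P (snd v)) \<subseteq> monomials_of m (m 1) {}"
        using v shear_polysD[OF \<open>P \<in> shear_polys 1\<close>, of "snd v"] by (auto simp: homog_polys_def coords_def)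
      also have "\<dots> = {}"
        using m_pos_coords[OF v(1)] v(2) by (auto simp: monomials_of_def)
      finally show ?thesis by simp
    qed
    then show ?thesis
      unfolding shear_def pid_def by (intro restrict_ext) auto
  qed
  then show ?thesis
    unfolding unip_factor_eq using shear_polys_zero[of 1] by (auto simp: image_iff)
qed

lemma unip_factor_Int:
  fixes ty :: "'a::comm_ring_1 itself"
  assumes "a \<noteq> b"
  shows "unip_factor ty m r t a \<inter> unip_factor ty m r t b = {pid}"
proof (intro equalityI subsetI)
  fix F assume F: "F \<in> unip_factor ty m r t a \<inter> unip_factor ty m r t b"
  then have "F v = pid v" if "v \<in> V" for v
    using that assms by (cases "fst v = a") (auto simp: unip_factor_def pid_def)
  moreover have "F \<in> extensional V"
    using F hmaps_ext[OF equiv_aut_hmaps, of F ty] by (auto simp: unip_factor_def unip_def)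
  ultimately show "F \<in> {pid}"
    by (auto simp: fun_eq_iff extensional_def pid_def)
next
  fix F :: "'a polymap" assume "F \<in> {pid}"
  then have "F = shear a (\<lambda>_. 0)" "F = shear b (\<lambda>_. 0)"
    by (auto simp: shear_zero)
  then show "F \<in> unip_factor ty m r t a \<inter> unip_factor ty m r t b"
    unfolding unip_factor_eq using shear_polys_zero by blast
qed

text \<open>
  A unipotent automorphism is the product of its truncations to single blocks, in increasing order
  of the blocks.
\<close>

lemma unip_subset_generate:
  "unip ty m r t \<subseteq> generate (equiv_aut ty m r t) (\<Union>a\<in>{1..t}. unip_factor ty m r t a)"
proof
  fix F assume F: "F \<in> unip ty m r t"
  let ?G = "equiv_aut ty m r t"
  let ?U = "\<Union>a\<in>{1..t}. unip_factor ty m r t a"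
  define P where "P i = (\<lambda>j. F (i, j) - var_poly (i, j))" for i
  define T where "T k = (\<lambda>v\<in>V. if fst v \<le> k then F v else var_poly v)" for k
  have P: "P i \<in> shear_polys i" if "i \<in> {1..t}" for i
    unfolding shear_polys_def
  proof (intro CollectI allI impI)
    fix j assume "j < r i"
    then have "(i, j) \<in> V"
      using that by (simp add: coords_iff)
    then show "P i j \<in> homog_polys m (m i) (B i)"
      using F by (fastforce simp: P_def unip_def)
  qed
  have below: "P i j \<in> homog_polys m (m i) (B i)" if "(i, j) \<in> V" for i j
    using P[of i] that by (auto simp: shear_polys_def coords_iff)
  have "T k \<in> generate ?G ?U" if "k \<le> t" for k
    using that
  proof (induction k)
    case 0
    have "T 0 = pid"
      unfolding T_def pid_def by (intro restrict_ext) (auto simp: coords_def)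
    then show ?case
      using generate.one[of ?G ?U] by simp
  next
    case (Suc k)
    have "T (Suc k) = pcomp (T k) (shear (Suc k) (P (Suc k)))"
      unfolding pcomp_def T_def[of "Suc k"]
    proof (rule restrict_ext)
      fix v assume v: "v \<in> V"
      show "(if fst v \<le> Suc k then F v else var_poly v) = subst_poly (shear (Suc k) (P (Suc k))) (T k v)"
      proof (cases "fst v \<le> k")
        case True
        obtain i j where ij: "v = (i, j)" by (cases v)
        have "F v = var_poly v + P i j"
          by (simp add: P_def ij)
        moreover have "P i j \<in> polys_in {w \<in> V. fst w \<noteq> Suc k}"
          using below[of i j] v True ij
          by (intro homog_imp_polys_in homog_polys_monoD[OF _ coords_below_avoids]) auto
        ultimately show ?thesis
          using True v by (simp add: T_def shear_apply_other subst_shear_other)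
      next
        case False
        then show ?thesis
          using v by (cases v) (auto simp: T_def shear_def P_def)
      qed
    qed
    moreover have "shear (Suc k) (P (Suc k)) \<in> generate ?G ?U"
      using P[of "Suc k"] Suc.prems by (intro generate.incl) (auto simp: unip_factor_eq)
    moreover have "T k \<in> generate ?G ?U"
      using Suc by simp
    ultimately show ?case
      using generate.eng[of "T k" ?G ?U "shear (Suc k) (P (Suc k))"] by simp
  qed
  moreover have "T t = F"
    using F hmaps_ext[OF equiv_aut_hmaps, of F ty]
    by (auto simp: T_def unip_def fun_eq_iff coords_def extensional_def)
  ultimately show "F \<in> generate ?G ?U" by auto
qed

lemma normal_unip: "unip TYPE('a::comm_ring_1) m r t \<lhd> equiv_aut TYPE('a) m r t"
proof -
  interpret h: group_hom "equiv_aut TYPE('a) m r t" "GL_prod TYPE('a) r t" lin_part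
    using group_GL_prod group_equiv_aut lin_part_hom by (intro group_hom.intro group_hom_axioms.intro)
  show ?thesis
    unfolding unip_eq_kernel by (rule h.normal_kernel)
qed

lemma unip_Int_lin: "unip TYPE('a::comm_ring_1) m r t \<inter> lin_subgroup TYPE('a) r t = {pid}"
  and unip_mult_lin: "unip TYPE('a::comm_ring_1) m r t <#>\<^bsub>equiv_aut TYPE('a) m r t\<^esub> lin_subgroup TYPE('a) r t =
     carrier (equiv_aut TYPE('a) m r t)"
  unfolding unip_eq_kernel lin_subgroup_def one_equiv_aut[of "TYPE('a)", symmetric]
  by (intro split_epi_semidirect group_equiv_aut group_GL_prod lin_part_hom lin_aut_hom lin_part_lin_aut;
      assumption)+

lemma subgroup_lin: "subgroup (lin_subgroup TYPE('a::comm_ring_1) r t) (equiv_aut TYPE('a) m r t)"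
proof -
  interpret h: group_hom "GL_prod TYPE('a) r t" "equiv_aut TYPE('a) m r t" "lin_aut r t"
    using group_GL_prod group_equiv_aut lin_aut_hom by (intro group_hom.intro group_hom_axioms.intro)
  show ?thesis
    unfolding lin_subgroup_def by (rule h.img_is_subgroup)
qed

lemma unip_succ_semidirect:
  "succ_semidirect (equiv_aut TYPE('a::comm_ring_1) m r t\<lparr>carrier := unip TYPE('a) m r t\<rparr>) {1..t}
     (unip_factor TYPE('a) m r t)"
proof -
  let ?G = "equiv_aut TYPE('a) m r t" and ?U = "unip TYPE('a) m r t"
  interpret G: group ?G by (rule group_equiv_aut)
  have U: "subgroup ?U ?G"
    using normal_unip by (rule normal_imp_subgroup)
  have sub: "unip_factor TYPE('a) m r t a \<subseteq> ?U" for a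
    by (auto simp: unip_factor_def)
  have conj: "conj_by (?G\<lparr>carrier := ?U\<rparr>) g u = conj_by ?G g u" if "g \<in> ?U" for g u
    using that U by (simp add: conj_by_def)
  show ?thesis
    unfolding succ_semidirect_def
  proof (intro conjI ballI impI)
    fix a assume "a \<in> {1..t}"
    show "subgroup (unip_factor TYPE('a) m r t a) (?G\<lparr>carrier := ?U\<rparr>)"
      by (intro G.subgroup_incl subgroup_unip_factor U sub)
  next
    fix a b g assume ab: "a < b" "g \<in> unip_factor TYPE('a) m r t a"
    have "conj_by ?G g ` unip_factor TYPE('a) m r t b = unip_factor TYPE('a) m r t b"
      using ab conj_unip_factor
      by (intro G.conj_by_image_eqI[OF subgroup_unip_factor[of "TYPE('a)" a]] unip_factor_subset) auto
    then show "conj_by (?G\<lparr>carrier := ?U\<rparr>) g ` unip_factor TYPE('a) m r t b = unip_factor TYPE('a) m r t b"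
      using conj[of g] ab(2) sub by (simp add: subset_iff cong: image_cong)
  next
    show "generate (?G\<lparr>carrier := ?U\<rparr>) (\<Union>a\<in>{1..t}. unip_factor TYPE('a) m r t a) = carrier (?G\<lparr>carrier := ?U\<rparr>)"
    proof -
      have Us: "(\<Union>a\<in>{1..t}. unip_factor TYPE('a) m r t a) \<subseteq> ?U"
        using sub by blast
      have "generate ?G (\<Union>a\<in>{1..t}. unip_factor TYPE('a) m r t a) = ?U"
        by (intro equalityI G.generate_subgroup_incl[OF Us U] unip_subset_generate)
      then show ?thesis
        using G.generate_consistent[OF Us U] by simp
    qed
  qed (auto simp: unip_factor_Int)
qed

lemma conj_lin_unip_factor:
  assumes "g \<in> lin_subgroup TYPE('a::comm_ring_1) r t" "u \<in> unip_factor TYPE('a) m r t b"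
  shows "conj_by (equiv_aut TYPE('a) m r t) g u \<in> unip_factor TYPE('a) m r t b"
  using assms conj_lin_aut_shear unfolding lin_subgroup_def unip_factor_eq by blast

lemma conj_lin_unip_factor_image:
  assumes "g \<in> lin_subgroup TYPE('a::comm_ring_1) r t"
  shows "conj_by (equiv_aut TYPE('a) m r t) g ` unip_factor TYPE('a) m r t b = unip_factor TYPE('a) m r t b"
  using group.conj_by_image_eqI[OF group_equiv_aut subgroup_lin unip_factor_subset conj_lin_unip_factor assms] .

lemma aut_succ_semidirect:
  "succ_semidirect (equiv_aut TYPE('a::comm_ring_1) m r t) {0..t}
     (\<lambda>a. if a = 0 then lin_subgroup TYPE('a) r t else unip_factor TYPE('a) m r t a)"
  (is "succ_semidirect ?G _ ?W")
proof -
  interpret G: group ?G by (rule group_equiv_aut)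
  let ?U = "unip TYPE('a) m r t" and ?L = "lin_subgroup TYPE('a) r t"
  have sub: "unip_factor TYPE('a) m r t a \<subseteq> ?U" for a
    by (auto simp: unip_factor_def)
  have Int: "?L \<inter> unip_factor TYPE('a) m r t b = {pid}" for b
    using unip_Int_lin[where 'a = 'a] sub[of b] subgroup.one_closed[OF subgroup_unip_factor[of "TYPE('a)" b]]
    by auto
  have W: "subgroup (?W a) ?G" for a
    by (simp add: subgroup_lin subgroup_unip_factor)
  show ?thesis
    unfolding succ_semidirect_def
  proof (intro conjI ballI impI)
    fix a b g assume "a < b" "g \<in> ?W a"
    then show "conj_by ?G g ` ?W b = ?W b"
      using conj_unip_factor[of a b] conj_lin_unip_factor_image[of g b]
        G.conj_by_image_eqI[OF subgroup_unip_factor[of "TYPE('a)" a] unip_factor_subset[of "TYPE('a)" b]]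
      by (auto split: if_splits)
  next
    fix a b :: nat assume "a \<noteq> b"
    then show "?W a \<inter> ?W b = {\<one>\<^bsub>?G\<^esub>}"
      using Int by (auto simp: unip_factor_Int Int_commute)
  next
    have W_sub: "(\<Union>a\<in>{0..t}. ?W a) \<subseteq> carrier ?G"
      using W subgroup.subset by blast
    have "(\<Union>a\<in>{1..t}. unip_factor TYPE('a) m r t a) \<subseteq> (\<Union>a\<in>{0..t}. ?W a)"
      by auto
    then have "?U \<subseteq> generate ?G (\<Union>a\<in>{0..t}. ?W a)"
      using unip_subset_generate[of "TYPE('a)"] G.mono_generate by blast
    moreover have "?L \<subseteq> generate ?G (\<Union>a\<in>{0..t}. ?W a)"
      by (auto intro!: generate.incl)
    ultimately have "?U <#>\<^bsub>?G\<^esub> ?L \<subseteq> generate ?G (\<Union>a\<in>{0..t}. ?W a)"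
      unfolding set_mult_def by (auto intro!: generate.eng simp del: mult_equiv_aut)
    then show "generate ?G (\<Union>a\<in>{0..t}. ?W a) = carrier ?G"
      using G.generate_incl[OF W_sub] by (simp add: unip_mult_lin subset_antisym)
  qed (rule W)
qed

end

section \<open>Base change\<close>

context comm_ring_hom
begin

lemma lookup_map_poly [simp]: "Poly_Mapping.lookup (Poly_Mapping.map hom p) k = hom (Poly_Mapping.lookup p k)"
  by (simp add: Poly_Mapping.map.rep_eq when_def)

lemma map_poly_add: "Poly_Mapping.map hom (p + q) = Poly_Mapping.map hom p + Poly_Mapping.map hom q"
  by (intro poly_mapping_eqI) (simp add: lookup_add hom_add)

lemma map_poly_zero: "Poly_Mapping.map hom 0 = 0"
  by (intro poly_mapping_eqI) simp

lemma map_poly_sum: "Poly_Mapping.map hom (sum f A) = (\<Sum>x\<in>A. Poly_Mapping.map hom (f x))"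
  by (induction A rule: infinite_finite_induct) (auto simp: map_poly_add map_poly_zero)

lemma map_poly_single: "Poly_Mapping.map hom (Poly_Mapping.single \<mu> c) = Poly_Mapping.single \<mu> (hom c)"
  by (intro poly_mapping_eqI) (simp add: lookup_single when_def)

lemma map_poly_const: "Poly_Mapping.map hom (const_poly c) = const_poly (hom c)"
  by (simp add: const_poly_def map_poly_single)

lemma map_poly_var: "Poly_Mapping.map hom (var_poly v) = var_poly v"
  by (simp add: var_poly_def map_poly_single)

lemma map_poly_mult:
  fixes p q :: "('v, 'a) mpoly"
  shows "Poly_Mapping.map hom (p * q) = Poly_Mapping.map hom p * Poly_Mapping.map hom q"
proof -
  let ?s = "\<lambda>p \<mu>. Poly_Mapping.single \<mu> (Poly_Mapping.lookup p \<mu>)"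
  have "Poly_Mapping.map hom (p * q) =
      Poly_Mapping.map hom ((\<Sum>\<mu>\<in>Poly_Mapping.keys p. ?s p \<mu>) * (\<Sum>\<nu>\<in>Poly_Mapping.keys q. ?s q \<nu>))"
    by (simp only: sum_single_lookup)
  also have "\<dots> = (\<Sum>\<mu>\<in>Poly_Mapping.keys p. \<Sum>\<nu>\<in>Poly_Mapping.keys q.
      Poly_Mapping.map hom (?s p \<mu>) * Poly_Mapping.map hom (?s q \<nu>))"
    by (simp add: sum_product map_poly_sum mult_single map_poly_single hom_mult)
  also have "\<dots> = Poly_Mapping.map hom p * Poly_Mapping.map hom q"
    by (simp only: sum_product[symmetric] map_poly_sum[symmetric] sum_single_lookup)
  finally show ?thesis .
qed

lemma map_poly_subst:
  "Poly_Mapping.map hom (subst_poly F p) = subst_poly (\<lambda>v. Poly_Mapping.map hom (F v)) (Poly_Mapping.map hom p)"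
  by (induction p rule: mpoly_induct[where V = UNIV])
    (simp_all add: map_poly_const map_poly_var map_poly_add map_poly_mult)

lemma map_poly_homog: "p \<in> homog_polys m d W \<Longrightarrow> Poly_Mapping.map hom p \<in> homog_polys m d W"
  by (auto simp: homog_polys_def in_keys_iff subset_iff) (metis hom_zero)

end

context weighted_blocks
begin

lemma base_change_hmaps:
  assumes "comm_ring_hom h" "F \<in> hmaps"
  shows "base_change r t h F \<in> hmaps"
  using assms(2) unfolding hmaps_def base_change_def
  by (auto intro: comm_ring_hom.map_poly_homog[OF assms(1)])

lemma base_change_pcomp:
  assumes h: "comm_ring_hom h" and F: "F \<in> hmaps"
  shows "base_change r t h (pcomp F H) = pcomp (base_change r t h F) (base_change r t h H)"
proof -
  interpret h: comm_ring_hom h by fact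
  show ?thesis
    unfolding base_change_def[of r t h "pcomp F H"] pcomp_def[of "base_change r t h F"]
  proof (rule restrict_ext)
    fix v assume v: "v \<in> V"
    have "Poly_Mapping.map h (F v) \<in> polys_in V"
      using hmaps_homog[OF F v] by (intro homog_imp_polys_in h.map_poly_homog)
    then show "Poly_Mapping.map h (pcomp F H v) = subst_poly (base_change r t h H) (base_change r t h F v)"
      using v by (simp add: pcomp_apply h.map_poly_subst base_change_def) (rule subst_cong, auto)
  qed
qed

lemma base_change_pid: "comm_ring_hom h \<Longrightarrow> base_change r t h pid = pid"
  unfolding base_change_def pid_def by (intro restrict_ext) (simp add: comm_ring_hom.map_poly_var)

lemma base_change_hom:
  fixes h :: "'a::comm_ring_1 \<Rightarrow> 'b::comm_ring_1"
  assumes h: "comm_ring_hom h"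
  shows "base_change r t h \<in> hom (equiv_aut TYPE('a) m r t) (equiv_aut TYPE('b) m r t)"
proof (rule homI)
  fix F assume "F \<in> carrier (equiv_aut TYPE('a) m r t)"
  then obtain H where H: "F \<in> hmaps" "H \<in> hmaps" "pcomp F H = pid" "pcomp H F = pid"
    by (auto simp: carrier_equiv_aut)
  then have "pcomp (base_change r t h F) (base_change r t h H) = pid"
    "pcomp (base_change r t h H) (base_change r t h F) = pid"
    by (simp_all add: base_change_pid h flip: base_change_pcomp)
  with H show "base_change r t h F \<in> carrier (equiv_aut TYPE('b) m r t)"
    unfolding carrier_equiv_aut using base_change_hmaps[OF h] by blast
next
  fix F H assume "F \<in> carrier (equiv_aut TYPE('a) m r t)" "H \<in> carrier (equiv_aut TYPE('a) m r t)"
  then show "base_change r t h (F \<otimes>\<^bsub>equiv_aut TYPE('a) m r t\<^esub> H) =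
      base_change r t h F \<otimes>\<^bsub>equiv_aut TYPE('b) m r t\<^esub> base_change r t h H"
    by (simp add: base_change_pcomp h equiv_aut_hmaps)
qed

lemma base_change_lin_aut:
  fixes h :: "'a::comm_ring_1 \<Rightarrow> 'b::comm_ring_1"
  assumes h: "comm_ring_hom h" and A: "A \<in> carrier (GL_prod TYPE('a) r t)"
  shows "base_change r t h (lin_aut r t A) = lin_aut r t (\<lambda>i\<in>{1..t}. map_mat h (A i))"
  unfolding base_change_def lin_aut_def[of r t "\<lambda>i\<in>{1..t}. map_mat h (A i)"]
proof (rule restrict_ext)
  interpret h: comm_ring_hom h by fact
  fix v assume v: "v \<in> V"
  then have i: "fst v \<in> {1..t}" "snd v < r (fst v)"
    by (auto simp: coords_def)
  then have "A (fst v) \<in> carrier_mat (r (fst v)) (r (fst v))"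
    using A by (auto simp: GL_prod_def carrier_GL PiE_iff)
  then show "Poly_Mapping.map h (lin_aut r t A v) = (\<Sum>k<r (fst v).
      const_poly ((\<lambda>i\<in>{1..t}. map_mat h (A i)) (fst v) $$ (snd v, k)) * var_poly (fst v, k))"
    using v i
    by (auto simp: lin_aut_def h.map_poly_sum h.map_poly_mult h.map_poly_const h.map_poly_var intro!: sum.cong)
qed

lemma base_change_shear:
  "comm_ring_hom h \<Longrightarrow> base_change r t h (shear b P) = shear b (\<lambda>j. Poly_Mapping.map h (P j))"
  unfolding base_change_def shear_def
  by (intro restrict_ext) (auto simp: comm_ring_hom.map_poly_add comm_ring_hom.map_poly_var)

lemma base_change_unip_factor:
  fixes h :: "'a::comm_ring_1 \<Rightarrow> 'b::comm_ring_1"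
  assumes "comm_ring_hom h"
  shows "base_change r t h ` unip_factor TYPE('a) m r t b \<subseteq> unip_factor TYPE('b) m r t b"
  using comm_ring_hom.map_poly_homog[OF assms]
  by (auto simp: unip_factor_eq base_change_shear[OF assms] shear_polys_def)

lemma natural_unip_coords:
  fixes h :: "'a::comm_ring_1 \<Rightarrow> 'b::comm_ring_1"
  assumes "comm_ring_hom h" "b \<in> {1..t}"
  shows "natural_along r t h (unip_factor TYPE('a) m r t b) ({..<r b} \<times> K_monomials m r t b)
     (unip_coords m r t b) (unip_coords m r t b)"
  using assms unfolding natural_along_def unip_factor_eq
  by (auto simp: base_change_shear unip_coords_shear comm_ring_hom.lookup_map_poly)

section \<open>Conjugation by the linear factors\<close>

abbreviation "GLf \<equiv> GL_factor r t"

lemma GL_tuple: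
  assumes "g \<in> carrier (GL TYPE('a::comm_ring_1) (r a))"
  shows "(\<lambda>i\<in>{1..t}. if i = a then g else 1\<^sub>m (r i)) \<in> carrier (GL_prod TYPE('a) r t)"
  using assms group.is_monoid[OF group_GL, THEN monoid.one_closed] by (auto simp: GL_prod_def)

lemma GLf_lin_subgroup:
  "g \<in> carrier (GL TYPE('a::comm_ring_1) (r a)) \<Longrightarrow> GLf a g \<in> lin_subgroup TYPE('a) r t"
  unfolding GL_factor_def lin_subgroup_def by (intro imageI GL_tuple)

lemma GLf_apply:
  "(a, j) \<in> V \<Longrightarrow> GLf a g (a, j) = (\<Sum>k<r a. const_poly (g $$ (j, k)) * var_poly (a, k))"
  by (simp add: GL_factor_def lin_aut_apply coords_iff)

lemma GLf_apply_other:
  assumes "v \<in> V" "fst v \<noteq> a"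
  shows "GLf a g v = var_poly v"
proof -
  obtain i j where v: "v = (i, j)" by (cases v)
  have "GLf a g v = (\<Sum>k<r i. const_poly (if k = j then 1 else 0) * var_poly (i, k))"
    using assms unfolding v GL_factor_def
    by (auto simp: lin_aut_apply coords_iff intro!: sum.cong)
  then show ?thesis
    using assms v by (simp add: sum_delta_var coords_iff)
qed

lemma conj_GLf_shear:
  assumes g: "g \<in> carrier (GL TYPE('a::comm_ring_1) (r a))" and P: "P \<in> shear_polys b" and b: "b \<in> {1..t}"
  defines "Q \<equiv> \<lambda>j. \<Sum>k<r b. const_poly ((if b = a then g else 1\<^sub>m (r b)) $$ (j, k)) *
    subst_poly (GLf a (inv\<^bsub>GL TYPE('a) (r a)\<^esub> g)) (P k)"
  shows "conj_by (equiv_aut TYPE('a) m r t) (GLf a g) (shear b P) = shear b Q" and "Q \<in> shear_polys b"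
proof -
  let ?A = "\<lambda>i\<in>{1..t}. if i = a then g else 1\<^sub>m (r i)"
  have inv: "(\<lambda>i\<in>{1..t}. inv\<^bsub>GL TYPE('a) (r i)\<^esub> (?A i)) =
      (\<lambda>i\<in>{1..t}. if i = a then inv\<^bsub>GL TYPE('a) (r a)\<^esub> g else 1\<^sub>m (r i))"
    using monoid.inv_one[OF group.is_monoid[OF group_GL]] by (intro restrict_ext) auto
  have Q: "Q = (\<lambda>j. \<Sum>k<r b. const_poly (?A b $$ (j, k)) *
      subst_poly (lin_aut r t (\<lambda>i\<in>{1..t}. inv\<^bsub>GL TYPE('a) (r i)\<^esub> (?A i))) (P k))"
    unfolding Q_def inv GL_factor_def using b by simp
  show "conj_by (equiv_aut TYPE('a) m r t) (GLf a g) (shear b P) = shear b Q" "Q \<in> shear_polys b"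
    unfolding Q GL_factor_def[of r t a g] by (rule conj_lin_aut_shear[OF GL_tuple[OF g] P])+
qed

lemma subst_GLf_below:
  assumes "p \<in> homog_polys m d (B b)" "b \<le> a"
  shows "subst_poly (GLf a g) p = p"
proof -
  have "subst_poly (GLf a g) p = subst_poly var_poly p"
    using assms by (intro subst_cong[OF homog_imp_polys_in[OF assms(1)]] GLf_apply_other)
      (auto simp: coords_below_def)
  then show ?thesis by simp
qed

lemma sum_one_mat:
  "j < n \<Longrightarrow> (\<Sum>k<n. const_poly (1\<^sub>m n $$ (j, k)) * f k) = (f j :: (coord, 'a::comm_ring_1) mpoly)"
proof -
  assume j: "j < n"
  have "(\<Sum>k<n. const_poly (1\<^sub>m n $$ (j, k)) * f k) = (\<Sum>k<n. const_poly (if k = j then 1 else 0) * f k)"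
    using j by (intro sum.cong) auto
  then show ?thesis using sum_delta_var[OF j] by simp
qed

lemma conj_GLf_above:
  assumes "g \<in> carrier (GL TYPE('a::comm_ring_1) (r a))" "b < a" "b \<in> {1..t}" "u \<in> unip_factor TYPE('a) m r t b"
  shows "conj_by (equiv_aut TYPE('a) m r t) (GLf a g) u = u"
proof -
  obtain P where P: "P \<in> shear_polys b" "u = shear b P"
    using assms(4) by (auto simp: unip_factor_eq)
  show ?thesis
    unfolding P(2) conj_GLf_shear(1)[OF assms(1) P(1) assms(3)]
    using assms(2) P(1) by (intro shear_cong) (simp add: sum_one_mat subst_GLf_below[OF shear_polysD] del: index_one_mat)
qed

lemma conj_GLf_below:
  assumes "g \<in> carrier (GL TYPE('a::comm_ring_1) (r a))" "a < b" "b \<in> {1..t}" "P \<in> shear_polys b"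
  shows "conj_by (equiv_aut TYPE('a) m r t) (GLf a g) (shear b P) =
    shear b (\<lambda>j. subst_poly (GLf a (inv\<^bsub>GL TYPE('a) (r a)\<^esub> g)) (P j))"
  unfolding conj_GLf_shear(1)[OF assms(1) assms(4,3)]
  using assms(2) by (intro shear_cong) (simp add: sum_one_mat del: index_one_mat)

lemma conj_rep_iso_equal:
  assumes "a \<in> {1..t}"
  shows "conj_rep_iso (equiv_aut TYPE('a::comm_ring_1) m r t) (unip_factor TYPE('a) m r t a)
     (GL TYPE('a) (r a)) (GLf a) (tensor_rep (std_rep (r a)) (triv_rep (K_monomials m r t a)))
     (unip_coords m r t a)"
  unfolding conj_rep_iso_def
proof (intro conjI ballI)
  let ?K = "K_monomials m r t a"
  let ?\<rho> = "tensor_rep (std_rep (r a)) (triv_rep ?K) :: ('a mat, nat \<times> coord monomial, 'a) mrep"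
  have basis: "rbasis ?\<rho> = {..<r a} \<times> ?K"
    by (simp add: tensor_rep_def std_rep_def triv_rep_def)
  show "unip_coords m r t a \<in> iso (equiv_aut TYPE('a) m r t\<lparr>carrier := unip_factor TYPE('a) m r t a\<rparr>)
      (vector_group (rbasis ?\<rho>))"
    unfolding basis by (rule unip_coords_iso[OF assms])
  fix g :: "'a mat" and u assume g: "g \<in> carrier (GL TYPE('a) (r a))" and "u \<in> unip_factor TYPE('a) m r t a"
  then obtain P where P: "P \<in> shear_polys a" "u = shear a P"
    by (auto simp: unip_factor_eq)
  have "conj_by (equiv_aut TYPE('a) m r t) (GLf a g) u = shear a (\<lambda>j. \<Sum>k<r a. const_poly (g $$ (j, k)) * P k)"
    unfolding P(2) conj_GLf_shear(1)[OF g P(1) assms]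
    using P(1) by (intro shear_cong) (simp add: subst_GLf_below[OF shear_polysD])
  then have l: "unip_coords m r t a (conj_by (equiv_aut TYPE('a) m r t) (GLf a g) u) =
     (\<lambda>(j, \<kappa>)\<in>{..<r a} \<times> ?K. \<Sum>k<r a. g $$ (j, k) * Poly_Mapping.lookup (P k) \<kappa>)"
    using assms by (simp add: unip_coords_shear lookup_sum)
  show "unip_coords m r t a (conj_by (equiv_aut TYPE('a) m r t) (GLf a g) u) =
      rep_act ?\<rho> g (unip_coords m r t a u)"
    unfolding l rep_act_def basis
  proof (rule restrict_ext)
    fix x assume "x \<in> {..<r a} \<times> ?K"
    then obtain j \<kappa> where x: "x = (j, \<kappa>)" "j < r a" "\<kappa> \<in> ?K" by auto
    have "(\<Sum>y\<in>{..<r a} \<times> ?K. rentry ?\<rho> g x y * unip_coords m r t a u y) =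
        (\<Sum>k<r a. \<Sum>\<nu>\<in>?K. if \<nu> = \<kappa> then g $$ (j, k) * Poly_Mapping.lookup (P k) \<kappa> else 0)"
      unfolding sum.cartesian_product P(2) using assms
      by (intro sum.cong) (auto simp: x tensor_rep_def std_rep_def triv_rep_def unip_coords_shear)
    also have "\<dots> = (\<Sum>k<r a. g $$ (j, k) * Poly_Mapping.lookup (P k) \<kappa>)"
      using x finite_K_monomials by (intro sum.cong) auto
    finally show "(case x of (j, \<kappa>) \<Rightarrow> \<Sum>k<r a. g $$ (j, k) * Poly_Mapping.lookup (P k) \<kappa>) =
        (\<Sum>y\<in>{..<r a} \<times> ?K. rentry ?\<rho> g x y * unip_coords m r t a u y)"
      by (simp add: x)
  qed
qed

text \<open>
  In the case \<open>a < b\<close> a basis of a representation is a relabelling \<open>\<Phi>\<close> of pairs of a row and a monomial,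
  and the matrix of \<open>g\<close> records the coefficients of the monomials after substituting \<open>g\<^sup>-\<^sup>1\<close>.
\<close>

lemma conj_rep_iso_relabel:
  fixes \<rho> :: "('a::comm_ring_1 mat, 'i, 'a) mrep"
  assumes ab: "a < b" "b \<in> {1..t}"
    and \<Phi>: "bij_betw \<Phi> (rbasis \<rho>) ({..<r b} \<times> K_monomials m r t b)"
    and entry: "\<And>g x y. g \<in> carrier (GL TYPE('a) (r a)) \<Longrightarrow> x \<in> rbasis \<rho> \<Longrightarrow> y \<in> rbasis \<rho> \<Longrightarrow>
      rentry \<rho> g x y = (if fst (\<Phi> x) = fst (\<Phi> y) then
        Poly_Mapping.lookup (monom_eval (GLf a (inv\<^bsub>GL TYPE('a) (r a)\<^esub> g)) (snd (\<Phi> y))) (snd (\<Phi> x)) else 0)"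
    and \<phi>: "\<And>u. \<phi> u = (\<lambda>x\<in>rbasis \<rho>. unip_coords m r t b u (\<Phi> x))"
  shows "conj_rep_iso (equiv_aut TYPE('a) m r t) (unip_factor TYPE('a) m r t b)
     (GL TYPE('a) (r a)) (GLf a) \<rho> \<phi>"
  unfolding conj_rep_iso_def
proof (intro conjI ballI)
  let ?I = "{..<r b} \<times> K_monomials m r t b" and ?Ub = "unip_factor TYPE('a) m r t b"
  let ?G = "equiv_aut TYPE('a) m r t"
  define R where "R = (\<lambda>z :: nat \<times> coord monomial \<Rightarrow> 'a. \<lambda>x\<in>rbasis \<rho>. z (\<Phi> x))"
  have \<Phi>_in: "\<Phi> x \<in> ?I" if "x \<in> rbasis \<rho>" for x
    using \<Phi> that by (rule bij_betwE[rule_format])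
  have "R \<in> iso (vector_group ?I) (vector_group (rbasis \<rho>))"
  proof (rule isoI)
    show "R \<in> hom (vector_group ?I) (vector_group (rbasis \<rho>))"
      using \<Phi>_in by (auto simp: hom_def vector_group_def R_def fun_eq_iff)
    show "bij_betw R (carrier (vector_group ?I)) (carrier (vector_group (rbasis \<rho>)))"
    proof (rule bij_betw_byWitness[where f' = "\<lambda>z. \<lambda>y\<in>?I. z (inv_into (rbasis \<rho>) \<Phi> y)"])
      show "\<forall>z\<in>carrier (vector_group ?I). (\<lambda>y\<in>?I. R z (inv_into (rbasis \<rho>) \<Phi> y)) = z"
      proof
        fix z :: "nat \<times> coord monomial \<Rightarrow> 'a" assume z: "z \<in> carrier (vector_group ?I)"
        have "(\<lambda>y\<in>?I. R z (inv_into (rbasis \<rho>) \<Phi> y)) = (\<lambda>y\<in>?I. z y)"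
        proof (rule restrict_ext)
          fix y assume "y \<in> ?I"
          then have "y \<in> \<Phi> ` rbasis \<rho>"
            using \<Phi> by (simp add: bij_betw_def)
          then show "R z (inv_into (rbasis \<rho>) \<Phi> y) = z y"
            by (simp add: R_def inv_into_into f_inv_into_f)
        qed
        then show "(\<lambda>y\<in>?I. R z (inv_into (rbasis \<rho>) \<Phi> y)) = z"
          using z by (simp add: vector_group_def PiE_def extensional_restrict)
      qed
      show "\<forall>z\<in>carrier (vector_group (rbasis \<rho>)). R (\<lambda>y\<in>?I. z (inv_into (rbasis \<rho>) \<Phi> y)) = z"
      proof
        fix z :: "'i \<Rightarrow> 'a" assume z: "z \<in> carrier (vector_group (rbasis \<rho>))"
        have "R (\<lambda>y\<in>?I. z (inv_into (rbasis \<rho>) \<Phi> y)) = (\<lambda>x\<in>rbasis \<rho>. z x)"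
          unfolding R_def
        proof (rule restrict_ext)
          fix x assume x: "x \<in> rbasis \<rho>"
          then have "inv_into (rbasis \<rho>) \<Phi> (\<Phi> x) = x"
            using \<Phi> by (simp add: bij_betw_def inv_into_f_f)
          then show "(\<lambda>y\<in>?I. z (inv_into (rbasis \<rho>) \<Phi> y)) (\<Phi> x) = z x"
            using \<Phi>_in[OF x] by simp
        qed
        then show "R (\<lambda>y\<in>?I. z (inv_into (rbasis \<rho>) \<Phi> y)) = z"
          using z by (simp add: vector_group_def PiE_def extensional_restrict)
      qed
    qed (simp_all add: vector_group_def R_def image_subset_iff)
  qed
  with unip_coords_iso[OF ab(2)]
  have "R \<circ> unip_coords m r t b \<in> iso (?G\<lparr>carrier := ?Ub\<rparr>) (vector_group (rbasis \<rho>))"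
    by (rule iso_set_trans)
  moreover have "\<phi> = R \<circ> unip_coords m r t b"
    by (simp add: fun_eq_iff \<phi> R_def)
  ultimately show "\<phi> \<in> iso (?G\<lparr>carrier := ?Ub\<rparr>) (vector_group (rbasis \<rho>))"
    by simp
  fix g :: "'a mat" and u assume g: "g \<in> carrier (GL TYPE('a) (r a))" and u: "u \<in> ?Ub"
  obtain P where P: "P \<in> shear_polys b" "u = shear b P"
    using u by (auto simp: unip_factor_eq)
  let ?L = "GLf a (inv\<^bsub>GL TYPE('a) (r a)\<^esub> g)"
  have conj: "conj_by ?G (GLf a g) u = shear b (\<lambda>j. subst_poly ?L (P j))"
    unfolding P(2) by (rule conj_GLf_below[OF g ab P(1)])
  show "\<phi> (conj_by ?G (GLf a g) u) = rep_act \<rho> g (\<phi> u)"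
    unfolding rep_act_def \<phi>[of "conj_by ?G (GLf a g) u"]
  proof (rule restrict_ext)
    fix x assume x: "x \<in> rbasis \<rho>"
    obtain j \<kappa> where jk: "\<Phi> x = (j, \<kappa>)" by (cases "\<Phi> x")
    have jI: "j < r b" "\<kappa> \<in> K_monomials m r t b"
      using \<Phi>_in[OF x] jk by auto
    have "unip_coords m r t b (conj_by ?G (GLf a g) u) (\<Phi> x) = Poly_Mapping.lookup (subst_poly ?L (P j)) \<kappa>"
      unfolding conj using ab(2) jI by (simp add: unip_coords_shear jk)
    also have "subst_poly ?L (P j) = (\<Sum>\<nu>\<in>K_monomials m r t b.
        const_poly (Poly_Mapping.lookup (P j) \<nu>) * monom_eval ?L \<nu>)"
      using shear_polysD[OF P(1) jI(1)]
      by (intro subst_poly_superset finite_K_monomials) (auto simp: homog_polys_def K_monomials_def)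
    also have "Poly_Mapping.lookup \<dots> \<kappa> = (\<Sum>\<nu>\<in>K_monomials m r t b.
        Poly_Mapping.lookup (P j) \<nu> * Poly_Mapping.lookup (monom_eval ?L \<nu>) \<kappa>)"
      by (simp add: lookup_sum)
    also have "\<dots> = (\<Sum>i<r b. if i = j then \<Sum>\<nu>\<in>K_monomials m r t b.
        Poly_Mapping.lookup (P i) \<nu> * Poly_Mapping.lookup (monom_eval ?L \<nu>) \<kappa> else 0)"
      using jI(1) by simp
    also have "\<dots> = (\<Sum>i<r b. \<Sum>\<nu>\<in>K_monomials m r t b. if i = j then
        Poly_Mapping.lookup (P i) \<nu> * Poly_Mapping.lookup (monom_eval ?L \<nu>) \<kappa> else 0)"
      by (intro sum.cong) auto
    also have "\<dots> = (\<Sum>y\<in>?I. if fst y = j then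
        Poly_Mapping.lookup (monom_eval ?L (snd y)) \<kappa> * unip_coords m r t b u y else 0)"
      unfolding sum.cartesian_product P(2) using ab(2)
      by (intro sum.cong) (auto simp: unip_coords_shear mult.commute)
    also have "\<dots> = (\<Sum>y\<in>rbasis \<rho>. if fst (\<Phi> y) = j then
        Poly_Mapping.lookup (monom_eval ?L (snd (\<Phi> y))) \<kappa> * unip_coords m r t b u (\<Phi> y) else 0)"
      by (rule sum.reindex_bij_betw[OF \<Phi>, symmetric])
    also have "\<dots> = (\<Sum>y\<in>rbasis \<rho>. rentry \<rho> g x y * \<phi> u y)"
      using g x by (intro sum.cong) (auto simp: entry \<phi> jk)
    finally show "unip_coords m r t b (conj_by ?G (GLf a g) u) (\<Phi> x) = (\<Sum>y\<in>rbasis \<rho>. rentry \<rho> g x y * \<phi> u y)" .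
  qed
qed

lemma natural_relabel:
  fixes h :: "'a::comm_ring_1 \<Rightarrow> 'b::comm_ring_1"
  assumes h: "comm_ring_hom h" "b \<in> {1..t}" and \<Phi>: "\<And>x. x \<in> I \<Longrightarrow> \<Phi> x \<in> {..<r b} \<times> K_monomials m r t b"
    and "\<And>u x. x \<in> I \<Longrightarrow> \<phi> u x = unip_coords m r t b u (\<Phi> x)"
    and "\<And>u x. x \<in> I \<Longrightarrow> \<psi> u x = unip_coords m r t b u (\<Phi> x)"
  shows "natural_along r t h (unip_factor TYPE('a) m r t b) I \<phi> \<psi>"
  unfolding natural_along_def
proof (intro ballI)
  fix F :: "'a polymap" and i assume F: "F \<in> unip_factor TYPE('a) m r t b" and i: "i \<in> I"
  then show "\<psi> (base_change r t h F) i = h (\<phi> F i)"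
    using natural_unip_coords[OF h, unfolded natural_along_def, rule_format, OF F \<Phi>[OF i]] assms(4,5)
    by simp
qed

end

section \<open>Splitting off the variables of one block\<close>

lemma block_monomial_empty [simp]: "block_monomial a {#} = 0"
  by (simp add: block_monomial_def)

lemma block_monomial_add_mset [simp]:
  "block_monomial a (add_mset x M) = Poly_Mapping.single (a, x) 1 + block_monomial a M"
  by (simp add: block_monomial_def)

lemma lookup_block_monomial:
  "Poly_Mapping.lookup (block_monomial a M) v = (if fst v = a then count M (snd v) else 0)"
  by (cases v, induction M) (auto simp: lookup_add lookup_single when_def)

lemma keys_block_monomial: "Poly_Mapping.keys (block_monomial a M) = {a} \<times> set_mset M"
  by (auto simp: in_keys_iff lookup_block_monomial split: if_splits)

lemma wdegree_block_monomial: "wdegree m (block_monomial a M) = m a * size M"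
  by (induction M) (auto simp: algebra_simps)

lemma block_split_inject:
  assumes "\<And>v. v \<in> Poly_Mapping.keys \<delta> \<Longrightarrow> fst v \<noteq> a" "\<And>v. v \<in> Poly_Mapping.keys \<epsilon> \<Longrightarrow> fst v \<noteq> a"
  shows "\<delta> + block_monomial a M = \<epsilon> + block_monomial a N \<longleftrightarrow> \<delta> = \<epsilon> \<and> M = N"
proof
  assume eq: "\<delta> + block_monomial a M = \<epsilon> + block_monomial a N"
  have lookup: "Poly_Mapping.lookup \<delta> v + (if fst v = a then count M (snd v) else 0) =
      Poly_Mapping.lookup \<epsilon> v + (if fst v = a then count N (snd v) else 0)" for v
    using arg_cong[OF eq, of "\<lambda>\<mu>. Poly_Mapping.lookup \<mu> v"] by (simp add: lookup_add lookup_block_monomial)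
  have zero: "Poly_Mapping.lookup \<delta> v = 0" "Poly_Mapping.lookup \<epsilon> v = 0" if "fst v = a" for v
    using assms(1)[of v] assms(2)[of v] that by (auto simp: in_keys_iff)
  have "M = N"
    using lookup[of "(a, _)"] zero[of "(a, _)"] by (intro multiset_eqI) simp
  moreover have "\<delta> = \<epsilon>"
  proof (rule poly_mapping_eqI)
    fix v show "Poly_Mapping.lookup \<delta> v = Poly_Mapping.lookup \<epsilon> v"
      using lookup[of v] zero[of v] by (cases "fst v = a") auto
  qed
  ultimately show "\<delta> = \<epsilon> \<and> M = N" by simp
qed simp

lemma monom_eval_block_monomial:
  fixes L :: "coord \<Rightarrow> (coord, 'a::comm_ring_1) mpoly"
  assumes "\<And>y. y \<in> set ys \<Longrightarrow> L (a, y) = (\<Sum>x<n. const_poly (C y x) * var_poly (a, x))"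
  shows "monom_eval L (block_monomial a (mset ys)) =
    (\<Sum>xs\<in>{xs. set xs \<subseteq> {..<n} \<and> length xs = length ys}.
       Poly_Mapping.single (block_monomial a (mset xs)) (\<Prod>k<length ys. C (ys ! k) (xs ! k)))"
  using assms
proof (induction ys)
  case Nil
  have "{xs :: nat list. set xs \<subseteq> {..<n} \<and> length xs = length []} = {[]}" by auto
  then show ?case by simp
next
  case (Cons y ys)
  let ?X = "{xs. set xs \<subseteq> {..<n} \<and> length xs = length ys}"
  let ?s = "\<lambda>ys xs. Poly_Mapping.single (block_monomial a (mset xs)) (\<Prod>k<length ys. C (ys ! k) (xs ! k))"
  have inj: "inj_on (\<lambda>(xs, x). x # xs) (?X \<times> {..<n})"
    by (auto simp: inj_on_def)
  have "monom_eval L (block_monomial a (mset (y # ys))) =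
      (\<Sum>x<n. const_poly (C y x) * var_poly (a, x)) * (\<Sum>xs\<in>?X. ?s ys xs)"
    using Cons by (simp add: monom_eval_add)
  also have "\<dots> = (\<Sum>xs\<in>?X. \<Sum>x<n. const_poly (C y x) * var_poly (a, x) * ?s ys xs)"
    by (subst sum.swap) (simp add: sum_product)
  also have "\<dots> = (\<Sum>xs\<in>?X. \<Sum>x<n. ?s (y # ys) (x # xs))"
    by (intro sum.cong refl)
      (simp add: var_poly_def const_poly_def mult_single prod.lessThan_Suc_shift del: prod.lessThan_Suc)
  also have "\<dots> = (\<Sum>z\<in>?X \<times> {..<n}. ?s (y # ys) ((\<lambda>(xs, x). x # xs) z))"
    unfolding sum.cartesian_product by (intro sum.cong) auto
  also have "\<dots> = (\<Sum>xs\<in>(\<lambda>(xs, x). x # xs) ` (?X \<times> {..<n}). ?s (y # ys) xs)"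
    by (subst sum.reindex[OF inj]) (simp add: o_def)
  finally show ?case
    by (simp add: lists_length_Suc_eq)
qed

context weighted_blocks
begin

lemma lookup_monom_eval_split:
  fixes C :: "'a::comm_ring_1 mat"
  assumes a: "a \<in> {1..t}"
    and \<delta>: "\<And>v. v \<in> Poly_Mapping.keys \<delta> \<Longrightarrow> v \<in> V \<and> fst v \<noteq> a"
    and \<epsilon>: "\<And>v. v \<in> Poly_Mapping.keys \<epsilon> \<Longrightarrow> v \<in> V \<and> fst v \<noteq> a"
    and ys: "set ys \<subseteq> {..<r a}" and M: "set_mset M \<subseteq> {..<r a}"
  shows "Poly_Mapping.lookup (monom_eval (GLf a C) (\<epsilon> + block_monomial a (mset ys))) (\<delta> + block_monomial a M) =
    (if \<delta> = \<epsilon> \<and> size M = length ys then \<Sum>xs\<in>{xs. mset xs = M}. \<Prod>k<length ys. C $$ (ys ! k, xs ! k) else 0)"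
proof -
  let ?X = "{xs. set xs \<subseteq> {..<r a} \<and> length xs = length ys}"
  let ?c = "\<lambda>xs. \<Prod>k<length ys. C $$ (ys ! k, xs ! k)"
  have "monom_eval (GLf a C) \<epsilon> = (monom_eval var_poly \<epsilon> :: (coord, 'a) mpoly)"
    using \<epsilon> by (intro monom_eval_cong GLf_apply_other) auto
  moreover have "monom_eval (GLf a C) (block_monomial a (mset ys)) =
      (\<Sum>xs\<in>?X. Poly_Mapping.single (block_monomial a (mset xs)) (?c xs))"
    using ys a by (intro monom_eval_block_monomial GLf_apply) (auto simp: coords_iff)
  ultimately have "monom_eval (GLf a C) (\<epsilon> + block_monomial a (mset ys)) =
      (\<Sum>xs\<in>?X. Poly_Mapping.single (\<epsilon> + block_monomial a (mset xs)) (?c xs))"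
    by (simp add: monom_eval_add sum_distrib_left mult_single)
  then have *: "Poly_Mapping.lookup (monom_eval (GLf a C) (\<epsilon> + block_monomial a (mset ys))) (\<delta> + block_monomial a M) =
      (\<Sum>xs\<in>?X. if \<delta> = \<epsilon> \<and> mset xs = M then ?c xs else 0)"
    using \<delta> \<epsilon> block_split_inject[of \<epsilon> a \<delta>]
    by (auto simp: lookup_sum lookup_single when_def intro!: sum.cong)
  show ?thesis
  proof (cases "\<delta> = \<epsilon> \<and> size M = length ys")
    case True
    have "{xs \<in> ?X. mset xs = M} = {xs. mset xs = M}"
      using True M by auto
    moreover have "(\<Sum>xs\<in>?X. if \<delta> = \<epsilon> \<and> mset xs = M then ?c xs else 0) = (\<Sum>xs\<in>{xs \<in> ?X. mset xs = M}. ?c xs)"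
      using True by (subst sum.inter_filter) (auto simp: finite_lists_length_eq)
    ultimately show ?thesis
      using * True by simp
  next
    case False
    then have "(\<Sum>xs\<in>?X. if \<delta> = \<epsilon> \<and> mset xs = M then ?c xs else 0) = 0"
      by (intro sum.neutral) auto
    with False * show ?thesis by auto
  qed
qed

lemma D_monomials_keys:
  "\<delta> \<in> D_monomials m r t a b l \<Longrightarrow> v \<in> Poly_Mapping.keys \<delta> \<Longrightarrow> v \<in> V \<and> fst v \<noteq> a"
  by (auto simp: D_monomials_def monomials_of_def coords_below_def)

lemma finite_D_monomials: "finite (D_monomials m r t a b l)"
  unfolding D_monomials_def using coords_below_subset by (intro finite_monomials_of) blast

lemma rbasis_sym_sum:
  "rbasis (sym_sum_rep m r t a b :: ('a::comm_ring_1 mat, _, 'a) mrep) =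
    (SIGMA l:{0..m b div m a}. ({..<r b} \<times> D_monomials m r t a b l) \<times> {M. set_mset M \<subseteq> {..<r a} \<and> size M = l})"
  by (simp add: sym_sum_rep_def dsum_rep_def tensor_rep_def triv_rep_def sym_power_rep_def inv_transpose_rep_def)

lemma rbasis_tensor_sum:
  "rbasis (tensor_sum_rep m r t a b :: ('a::comm_ring_1 mat, _, 'a) mrep) =
    (SIGMA l:{0..m b div m a}. ({..<r b} \<times> D_monomials m r t a b l) \<times> {xs. set xs \<subseteq> {..<r a} \<and> length xs = l})"
  by (simp add: tensor_sum_rep_def dsum_rep_def tensor_rep_def triv_rep_def tensor_power_rep_def inv_transpose_rep_def)

definition split_index :: "nat \<Rightarrow> nat \<times> ((nat \<times> coord monomial) \<times> nat multiset) \<Rightarrow> nat \<times> coord monomial" where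
  "split_index a = (\<lambda>(l, ((j, \<delta>), M)). (j, \<delta> + block_monomial a M))"

lemma bij_betw_split_index:
  assumes ab: "a \<in> {1..t}" "b \<in> {1..t}" "a < b"
  shows "bij_betw (split_index a) (rbasis (sym_sum_rep m r t a b :: ('a::comm_ring_1 mat, _, 'a) mrep))
    ({..<r b} \<times> K_monomials m r t b)"
  unfolding bij_betw_def rbasis_sym_sum
proof (intro conjI equalityI subsetI)
  let ?I = "SIGMA l:{0..m b div m a}. ({..<r b} \<times> D_monomials m r t a b l) \<times> {M. set_mset M \<subseteq> {..<r a} \<and> size M = l}"
  show "inj_on (split_index a) ?I"
    by (rule inj_onI) (auto simp: split_index_def block_split_inject D_monomials_keys)
  fix x assume "x \<in> split_index a ` ?I"
  then obtain l j \<delta> M where x: "x = (j, \<delta> + block_monomial a M)" "l \<le> m b div m a" "j < r b"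
    "\<delta> \<in> D_monomials m r t a b l" "set_mset M \<subseteq> {..<r a}" "size M = l"
    by (auto simp: split_index_def)
  have "l * m a \<le> m b"
    using x(2) by (metis div_times_less_eq_dividend mult_le_mono1 order_trans)
  then have "wdegree m (\<delta> + block_monomial a M) = m b"
    using x by (simp add: wdegree_block_monomial D_monomials_def monomials_of_def mult.commute)
  moreover have "Poly_Mapping.keys (\<delta> + block_monomial a M) \<subseteq> B b"
    using x ab by (auto simp: keys_add_nat keys_block_monomial D_monomials_def monomials_of_def
        coords_below_def coords_def)
  ultimately show "x \<in> {..<r b} \<times> K_monomials m r t b"
    using x by (simp add: K_monomials_def monomials_of_def)
next
  let ?I = "SIGMA l:{0..m b div m a}. ({..<r b} \<times> D_monomials m r t a b l) \<times> {M. set_mset M \<subseteq> {..<r a} \<and> size M = l}"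
  fix x assume "x \<in> {..<r b} \<times> K_monomials m r t b"
  then obtain j \<kappa> where x: "x = (j, \<kappa>)" "j < r b" "Poly_Mapping.keys \<kappa> \<subseteq> B b" "wdegree m \<kappa> = m b"
    by (auto simp: K_monomials_def monomials_of_def)
  define M where "M = (\<Sum>k<r a. replicate_mset (Poly_Mapping.lookup \<kappa> (a, k)) k)"
  have count_M: "count M k = (if k < r a then Poly_Mapping.lookup \<kappa> (a, k) else 0)" for k
    by (simp add: M_def count_sum)
  have M: "set_mset M \<subseteq> {..<r a}"
    by (auto simp: M_def set_mset_sum split: if_splits)
  have outside: "Poly_Mapping.lookup \<kappa> (a, k) = 0" if "\<not> k < r a" for k
  proof -
    have "(a, k) \<notin> Poly_Mapping.keys \<kappa>"
      using that x(3) by (auto simp: coords_below_def coords_iff)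
    then show ?thesis by (simp add: in_keys_iff)
  qed
  define \<delta> where "\<delta> = \<kappa> - block_monomial a M"
  have lookup_\<delta>: "Poly_Mapping.lookup \<delta> v = (if fst v = a then 0 else Poly_Mapping.lookup \<kappa> v)" for v
    using outside[of "snd v"] by (cases v) (auto simp: \<delta>_def lookup_minus lookup_block_monomial count_M)
  have \<kappa>: "\<kappa> = \<delta> + block_monomial a M"
  proof (rule poly_mapping_eqI)
    fix v show "Poly_Mapping.lookup \<kappa> v = Poly_Mapping.lookup (\<delta> + block_monomial a M) v"
      using outside[of "snd v"] by (cases v) (auto simp: lookup_add lookup_\<delta> lookup_block_monomial count_M)
  qed
  have deg: "wdegree m \<delta> + m a * size M = m b"
    using x(4) unfolding \<kappa> by (simp add: wdegree_block_monomial)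
  have "size M \<le> m b div m a"
    using deg m_pos[OF ab(1)] by (simp add: less_eq_div_iff_mult_less_eq mult.commute)
  moreover have "Poly_Mapping.keys \<delta> \<subseteq> {v \<in> B b. fst v \<noteq> a}"
  proof
    fix v assume "v \<in> Poly_Mapping.keys \<delta>"
    then have "fst v \<noteq> a" "v \<in> Poly_Mapping.keys \<kappa>"
      by (auto simp: in_keys_iff lookup_\<delta> split: if_splits)
    with x(3) show "v \<in> {v \<in> B b. fst v \<noteq> a}" by auto
  qed
  moreover have "wdegree m \<delta> = m b - size M * m a"
    using deg by (simp add: mult.commute)
  ultimately have "(size M, ((j, \<delta>), M)) \<in> ?I"
    using x(2) M by (simp add: D_monomials_def monomials_of_def)
  moreover have "x = split_index a (size M, ((j, \<delta>), M))"
    using \<kappa> by (simp add: split_index_def x(1))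
  ultimately show "x \<in> split_index a ` ?I"
    by (rule rev_image_eqI)
qed

lemma sym_sum_coords_split_index:
  fixes u :: "'a::comm_ring_1 polymap"
  shows "sym_sum_coords m r t a b u =
    (\<lambda>x\<in>rbasis (sym_sum_rep m r t a b :: ('a mat, _, 'a) mrep). unip_coords m r t b u (split_index a x))"
  unfolding sym_sum_coords_def by (intro restrict_ext) (auto simp: split_index_def)

lemma inv_GL_carrier_mat:
  "g \<in> carrier (GL TYPE('a::comm_ring_1) n) \<Longrightarrow> inv\<^bsub>GL TYPE('a) n\<^esub> g \<in> carrier_mat n n"
  using group.inv_closed[OF group_GL, of g n] by (auto simp: carrier_GL)

lemma rentry_sym_power:
  fixes g :: "'a::comm_ring_1 mat"
  assumes g: "g \<in> carrier (GL TYPE('a) n)" and M: "set_mset M \<subseteq> {..<n}" "size M = l"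
    and N: "set_mset N \<subseteq> {..<n}" "size N = l"
  shows "rentry (sym_power_rep l (inv_transpose_rep n)) g M N =
    (\<Sum>xs\<in>{xs. mset xs = M}. \<Prod>k<l. (inv\<^bsub>GL TYPE('a) n\<^esub> g) $$ ((SOME ys. mset ys = N) ! k, xs ! k))"
proof -
  define ys where "ys = (SOME ys. mset ys = N)"
  have "mset ys = N"
    unfolding ys_def by (rule someI_ex) (rule ex_mset)
  then have ys: "set ys \<subseteq> {..<n}" "length ys = l"
    using N by (auto simp flip: set_mset_mset size_mset)
  have "(\<Prod>k<l. transpose_mat (inv\<^bsub>GL TYPE('a) n\<^esub> g) $$ (xs ! k, ys ! k)) =
      (\<Prod>k<l. (inv\<^bsub>GL TYPE('a) n\<^esub> g) $$ (ys ! k, xs ! k))" if "mset xs = M" for xs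
  proof (intro prod.cong refl)
    fix k assume k: "k \<in> {..<l}"
    have xs: "set xs \<subseteq> {..<n}" "length xs = l"
      using M that by (auto simp flip: set_mset_mset size_mset)
    have "xs ! k < n" "ys ! k < n"
      using xs ys k by (auto simp: subset_iff)
    then show "transpose_mat (inv\<^bsub>GL TYPE('a) n\<^esub> g) $$ (xs ! k, ys ! k) = (inv\<^bsub>GL TYPE('a) n\<^esub> g) $$ (ys ! k, xs ! k)"
      using inv_GL_carrier_mat[OF g] by simp
  qed
  then show ?thesis
    by (simp add: sym_power_rep_def tensor_power_rep_def inv_transpose_rep_def flip: ys_def)
qed

lemma conj_rep_iso_sym_sum:
  assumes ab: "a \<in> {1..t}" "b \<in> {1..t}" "a < b"
  shows "conj_rep_iso (equiv_aut TYPE('a::comm_ring_1) m r t) (unip_factor TYPE('a) m r t b)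
     (GL TYPE('a) (r a)) (GLf a) (sym_sum_rep m r t a b) (sym_sum_coords m r t a b)"
proof (rule conj_rep_iso_relabel[OF ab(3,2) bij_betw_split_index[OF ab] _ sym_sum_coords_split_index])
  let ?\<rho> = "sym_sum_rep m r t a b :: ('a mat, _, 'a) mrep"
  fix g :: "'a mat" and x y
  assume g: "g \<in> carrier (GL TYPE('a) (r a))" and "x \<in> rbasis ?\<rho>" "y \<in> rbasis ?\<rho>"
  then obtain l j \<delta> M l' j' \<epsilon> N where
    x: "x = (l, ((j, \<delta>), M))" "\<delta> \<in> D_monomials m r t a b l" "set_mset M \<subseteq> {..<r a}" "size M = l" and
    y: "y = (l', ((j', \<epsilon>), N))" "\<epsilon> \<in> D_monomials m r t a b l'" "set_mset N \<subseteq> {..<r a}" "size N = l'"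
    by (auto simp: rbasis_sym_sum)
  let ?C = "inv\<^bsub>GL TYPE('a) (r a)\<^esub> g"
  define ys where "ys = (SOME ys. mset ys = N)"
  have ys: "mset ys = N"
    unfolding ys_def by (rule someI_ex) (rule ex_mset)
  then have ys': "set ys \<subseteq> {..<r a}" "length ys = l'"
    using y(3,4) by (auto simp flip: set_mset_mset size_mset)
  have "Poly_Mapping.lookup (monom_eval (GLf a (inv\<^bsub>GL TYPE('a) (r a)\<^esub> g)) (snd (split_index a y))) (snd (split_index a x)) =
     (if \<delta> = \<epsilon> \<and> l = l' then \<Sum>xs\<in>{xs. mset xs = M}. \<Prod>k<l'. (inv\<^bsub>GL TYPE('a) (r a)\<^esub> g) $$ (ys ! k, xs ! k) else 0)"
    using lookup_monom_eval_split[of a \<delta> \<epsilon> ys M ?C] ab(1) ys'(1) x(3) D_monomials_keys[OF x(2)] D_monomials_keys[OF y(2)]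
    by (simp add: split_index_def x(1,4) y(1) ys ys'(2))
  then show "rentry ?\<rho> g x y = (if fst (split_index a x) = fst (split_index a y) then
      Poly_Mapping.lookup (monom_eval (GLf a (inv\<^bsub>GL TYPE('a) (r a)\<^esub> g)) (snd (split_index a y))) (snd (split_index a x)) else 0)"
    using rentry_sym_power[OF g x(3) _ y(3), of l] x(4) y(4)
    by (auto simp: x(1) y(1) split_index_def sym_sum_rep_def dsum_rep_def tensor_rep_def triv_rep_def
        simp flip: ys_def)
qed

lemma unique_list_of_mset:
  fixes n :: nat
  assumes "mset xs = mset zs" "set zs \<subseteq> {..<n}" "n = 1 \<or> length zs \<le> 1"
  shows "xs = zs"
proof (cases "n = 1")
  case True
  have len: "length xs = length zs" and "set xs = set zs"
    using assms(1) by (auto dest: mset_eq_length mset_eq_setD)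
  then have "\<forall>x\<in>set xs. x = 0" "\<forall>x\<in>set zs. x = 0"
    using True assms(2) by auto
  then have "xs = replicate (length xs) 0" "zs = replicate (length zs) 0"
    by (metis replicate_length_same)+
  then show ?thesis
    using len by metis
next
  case False
  then show ?thesis
    using assms by (cases zs) auto
qed

lemma tensor_sum_coords_split_index:
  fixes u :: "'a::comm_ring_1 polymap"
  shows "tensor_sum_coords m r t a b u =
    (\<lambda>x\<in>rbasis (tensor_sum_rep m r t a b :: ('a mat, _, 'a) mrep).
      unip_coords m r t b u (split_index a (map_prod id (map_prod id mset) x)))"
  unfolding tensor_sum_coords_def by (intro restrict_ext) (auto simp: split_index_def)

lemma few_degree:
  assumes "r a = 1 \<or> (\<forall>l\<in>{2..m b div m a}. D_monomials m r t a b l = {})"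
    and "\<delta> \<in> D_monomials m r t a b l" "l \<le> m b div m a"
  shows "r a = 1 \<or> l \<le> 1"
proof (rule ccontr)
  assume "\<not> ?thesis"
  then have "r a \<noteq> 1" "l \<in> {2..m b div m a}"
    using assms(3) by auto
  with assms(1,2) show False by auto
qed

lemma bij_betw_tensor_index:
  assumes ab: "a \<in> {1..t}" "b \<in> {1..t}" "a < b"
    and few: "r a = 1 \<or> (\<forall>l\<in>{2..m b div m a}. D_monomials m r t a b l = {})"
  shows "bij_betw (\<lambda>x. split_index a (map_prod id (map_prod id mset) x))
    (rbasis (tensor_sum_rep m r t a b :: ('a::comm_ring_1 mat, _, 'a) mrep)) ({..<r b} \<times> K_monomials m r t b)"
proof -
  let ?f = "map_prod id (map_prod id mset) :: nat \<times> (nat \<times> coord monomial) \<times> nat list \<Rightarrow> _"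
  let ?S = "rbasis (sym_sum_rep m r t a b :: ('a mat, _, 'a) mrep)"
  let ?T = "rbasis (tensor_sum_rep m r t a b :: ('a mat, _, 'a) mrep)"
  have "bij_betw ?f ?T ?S"
    unfolding bij_betw_def
  proof (intro conjI equalityI subsetI)
    show "inj_on ?f ?T"
    proof (rule inj_onI)
      fix x y assume xy: "x \<in> ?T" "y \<in> ?T" "?f x = ?f y"
      obtain l j \<delta> xs where x: "x = (l, ((j, \<delta>), xs))" by (metis surj_pair)
      obtain l' p zs where y': "y = (l', (p, zs))" by (metis surj_pair)
      have y: "y = (l, ((j, \<delta>), zs))"
        using xy(3) by (simp add: x y')
      have *: "mset xs = mset zs" "l \<le> m b div m a" "\<delta> \<in> D_monomials m r t a b l" "set zs \<subseteq> {..<r a}" "length zs = l"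
        using xy unfolding x y rbasis_tensor_sum by simp_all
      have "r a = 1 \<or> length zs \<le> 1"
        by (rule few_degree[OF few *(3,2), folded *(5)])
      then show "x = y"
        using unique_list_of_mset[OF *(1,4)] x y by simp
    qed
    show "z \<in> ?S" if "z \<in> ?f ` ?T" for z
      using that by (auto simp: rbasis_tensor_sum rbasis_sym_sum)
    show "z \<in> ?f ` ?T" if "z \<in> ?S" for z
    proof -
      obtain l p M where z: "z = (l, (p, M))" by (cases z) auto
      obtain xs where xs: "mset xs = M" using ex_mset by blast
      have "(l, (p, xs)) \<in> ?T"
        using that unfolding z by (auto simp: rbasis_tensor_sum rbasis_sym_sum xs[symmetric])
      then show ?thesis
        by (force simp: z xs intro!: image_eqI[of _ _ "(l, (p, xs))"])
    qed
  qed
  from bij_betw_trans[OF this bij_betw_split_index[OF ab]] show ?thesis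
    by (simp add: o_def)
qed

lemma conj_rep_iso_tensor_sum:
  assumes ab: "a \<in> {1..t}" "b \<in> {1..t}" "a < b"
    and few: "r a = 1 \<or> (\<forall>l\<in>{2..m b div m a}. D_monomials m r t a b l = {})"
  shows "conj_rep_iso (equiv_aut TYPE('a::comm_ring_1) m r t) (unip_factor TYPE('a) m r t b)
     (GL TYPE('a) (r a)) (GLf a) (tensor_sum_rep m r t a b) (tensor_sum_coords m r t a b)"
proof (rule conj_rep_iso_relabel[OF ab(3,2) bij_betw_tensor_index[OF ab few] _ tensor_sum_coords_split_index])
  let ?\<rho> = "tensor_sum_rep m r t a b :: ('a mat, _, 'a) mrep"
  let ?\<Phi> = "\<lambda>x. split_index a (map_prod id (map_prod id mset) x)"
  fix g :: "'a mat" and x y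
  assume g: "g \<in> carrier (GL TYPE('a) (r a))" and "x \<in> rbasis ?\<rho>" "y \<in> rbasis ?\<rho>"
  then obtain l j \<delta> xs l' j' \<epsilon> ys where
    x: "x = (l, ((j, \<delta>), xs))" "\<delta> \<in> D_monomials m r t a b l" "set xs \<subseteq> {..<r a}" "length xs = l" "l \<le> m b div m a" and
    y: "y = (l', ((j', \<epsilon>), ys))" "\<epsilon> \<in> D_monomials m r t a b l'" "set ys \<subseteq> {..<r a}" "length ys = l'"
    by (auto simp: rbasis_tensor_sum)
  let ?C = "inv\<^bsub>GL TYPE('a) (r a)\<^esub> g"
  have "r a = 1 \<or> length xs \<le> 1"
    by (rule few_degree[OF few x(2,5), folded x(4)])
  then have single: "{zs. mset zs = mset xs} = {xs}"
    using unique_list_of_mset[OF _ x(3)] by auto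
  have "Poly_Mapping.lookup (monom_eval (GLf a ?C) (snd (?\<Phi> y))) (snd (?\<Phi> x)) =
     (if \<delta> = \<epsilon> \<and> l = l' then \<Prod>k<l'. ?C $$ (ys ! k, xs ! k) else 0)"
    using lookup_monom_eval_split[of a \<delta> \<epsilon> ys "mset xs" ?C] ab(1) y(3) x(3) D_monomials_keys[OF x(2)] D_monomials_keys[OF y(2)]
    by (simp add: split_index_def x(1,4) y(1,4) single)
  moreover have "(\<Prod>k<l. transpose_mat ?C $$ (xs ! k, ys ! k)) = (\<Prod>k<l. ?C $$ (ys ! k, xs ! k))" if "l = l'"
  proof (intro prod.cong refl)
    fix k assume "k \<in> {..<l}"
    then have "xs ! k < r a" "ys ! k < r a"
      using x(3,4) y(3,4) that by (auto simp: subset_iff)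
    then show "transpose_mat ?C $$ (xs ! k, ys ! k) = ?C $$ (ys ! k, xs ! k)"
      using inv_GL_carrier_mat[OF g] by simp
  qed
  ultimately show "rentry ?\<rho> g x y = (if fst (?\<Phi> x) = fst (?\<Phi> y) then
      Poly_Mapping.lookup (monom_eval (GLf a ?C) (snd (?\<Phi> y))) (snd (?\<Phi> x)) else 0)"
    by (auto simp: x(1) y(1) split_index_def tensor_sum_rep_def dsum_rep_def tensor_rep_def triv_rep_def
        tensor_power_rep_def inv_transpose_rep_def)
qed

lemma card_D_monomials:
  assumes "b \<in> {1..t}"
  shows "card (D_monomials m r t a b l) =
     card {z \<in> {v \<in> B b. fst v \<noteq> a} \<rightarrow>\<^sub>E (UNIV :: nat set).
       (\<Sum>i\<in>{1..b - 1} - {a}. m i * (\<Sum>j<r i. z (i, j))) = m b - l * m a}"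
proof -
  let ?W = "{v \<in> B b. fst v \<noteq> a}"
  have W: "?W = (SIGMA i:{1..b - 1} - {a}. {..<r i})"
    using assms by (auto simp: coords_below_def coords_def)
  have fin: "finite ?W"
    by (simp add: W)
  have weight: "(\<Sum>i\<in>{1..b - 1} - {a}. m i * (\<Sum>j<r i. z (i, j))) = (\<Sum>v\<in>?W. m (fst v) * z v)" for z :: "coord \<Rightarrow> nat"
    unfolding W sum_distrib_left by (subst sum.Sigma) (auto intro: sum.cong)
  define \<Psi> where "\<Psi> = (\<lambda>z :: coord \<Rightarrow> nat. \<Sum>v\<in>?W. Poly_Mapping.single v (z v))"
  have lookup_\<Psi>: "Poly_Mapping.lookup (\<Psi> z) v = (if v \<in> ?W then z v else 0)" for z v
  proof -
    have "Poly_Mapping.lookup (\<Psi> z) v = (\<Sum>w\<in>?W. if w = v then z v else 0)"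
      unfolding \<Psi>_def lookup_sum by (intro sum.cong) (auto simp: lookup_single when_def)
    then show ?thesis using fin by simp
  qed
  have keys_\<Psi>: "Poly_Mapping.keys (\<Psi> z) \<subseteq> ?W" for z
    by (auto simp: in_keys_iff lookup_\<Psi> split: if_splits)
  have wdegree_\<Psi>: "wdegree m (\<Psi> z) = (\<Sum>v\<in>?W. m (fst v) * z v)" for z
    unfolding wdegree_superset[OF fin keys_\<Psi>] by (intro sum.cong) (auto simp: lookup_\<Psi>)
  have "bij_betw (\<lambda>\<mu>. \<lambda>v\<in>?W. Poly_Mapping.lookup \<mu> v) (D_monomials m r t a b l)
    {z \<in> ?W \<rightarrow>\<^sub>E UNIV. (\<Sum>v\<in>?W. m (fst v) * z v) = m b - l * m a}"
  proof (rule bij_betw_byWitness[where f' = \<Psi>])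
    show "\<forall>\<mu>\<in>D_monomials m r t a b l. \<Psi> (\<lambda>v\<in>?W. Poly_Mapping.lookup \<mu> v) = \<mu>"
    proof (intro ballI poly_mapping_eqI)
      fix \<mu> v assume \<mu>: "\<mu> \<in> D_monomials m r t a b l"
      show "Poly_Mapping.lookup (\<Psi> (\<lambda>v\<in>?W. Poly_Mapping.lookup \<mu> v)) v = Poly_Mapping.lookup \<mu> v"
      proof (cases "v \<in> ?W")
        case False
        then have "v \<notin> Poly_Mapping.keys \<mu>"
          using \<mu> by (auto simp: D_monomials_def monomials_of_def)
        with False show ?thesis by (simp only: lookup_\<Psi> if_False in_keys_iff not_not)
      qed (simp add: lookup_\<Psi>)
    qed
    show "\<forall>z\<in>{z \<in> ?W \<rightarrow>\<^sub>E UNIV. (\<Sum>v\<in>?W. m (fst v) * z v) = m b - l * m a}. (\<lambda>v\<in>?W. Poly_Mapping.lookup (\<Psi> z) v) = z"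
      by (auto simp: lookup_\<Psi> fun_eq_iff PiE_iff extensional_def)
    show "(\<lambda>\<mu>. \<lambda>v\<in>?W. Poly_Mapping.lookup \<mu> v) ` D_monomials m r t a b l \<subseteq>
        {z \<in> ?W \<rightarrow>\<^sub>E UNIV. (\<Sum>v\<in>?W. m (fst v) * z v) = m b - l * m a}"
    proof (intro subsetI, elim imageE)
      fix z \<mu> assume z: "z = (\<lambda>v\<in>?W. Poly_Mapping.lookup \<mu> v)" and \<mu>: "\<mu> \<in> D_monomials m r t a b l"
      have "(\<Sum>v\<in>?W. m (fst v) * z v) = (\<Sum>v\<in>?W. m (fst v) * Poly_Mapping.lookup \<mu> v)"
        by (intro sum.cong) (auto simp: z)
      also have "\<dots> = m b - l * m a"
        using \<mu> wdegree_superset[OF fin, of \<mu> m] by (auto simp: D_monomials_def monomials_of_def)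
      finally show "z \<in> {z \<in> ?W \<rightarrow>\<^sub>E UNIV. (\<Sum>v\<in>?W. m (fst v) * z v) = m b - l * m a}"
        by (simp add: z)
    qed
    show "\<Psi> ` {z \<in> ?W \<rightarrow>\<^sub>E UNIV. (\<Sum>v\<in>?W. m (fst v) * z v) = m b - l * m a} \<subseteq> D_monomials m r t a b l"
      using keys_\<Psi> by (auto simp: D_monomials_def monomials_of_def wdegree_\<Psi>)
  qed
  then show ?thesis
    unfolding weight by (rule bij_betw_same_card)
qed

lemma natural_sym_sum_coords:
  fixes h :: "'a::comm_ring_1 \<Rightarrow> 'b::comm_ring_1"
  assumes h: "comm_ring_hom h" and ab: "a \<in> {1..t}" "b \<in> {1..t}" "a < b"
  shows "natural_along r t h (unip_factor TYPE('a) m r t b)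
     (rbasis (sym_sum_rep m r t a b :: ('a mat, _, 'a) mrep)) (sym_sum_coords m r t a b) (sym_sum_coords m r t a b)"
proof (rule natural_relabel[OF h ab(2), where \<Phi> = "split_index a"])
  fix x assume x: "x \<in> rbasis (sym_sum_rep m r t a b :: ('a mat, _, 'a) mrep)"
  then have x': "x \<in> rbasis (sym_sum_rep m r t a b :: ('b mat, _, 'b) mrep)"
    by (simp add: rbasis_sym_sum)
  show "split_index a x \<in> {..<r b} \<times> K_monomials m r t b"
    using bij_betw_split_index[OF ab] x by (rule bij_betw_apply)
  show "sym_sum_coords m r t a b u x = unip_coords m r t b u (split_index a x)" for u :: "'a polymap"
    using x by (simp add: sym_sum_coords_split_index)
  show "sym_sum_coords m r t a b u x = unip_coords m r t b u (split_index a x)" for u :: "'b polymap"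
    using x' by (simp add: sym_sum_coords_split_index)
qed

lemma natural_tensor_sum_coords:
  fixes h :: "'a::comm_ring_1 \<Rightarrow> 'b::comm_ring_1"
  assumes h: "comm_ring_hom h" and ab: "a \<in> {1..t}" "b \<in> {1..t}" "a < b"
    and few: "r a = 1 \<or> (\<forall>l\<in>{2..m b div m a}. D_monomials m r t a b l = {})"
  shows "natural_along r t h (unip_factor TYPE('a) m r t b)
     (rbasis (tensor_sum_rep m r t a b :: ('a mat, _, 'a) mrep)) (tensor_sum_coords m r t a b) (tensor_sum_coords m r t a b)"
proof (rule natural_relabel[OF h ab(2), where \<Phi> = "\<lambda>x. split_index a (map_prod id (map_prod id mset) x)"])
  fix x assume x: "x \<in> rbasis (tensor_sum_rep m r t a b :: ('a mat, _, 'a) mrep)"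
  then have x': "x \<in> rbasis (tensor_sum_rep m r t a b :: ('b mat, _, 'b) mrep)"
    by (simp add: rbasis_tensor_sum)
  show "split_index a (map_prod id (map_prod id mset) x) \<in> {..<r b} \<times> K_monomials m r t b"
    using bij_betw_tensor_index[OF ab few] x by (rule bij_betw_apply)
  show "tensor_sum_coords m r t a b u x = unip_coords m r t b u (split_index a (map_prod id (map_prod id mset) x))"
    for u :: "'a polymap"
    using x by (simp add: tensor_sum_coords_split_index)
  show "tensor_sum_coords m r t a b u x = unip_coords m r t b u (split_index a (map_prod id (map_prod id mset) x))"
    for u :: "'b polymap"
    using x' by (simp add: tensor_sum_coords_split_index)
qed

end

theorem theorem7p7:
  fixes m r :: "nat \<Rightarrow> nat" and t :: nat
    and h :: "'a::comm_ring_1 \<Rightarrow> 'b::comm_ring_1"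
  assumes m_pos: "\<forall>i\<in>{1..t}. 1 \<le> m i"
    and m_mono: "strict_mono_on {1..t} m"
    and r_pos: "\<forall>i\<in>{1..t}. 1 \<le> r i"
    and r_sum: "2 \<le> (\<Sum>i=1..t. r i)"
  shows "let
      G = equiv_aut TYPE('a) m r t;
      G' = equiv_aut TYPE('b) m r t;
      L = lin_subgroup TYPE('a) r t;
      U = unip TYPE('a) m r t;
      Ua = unip_factor TYPE('a) m r t
    in
      \<comment> \<open>decomposition\<close>
      group G \<and>
      lin_aut r t \<in> mon (GL_prod TYPE('a) r t) G \<and>
      U \<lhd> G \<and> U \<inter> L = {\<one>\<^bsub>G\<^esub>} \<and> U <#>\<^bsub>G\<^esub> L = carrier G \<and>
      succ_semidirect (G\<lparr>carrier := U\<rparr>) {1..t} Ua \<and>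
      succ_semidirect G {0..t} (\<lambda>a. if a = 0 then L else Ua a) \<and>
      \<comment> \<open>the factors as vector groups\<close>
      (\<forall>a\<in>{1..t}. finite (K_monomials m r t a) \<and>
         card ({..<r a} \<times> K_monomials m r t a) = r a * card (K_monomials m r t a) \<and>
         unip_coords m r t a \<in>
           iso (G\<lparr>carrier := Ua a\<rparr>) (vector_group ({..<r a} \<times> K_monomials m r t a))) \<and>
      Ua 1 = {\<one>\<^bsub>G\<^esub>} \<and>
      \<comment> \<open>compatibility with base change\<close>
      (comm_ring_hom h \<longrightarrow>
         base_change r t h \<in> hom G G' \<and>
         (\<forall>A\<in>carrier (GL_prod TYPE('a) r t).
            base_change r t h (lin_aut r t A) = lin_aut r t (\<lambda>i\<in>{1..t}. map_mat h (A i))) \<and>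
         (\<forall>a\<in>{1..t}.
            base_change r t h ` Ua a \<subseteq> unip_factor TYPE('b) m r t a \<and>
            natural_along r t h (Ua a) ({..<r a} \<times> K_monomials m r t a)
              (unip_coords m r t a) (unip_coords m r t a))) \<and>
      \<comment> \<open>the conjugation actions\<close>
      (\<forall>a\<in>{1..t}. \<forall>b\<in>{1..t}.
         (\<forall>g\<in>carrier (GL TYPE('a) (r a)). conj_by G (GL_factor r t a g) ` Ua b = Ua b) \<and>
         (a > b \<longrightarrow>
            (\<forall>g\<in>carrier (GL TYPE('a) (r a)). \<forall>u\<in>Ua b. conj_by G (GL_factor r t a g) u = u)) \<and>
         (a = b \<longrightarrow>
            conj_rep_iso G (Ua a) (GL TYPE('a) (r a)) (GL_factor r t a)
              (tensor_rep (std_rep (r a)) (triv_rep (K_monomials m r t a)))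
              (unip_coords m r t a)) \<and>
         (a < b \<longrightarrow>
            (\<forall>l\<in>{0..m b div m a}.
               finite (D_monomials m r t a b l) \<and>
               card ({..<r b} \<times> D_monomials m r t a b l) = r b * card (D_monomials m r t a b l) \<and>
               card (D_monomials m r t a b l) =
                 card {z \<in> {v \<in> coords_below r t b. fst v \<noteq> a} \<rightarrow>\<^sub>E (UNIV :: nat set).
                   (\<Sum>i\<in>{1..b - 1} - {a}. m i * (\<Sum>j<r i. z (i, j))) = m b - l * m a}) \<and>
            conj_rep_iso G (Ua b) (GL TYPE('a) (r a)) (GL_factor r t a)
              (sym_sum_rep m r t a b) (sym_sum_coords m r t a b) \<and>
            (comm_ring_hom h \<longrightarrow>
               natural_along r t h (Ua b)
                 (rbasis (sym_sum_rep m r t a b :: ('a mat, _, 'a) mrep))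
                 (sym_sum_coords m r t a b) (sym_sum_coords m r t a b)) \<and>
            \<comment> \<open>symmetric powers versus tensor powers\<close>
            (r a = 1 \<or> (\<forall>l\<in>{2..m b div m a}. D_monomials m r t a b l = {}) \<longrightarrow>
               conj_rep_iso G (Ua b) (GL TYPE('a) (r a)) (GL_factor r t a)
                 (tensor_sum_rep m r t a b) (tensor_sum_coords m r t a b) \<and>
               (comm_ring_hom h \<longrightarrow>
                  natural_along r t h (Ua b)
                    (rbasis (tensor_sum_rep m r t a b :: ('a mat, _, 'a) mrep))
                    (tensor_sum_coords m r t a b) (tensor_sum_coords m r t a b)))))"
proof -
  interpret weighted_blocks m r t
    using m_pos m_mono by unfold_locales auto
  let ?G = "equiv_aut TYPE('a) m r t" and ?Ua = "unip_factor TYPE('a) m r t"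
  show ?thesis
    unfolding Let_def
  proof (intro conjI ballI impI)
    show "group ?G"
      by (rule group_equiv_aut)
    show "lin_aut r t \<in> mon (GL_prod TYPE('a) r t) ?G"
      by (rule hom_section_mon[OF lin_aut_hom]) (rule lin_part_lin_aut)
    show "unip TYPE('a) m r t \<lhd> ?G"
      by (rule normal_unip)
    show "unip TYPE('a) m r t \<inter> lin_subgroup TYPE('a) r t = {\<one>\<^bsub>?G\<^esub>}"
      by (simp add: unip_Int_lin)
    show "unip TYPE('a) m r t <#>\<^bsub>?G\<^esub> lin_subgroup TYPE('a) r t = carrier ?G"
      by (rule unip_mult_lin)
    show "succ_semidirect (?G\<lparr>carrier := unip TYPE('a) m r t\<rparr>) {1..t} ?Ua"
      by (rule unip_succ_semidirect)
    show "succ_semidirect ?G {0..t} (\<lambda>a. if a = 0 then lin_subgroup TYPE('a) r t else ?Ua a)"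
      by (rule aut_succ_semidirect)
    show "?Ua 1 = {\<one>\<^bsub>?G\<^esub>}"
      by (simp only: unip_factor_first one_equiv_aut)
  next
    assume h: "comm_ring_hom h"
    show "base_change r t h \<in> hom ?G (equiv_aut TYPE('b) m r t)"
      by (rule base_change_hom[OF h])
    show "base_change r t h (lin_aut r t A) = lin_aut r t (\<lambda>i\<in>{1..t}. map_mat h (A i))"
      if "A \<in> carrier (GL_prod TYPE('a) r t)" for A
      by (rule base_change_lin_aut[OF h that])
    fix a assume a: "a \<in> {1..t}"
    show "base_change r t h ` ?Ua a \<subseteq> unip_factor TYPE('b) m r t a"
      by (rule base_change_unip_factor[OF h])
    show "natural_along r t h (?Ua a) ({..<r a} \<times> K_monomials m r t a) (unip_coords m r t a) (unip_coords m r t a)"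
      by (rule natural_unip_coords[OF h a])
  next
    fix a assume a: "a \<in> {1..t}"
    show "finite (K_monomials m r t a)"
      by (rule finite_K_monomials)
    show "card ({..<r a} \<times> K_monomials m r t a) = r a * card (K_monomials m r t a)"
      by (simp add: card_cartesian_product)
    show "unip_coords m r t a \<in> iso (?G\<lparr>carrier := ?Ua a\<rparr>) (vector_group ({..<r a} \<times> K_monomials m r t a))"
      by (rule unip_coords_iso[OF a])
    fix b assume b: "b \<in> {1..t}"
    show "conj_by ?G (GL_factor r t a g) ` ?Ua b = ?Ua b" if "g \<in> carrier (GL TYPE('a) (r a))" for g
      by (rule conj_lin_unip_factor_image[OF GLf_lin_subgroup[OF that]])
    show "conj_by ?G (GL_factor r t a g) u = u"
      if "b < a" "g \<in> carrier (GL TYPE('a) (r a))" "u \<in> ?Ua b" for g u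
      by (rule conj_GLf_above[OF that(2,1) b that(3)])
    show "conj_rep_iso ?G (?Ua a) (GL TYPE('a) (r a)) (GL_factor r t a)
        (tensor_rep (std_rep (r a)) (triv_rep (K_monomials m r t a))) (unip_coords m r t a)"
      by (rule conj_rep_iso_equal[OF a])
    assume ab: "a < b"
    show "conj_rep_iso ?G (?Ua b) (GL TYPE('a) (r a)) (GL_factor r t a)
        (sym_sum_rep m r t a b) (sym_sum_coords m r t a b)"
      by (rule conj_rep_iso_sym_sum[OF a b ab])
    show "natural_along r t h (?Ua b) (rbasis (sym_sum_rep m r t a b :: ('a mat, _, 'a) mrep))
        (sym_sum_coords m r t a b) (sym_sum_coords m r t a b)" if "comm_ring_hom h"
      by (rule natural_sym_sum_coords[OF that a b ab])
    show "finite (D_monomials m r t a b l)" for l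
      by (rule finite_D_monomials)
    show "card ({..<r b} \<times> D_monomials m r t a b l) = r b * card (D_monomials m r t a b l)" for l
      by (simp add: card_cartesian_product)
    show "card (D_monomials m r t a b l) =
        card {z \<in> {v \<in> coords_below r t b. fst v \<noteq> a} \<rightarrow>\<^sub>E (UNIV :: nat set).
          (\<Sum>i\<in>{1..b - 1} - {a}. m i * (\<Sum>j<r i. z (i, j))) = m b - l * m a}" for l
      by (rule card_D_monomials[OF b])
    assume few: "r a = 1 \<or> (\<forall>l\<in>{2..m b div m a}. D_monomials m r t a b l = {})"
    show "conj_rep_iso ?G (?Ua b) (GL TYPE('a) (r a)) (GL_factor r t a)
        (tensor_sum_rep m r t a b) (tensor_sum_coords m r t a b)"
      by (rule conj_rep_iso_tensor_sum[OF a b ab few])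
    show "natural_along r t h (?Ua b) (rbasis (tensor_sum_rep m r t a b :: ('a mat, _, 'a) mrep))
        (tensor_sum_coords m r t a b) (tensor_sum_coords m r t a b)" if "comm_ring_hom h"
      by (rule natural_tensor_sum_coords[OF that a b ab few])
  qed
qed

end
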